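(* Let $\mu\in\mathbb{R}$, $\sigma>0$ be constants, $\delta,\beta,L_{max}>0$, $\lambda\le0$, $0<\alpha\le1$, and let $a_{1,2},b_{1,2},c_{1,2},d_{1,2}$, $G$, $A_1,B_2,C_1,D_2$ be as in the context. Assume $$(-b_2)\frac{L_{max}}{\delta}+\lambda d_2-1>0 .$$ Let $b^*$ be the unique positive solution of $G(b)=0$, and define, for $r,t,x\in[0,\infty)$, $$\nu(r,t,x)=\begin{cases} e^{-\delta(t-r)}A_1(b^* )(e^{a_1x}-e^{a_2x})+e^{-\beta(t-r)}\big(-\lambda+C_1(b^* )e^{c_1x}+(\lambda-C_1(b^* ))e^{c_2x}\big)+\lambda(1-\alpha), & 0\le x<b^*,\\[4pt] e^{-\delta(t-r)}\big(\tfrac{L_{max}}{\delta}+B_2(b^* )e^{b_2x}\big)+e^{-\beta(t-r)}\big(-\lambda+D_2(b^* )e^{d_2x}\big)+\lambda(1-\alpha), & x\ge b^*,\end{cases}$$ and $$\hat l(t,x)=\begin{cases}0,&0\le x<b^*,\\ L_{max},&x\ge b^*.\end{cases}$$ Then $\nu$ (with $\hat l$) solves the extended HJB system given in the context, $V(t,x)=\nu(t,t,x)$ is an equilibrium value function, and $\hat l$ is the associated equilibrium control.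
   Context: Setting. $W$ is a standard Brownian motion. $\Theta$ is the set of measurable feedback functions $l:[0,\infty)^2\to[0,L_{max}]$. For $l\in\Theta$ the controlled process is $dX^l_s=(\mu-l(s,X^l_s))ds+\sigma\,dW_s$, $X^l_t=x$, with ruin time $\tau^l=\inf\{s\ge t:X^l_s\le0\}$; $\mathbb{E}_{t,x}$ is expectation given $X^l_t=x$. The reward is $$J(t,x,l)=\mathbb{E}_{t,x}\Big[\int_t^{\tau^l}e^{-\delta(s-t)}l(s,X^l_s)\,ds+\lambda\big(e^{-\beta(\tau^l-t)}-\alpha\big)\Big],\qquad e^{-\beta\cdot\infty}=0.$$ Equilibrium control: $\hat l\in\Theta$ is an equilibrium control if for every $l\in\Theta$ and every $(t,x)$ with $t,x\ge0$, $\liminf_{h\downarrow0}\frac{J(t,x,\hat l)-J(t,x,l_h)}{h}\ge0$, where $l_h(s,y)=l(s,y)$ for $t\le s<t+h$ and $l_h(s,y)=\hat l(s,y)$ for $s\ge t+h$. Its equilibrium value function is $V(t,x)=J(t,x,\hat l)$. Extended HJB system for a function $g(r,t,x)=g^r(t,x)$: with $\mathcal{A}^l f(t,x)=\frac{\partial}{\partial t}f+(\mu-l)\frac{\partial}{\partial x}f+\frac{\sigma^2}{2}\frac{\partial^2}{\partial x^2}f$ (acting on $g^r$ with $r$ fixed; $\mathcal{A}^l g^t(t,x)$ means evaluation at $r=t$) and $H(r,s,l)=e^{-\delta(s-r)}l-\lambda\beta e^{-\beta(s-r)}$, (i) $\sup_{l\in[0,L_{max}]}\{\mathcal{A}^l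 g^t(t,x)+H(t,t,l)\}=0$ for all $t,x\ge0$, the supremum being attained at $\hat l(t,x)$; (ii) $\mathcal{A}^{\hat l}g^r(t,x)+H(r,t,\hat l(t,x))=0$ for all $r,t,x\ge0$; (iii) $\lim_{w\to\infty}\mathbb{E}_{t,x}\big[g^r(w\wedge\tau^{\hat l},X^{\hat l}_{w\wedge\tau^{\hat l}})\big]=\lambda(1-\alpha)$ for all $r,t,x\ge0$. At the threshold $x=b^*$ the second $x$-derivative is read as the right-hand limit where it does not exist. Constants: $$a_{1,2}=-\tfrac{\mu}{\sigma^2}\pm\sqrt{\tfrac{\mu^2}{\sigma^4}+\tfrac{2\delta}{\sigma^2}},\quad b_{1,2}=-\tfrac{\mu-L_{max}}{\sigma^2}\pm\sqrt{\tfrac{(\mu-L_{max})^2}{\sigma^4}+\tfrac{2\delta}{\sigma^2}},$$ $$c_{1,2}=-\tfrac{\mu}{\sigma^2}\pm\sqrt{\tfrac{\mu^2}{\sigma^4}+\tfrac{2\beta}{\sigma^2}},\quad d_{1,2}=-\tfrac{\mu-L_{max}}{\sigma^2}\pm\sqrt{\tfrac{(\mu-L_{max})^2}{\sigma^4}+\tfrac{2\beta}{\sigma^2}}$$ (index 1 for $+$, index 2 for $-$). For $b\ge0$: $$A_1(b)=-\frac{L_{max}}{\delta}\frac{b_2}{(a_1-b_2)e^{a_1b}+(b_2-a_2)e^{a_2b}},\qquad B_2(b)=\frac{A_1(b)}{b_2e^{b_2b}}(a_1e^{a_1b}-a_2e^{a_2b}),$$ $$C_1(b)=\frac{\lambda(c_2-d_2)e^{c_2b}}{(d_2-c_1)e^{c_1b}+(c_2-d_2)e^{c_2b}},\qquad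 D_2(b)=\frac{C_1(b)e^{c_1b}+(\lambda-C_1(b))e^{c_2b}}{e^{d_2b}},$$ $$G(b)=\frac{L_{max}}{\delta}\frac{(-b_2)(a_1e^{a_1b}-a_2e^{a_2b})}{(a_1-b_2)e^{a_1b}+(b_2-a_2)e^{a_2b}}+\lambda\frac{(c_2-c_1)d_2e^{(c_1+c_2)b}}{(d_2-c_1)e^{c_1b}+(c_2-d_2)e^{c_2b}}-1 .$$ Under the assumption of the claim, $G(b)=0$ has a unique positive solution. *)

theory Defs
  imports "HOL-Probability.Probability" "HOL-Probability.Stopping_Time"
begin

section \<open>Brownian motion and controlled processes\<close>

text \<open>Standard Brownian motion relative to a filtration. Only times \<open>\<ge> 0\<close> matter; the members of
  \<open>F\<close> at negative indices are irrelevant.\<close>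

locale brownian_motion = prob_space M + filtration "space M" F
  for M :: "'a measure" and F :: "real \<Rightarrow> 'a measure" +
  fixes W :: "real \<Rightarrow> 'a \<Rightarrow> real"
  assumes sets_F_le: "sets (F s) \<subseteq> sets M"
    and adapted: "0 \<le> s \<Longrightarrow> W s \<in> borel_measurable (F s)"
    and start: "AE \<omega> in M. W 0 \<omega> = 0"
    and increment_normal: "\<lbrakk>0 \<le> s; s < u\<rbrakk> \<Longrightarrow>
          distributed M lborel (\<lambda>\<omega>. W u \<omega> - W s \<omega>) (normal_density 0 (sqrt (u - s)))"
    and increment_indep: "\<lbrakk>0 \<le> s; s < u\<rbrakk> \<Longrightarrow>
          indep_set (sets (F s)) (sets (vimage_algebra (space M) (\<lambda>\<omega>. W u \<omega> - W s \<omega>) borel))"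
    and continuous_paths: "AE \<omega> in M. continuous_on {0..} (\<lambda>s. W s \<omega>)"

type_synonym control = "real \<Rightarrow> real \<Rightarrow> real"

text \<open>The feedback functions. Only the values on the quadrant \<open>[0,\<infinity>)\<^sup>2\<close> are constrained,
  and only they are used below.\<close>

definition controls :: "real \<Rightarrow> control set" where
  "controls Lmax = {l.
     (\<lambda>p. l (fst p) (snd p)) \<in> borel_measurable (restrict_space borel ({0..} \<times> {0..})) \<and>
     (\<forall>s\<ge>0. \<forall>y\<ge>0. l s y \<in> {0..Lmax})}"

text \<open>Takes the value \<open>\<infinity>\<close> if the path is never ruined, as \<open>Inf {} = \<infinity>\<close> in \<open>ereal\<close>.\<close>

definition ruin_time :: "real \<Rightarrow> (real \<Rightarrow> 'a \<Rightarrow> real) \<Rightarrow> 'a \<Rightarrow> ereal" where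
  "ruin_time t Y \<omega> = Inf (ereal ` {s. t \<le> s \<and> Y s \<omega> \<le> 0})"

text \<open>\<open>Y\<close> solves \<open>dY = (\<mu> - l(s,Y)) ds + \<sigma> dW\<close>, \<open>Y\<^sub>t = x\<close>. As \<open>\<sigma>\<close> is constant, the stochastic
  integral is just \<open>\<sigma> (W\<^sub>s - W\<^sub>t)\<close>. Feedback functions are only given for nonnegative states,
  so the equation is required up to and including the ruin time; beyond it \<open>Y\<close> is never used.
  The case \<open>s = t\<close> is the initial condition.\<close>

definition controlled_process ::
  "'a measure \<Rightarrow> (real \<Rightarrow> 'a measure) \<Rightarrow> (real \<Rightarrow> 'a \<Rightarrow> real) \<Rightarrow> real \<Rightarrow> real \<Rightarrow>
   control \<Rightarrow> real \<Rightarrow> real \<Rightarrow> (real \<Rightarrow> 'a \<Rightarrow> real) \<Rightarrow> bool" where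
  "controlled_process M F W \<mu> \<sigma> l t x Y \<longleftrightarrow>
     (\<forall>s\<ge>t. Y s \<in> borel_measurable (F s)) \<and>
     (\<forall>\<omega>\<in>space M. continuous_on {t..} (\<lambda>s. Y s \<omega>)) \<and>
     (AE \<omega> in M. \<forall>s\<ge>t. ereal s \<le> ruin_time t Y \<omega> \<longrightarrow>
        Y s \<omega> = x + (LINT u:{t..s}|lborel. \<mu> - l u (Y u \<omega>)) + \<sigma> * (W s \<omega> - W t \<omega>))"


section \<open>Reward and equilibrium\<close>

text \<open>A family \<open>X\<close> provides, for each control \<open>l\<close> and initial datum \<open>(t,x)\<close>, the controlled
  process \<open>X l t x\<close>.\<close>

type_synonym 'a process_family = "control \<Rightarrow> real \<Rightarrow> real \<Rightarrow> real \<Rightarrow> 'a \<Rightarrow> real"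

definition discount :: "real \<Rightarrow> ereal \<Rightarrow> real" where
  "discount \<beta> z = (if z = \<infinity> then 0 else exp (- \<beta> * real_of_ereal z))"

definition reward ::
  "'a measure \<Rightarrow> 'a process_family \<Rightarrow> real \<Rightarrow> real \<Rightarrow> real \<Rightarrow> real \<Rightarrow>
   real \<Rightarrow> real \<Rightarrow> control \<Rightarrow> real" where
  "reward M X \<delta> \<beta> lam \<alpha> t x l =
     (\<integral>\<omega>. (LINT s:{s. t \<le> s \<and> ereal s < ruin_time t (X l t x) \<omega>}|lborel.
                exp (- \<delta> * (s - t)) * l s (X l t x s \<omega>))
           + lam * (discount \<beta> (ruin_time t (X l t x) \<omega> - ereal t) - \<alpha>) \<partial>M)"

definition deviation :: "real \<Rightarrow> real \<Rightarrow> control \<Rightarrow> control \<Rightarrow> control" where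
  "deviation t h l lhat = (\<lambda>s y. if t \<le> s \<and> s < t + h then l s y else lhat s y)"

definition equilibrium_control ::
  "'a measure \<Rightarrow> 'a process_family \<Rightarrow> real \<Rightarrow> real \<Rightarrow> real \<Rightarrow> real \<Rightarrow>
   real \<Rightarrow> control \<Rightarrow> bool" where
  "equilibrium_control M X \<delta> \<beta> lam \<alpha> Lmax lhat \<longleftrightarrow>
     lhat \<in> controls Lmax \<and>
     (\<forall>l \<in> controls Lmax. \<forall>t\<ge>0. \<forall>x\<ge>0.
        Liminf (at_right 0) (\<lambda>h. ereal
          ((reward M X \<delta> \<beta> lam \<alpha> t x lhat
            - reward M X \<delta> \<beta> lam \<alpha> t x (deviation t h l lhat)) / h)) \<ge> 0)"

definition equilibrium_value_function ::
  "'a measure \<Rightarrow> 'a process_family \<Rightarrow> real \<Rightarrow> real \<Rightarrow> real \<Rightarrow> real \<Rightarrow>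
   real \<Rightarrow> control \<Rightarrow> (real \<Rightarrow> real \<Rightarrow> real) \<Rightarrow> bool" where
  "equilibrium_value_function M X \<delta> \<beta> lam \<alpha> Lmax lhat V \<longleftrightarrow>
     equilibrium_control M X \<delta> \<beta> lam \<alpha> Lmax lhat \<and>
     (\<forall>t\<ge>0. \<forall>x\<ge>0. V t x = reward M X \<delta> \<beta> lam \<alpha> t x lhat)"


section \<open>The extended HJB system\<close>

text \<open>Derivatives on the domain \<open>[0,\<infinity>)\<^sup>2\<close>, hence one-sided at the boundary.\<close>

definition deriv_t :: "(real \<Rightarrow> real \<Rightarrow> real) \<Rightarrow> real \<Rightarrow> real \<Rightarrow> real" where
  "deriv_t f t x = vector_derivative (\<lambda>s. f s x) (at t within {0..})"

definition deriv_x :: "(real \<Rightarrow> real \<Rightarrow> real) \<Rightarrow> real \<Rightarrow> real \<Rightarrow> real" where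
  "deriv_x f t x = vector_derivative (\<lambda>y. f t y) (at x within {0..})"

text \<open>Where the second derivative does not exist, its right-hand limit is taken.
  By \<open>smooth_off\<close> below, this can happen only at the threshold.\<close>

definition deriv_xx :: "(real \<Rightarrow> real \<Rightarrow> real) \<Rightarrow> real \<Rightarrow> real \<Rightarrow> real" where
  "deriv_xx f t x =
     (if (\<lambda>y. deriv_x f t y) differentiable (at x within {0..})
      then deriv_x (deriv_x f) t x
      else Lim (at_right x) (\<lambda>y. deriv_x (deriv_x f) t y))"

definition smooth_off :: "real \<Rightarrow> (real \<Rightarrow> real \<Rightarrow> real) \<Rightarrow> bool" where
  "smooth_off b f \<longleftrightarrow> (\<forall>t\<ge>0. \<forall>x\<ge>0.
     (\<lambda>s. f s x) differentiable (at t within {0..}) \<and>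
     (\<lambda>y. f t y) differentiable (at x within {0..}) \<and>
     ((\<lambda>y. deriv_x f t y) differentiable (at x within {0..}) \<or>
      x = b \<and> (\<exists>k. ((\<lambda>y. deriv_x (deriv_x f) t y) \<longlongrightarrow> k) (at_right b))))"

definition generator ::
  "real \<Rightarrow> real \<Rightarrow> real \<Rightarrow> (real \<Rightarrow> real \<Rightarrow> real) \<Rightarrow> real \<Rightarrow> real \<Rightarrow> real" where
  "generator \<mu> \<sigma> c f t x =
     deriv_t f t x + (\<mu> - c) * deriv_x f t x + \<sigma>\<^sup>2 / 2 * deriv_xx f t x"

definition running ::
  "real \<Rightarrow> real \<Rightarrow> real \<Rightarrow> real \<Rightarrow> real \<Rightarrow> real \<Rightarrow> real" where
  "running \<delta> \<beta> lam r s c = exp (- \<delta> * (s - r)) * c - lam * \<beta> * exp (- \<beta> * (s - r))"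

text \<open>The first conjunct makes the derivatives in the system meaningful, \<open>b\<close> being the threshold;
  integrability does so for the expectation in the last one.\<close>

definition extended_HJB ::
  "'a measure \<Rightarrow> 'a process_family \<Rightarrow> real \<Rightarrow> real \<Rightarrow> real \<Rightarrow> real \<Rightarrow> real \<Rightarrow> real \<Rightarrow>
   real \<Rightarrow> real \<Rightarrow> control \<Rightarrow> (real \<Rightarrow> real \<Rightarrow> real \<Rightarrow> real) \<Rightarrow> bool" where
  "extended_HJB M X \<mu> \<sigma> \<delta> \<beta> lam \<alpha> Lmax b lhat g \<longleftrightarrow>
     (\<forall>r\<ge>0. smooth_off b (g r)) \<and>
     (\<forall>t\<ge>0. \<forall>x\<ge>0.
        (SUP c\<in>{0..Lmax}. generator \<mu> \<sigma> c (g t) t x + running \<delta> \<beta> lam t t c) = 0 \<and>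
        lhat t x \<in> {0..Lmax} \<and>
        generator \<mu> \<sigma> (lhat t x) (g t) t x + running \<delta> \<beta> lam t t (lhat t x) = 0) \<and>
     (\<forall>r\<ge>0. \<forall>t\<ge>0. \<forall>x\<ge>0.
        generator \<mu> \<sigma> (lhat t x) (g r) t x + running \<delta> \<beta> lam r t (lhat t x) = 0) \<and>
     (\<forall>r\<ge>0. \<forall>t\<ge>0. \<forall>x\<ge>0.
        let Y = X lhat t x;
            stop = (\<lambda>w \<omega>. real_of_ereal (min (ereal w) (ruin_time t Y \<omega>)))
        in (\<forall>w\<ge>t. integrable M (\<lambda>\<omega>. g r (stop w \<omega>) (Y (stop w \<omega>) \<omega>))) \<and>
           ((\<lambda>w. \<integral>\<omega>. g r (stop w \<omega>) (Y (stop w \<omega>) \<omega>) \<partial>M) \<longlongrightarrow> lam * (1 - \<alpha>)) at_top)"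


section \<open>The explicit candidate solution\<close>

text \<open>The two roots of \<open>\<sigma>\<^sup>2/2 z\<^sup>2 + m z - k = 0\<close>; the constants with index 1 and 2 are
  \<open>a\<close> for \<open>(m,k) = (\<mu>,\<delta>)\<close>, \<open>b\<close> for \<open>(\<mu> - Lmax,\<delta>)\<close>, \<open>c\<close> for \<open>(\<mu>,\<beta>)\<close> and \<open>d\<close> for
  \<open>(\<mu> - Lmax,\<beta>)\<close>.\<close>

definition root1 :: "real \<Rightarrow> real \<Rightarrow> real \<Rightarrow> real" where
  "root1 m \<sigma> k = - m / \<sigma>^2 + sqrt (m^2 / \<sigma>^4 + 2 * k / \<sigma>^2)"

definition root2 :: "real \<Rightarrow> real \<Rightarrow> real \<Rightarrow> real" where
  "root2 m \<sigma> k = - m / \<sigma>^2 - sqrt (m^2 / \<sigma>^4 + 2 * k / \<sigma>^2)"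

definition coeff_A1 :: "real \<Rightarrow> real \<Rightarrow> real \<Rightarrow> real \<Rightarrow> real \<Rightarrow> real" where
  "coeff_A1 \<mu> \<sigma> \<delta> Lmax b =
    (let a1 = root1 \<mu> \<sigma> \<delta>; a2 = root2 \<mu> \<sigma> \<delta>; b2 = root2 (\<mu> - Lmax) \<sigma> \<delta>
     in - (Lmax / \<delta>) * (b2 / ((a1 - b2) * exp (a1 * b) + (b2 - a2) * exp (a2 * b))))"

definition coeff_B2 :: "real \<Rightarrow> real \<Rightarrow> real \<Rightarrow> real \<Rightarrow> real \<Rightarrow> real" where
  "coeff_B2 \<mu> \<sigma> \<delta> Lmax b =
    (let a1 = root1 \<mu> \<sigma> \<delta>; a2 = root2 \<mu> \<sigma> \<delta>; b2 = root2 (\<mu> - Lmax) \<sigma> \<delta>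
     in coeff_A1 \<mu> \<sigma> \<delta> Lmax b / (b2 * exp (b2 * b)) * (a1 * exp (a1 * b) - a2 * exp (a2 * b)))"

definition coeff_C1 :: "real \<Rightarrow> real \<Rightarrow> real \<Rightarrow> real \<Rightarrow> real \<Rightarrow> real \<Rightarrow> real" where
  "coeff_C1 \<mu> \<sigma> \<beta> Lmax lam b =
    (let c1 = root1 \<mu> \<sigma> \<beta>; c2 = root2 \<mu> \<sigma> \<beta>; d2 = root2 (\<mu> - Lmax) \<sigma> \<beta>
     in lam * (c2 - d2) * exp (c2 * b) / ((d2 - c1) * exp (c1 * b) + (c2 - d2) * exp (c2 * b)))"

definition coeff_D2 :: "real \<Rightarrow> real \<Rightarrow> real \<Rightarrow> real \<Rightarrow> real \<Rightarrow> real \<Rightarrow> real" where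
  "coeff_D2 \<mu> \<sigma> \<beta> Lmax lam b =
    (let c1 = root1 \<mu> \<sigma> \<beta>; c2 = root2 \<mu> \<sigma> \<beta>; d2 = root2 (\<mu> - Lmax) \<sigma> \<beta>;
         C1 = coeff_C1 \<mu> \<sigma> \<beta> Lmax lam b
     in (C1 * exp (c1 * b) + (lam - C1) * exp (c2 * b)) / exp (d2 * b))"

definition threshold_fun ::
  "real \<Rightarrow> real \<Rightarrow> real \<Rightarrow> real \<Rightarrow> real \<Rightarrow> real \<Rightarrow> real \<Rightarrow> real" where
  "threshold_fun \<mu> \<sigma> \<delta> \<beta> Lmax lam b =
    (let a1 = root1 \<mu> \<sigma> \<delta>; a2 = root2 \<mu> \<sigma> \<delta>; b2 = root2 (\<mu> - Lmax) \<sigma> \<delta>;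
         c1 = root1 \<mu> \<sigma> \<beta>; c2 = root2 \<mu> \<sigma> \<beta>; d2 = root2 (\<mu> - Lmax) \<sigma> \<beta>
     in Lmax / \<delta> * ((- b2) * (a1 * exp (a1 * b) - a2 * exp (a2 * b))
            / ((a1 - b2) * exp (a1 * b) + (b2 - a2) * exp (a2 * b)))
        + lam * ((c2 - c1) * d2 * exp ((c1 + c2) * b)
            / ((d2 - c1) * exp (c1 * b) + (c2 - d2) * exp (c2 * b)))
        - 1)"

definition candidate ::
  "real \<Rightarrow> real \<Rightarrow> real \<Rightarrow> real \<Rightarrow> real \<Rightarrow> real \<Rightarrow> real \<Rightarrow> real \<Rightarrow>
   real \<Rightarrow> real \<Rightarrow> real \<Rightarrow> real" where
  "candidate \<mu> \<sigma> \<delta> \<beta> Lmax lam \<alpha> bs r t x =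
    (let a1 = root1 \<mu> \<sigma> \<delta>; a2 = root2 \<mu> \<sigma> \<delta>; b2 = root2 (\<mu> - Lmax) \<sigma> \<delta>;
         c1 = root1 \<mu> \<sigma> \<beta>; c2 = root2 \<mu> \<sigma> \<beta>; d2 = root2 (\<mu> - Lmax) \<sigma> \<beta>;
         A1 = coeff_A1 \<mu> \<sigma> \<delta> Lmax bs; B2 = coeff_B2 \<mu> \<sigma> \<delta> Lmax bs;
         C1 = coeff_C1 \<mu> \<sigma> \<beta> Lmax lam bs; D2 = coeff_D2 \<mu> \<sigma> \<beta> Lmax lam bs
     in if x < bs
        then exp (- \<delta> * (t - r)) * (A1 * (exp (a1 * x) - exp (a2 * x)))
             + exp (- \<beta> * (t - r)) * (- lam + C1 * exp (c1 * x) + (lam - C1) * exp (c2 * x))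
             + lam * (1 - \<alpha>)
        else exp (- \<delta> * (t - r)) * (Lmax / \<delta> + B2 * exp (b2 * x))
             + exp (- \<beta> * (t - r)) * (- lam + D2 * exp (d2 * x))
             + lam * (1 - \<alpha>))"

definition threshold_control :: "real \<Rightarrow> real \<Rightarrow> control" where
  "threshold_control Lmax bs = (\<lambda>t x. if x < bs then 0 else Lmax)"

end

theory Submission
  imports Defs
begin

text \<open>
  The candidate splits by discount factor:
  \<open>\<nu>(r,t,x) = exp (-\<delta>(t-r)) g(x) + exp (-\<beta>(t-r)) h(x) + \<lambda>(1-\<alpha>)\<close>, where \<open>g\<close> is the value of the dividends
  and \<open>h\<close>, up to a constant, that of the ruin payment under the threshold control. Both vanish at \<open>0\<close>, are \<open>C\<^sup>1\<close> with
  Lipschitz derivative, and solve a linear second-order equation on either side of the threshold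
  \<open>b\<close>; only their second derivatives jump there. The equations on the two sides differ by a
  multiple of the control, so that for every constant \<open>c\<close> the generator of \<open>\<nu>\<close> plus the running reward is
  \<open>(l\<^sub>b(x) - c) (exp (-\<delta>(t-r)) (g'(x) - 1) + exp (-\<beta>(t-r)) h'(x))\<close>, with \<open>l\<^sub>b\<close> the threshold control
  (\<open>candidate_generator\<close>). This vanishes for \<open>c = l\<^sub>b(x)\<close>. For \<open>r = t\<close> the second factor is
  \<open>g'(x) + h'(x) - 1\<close>, so the supremum over \<open>c\<close> is attained at \<open>l\<^sub>b\<close> as soon as the marginal value
  \<open>g' + h'\<close> is at least \<open>1\<close> below \<open>b\<close> and at most \<open>1\<close> above. The equation \<open>G(b) = 0\<close> says that it
  equals \<open>1\<close> at \<open>b\<close>. Above \<open>b\<close> it is a sum of decreasing exponentials; below \<open>b\<close> its monotonicity comes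
  from a maximum principle (\<open>marginal_below\<close>).

  The probabilistic half rests on one identity. For every admissible control \<open>l\<close>, Dynkin's formula
  for \<open>exp (-\<delta>(s-t)) g\<close> and \<open>exp (-\<beta>(s-t)) h\<close> along the process controlled by \<open>l\<close> gives
  \<open>J(t,x,l) = \<nu>(t,t,x) + E \<integral> (l - l\<^sub>b) (exp (-\<delta>(s-t)) (1 - g') - exp (-\<beta>(s-t)) h') ds\<close>, the
  integral running from \<open>t\<close> to ruin (\<open>reward_decomposition\<close>). With \<open>l = l\<^sub>b\<close> it yields
  \<open>J(t,x,l\<^sub>b) = \<nu>(t,t,x)\<close>. If \<open>l\<close> deviates from \<open>l\<^sub>b\<close> only during \<open>[t,t+\<epsilon>)\<close>, the integrand vanishes
  later, and before that it exceeds the nonpositive number \<open>(l - l\<^sub>b) (1 - g' - h')\<close>, up to a positive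
  factor, by at most a multiple of \<open>\<epsilon>\<close>: the two discount factors have had no time to separate. A
  deviation therefore gains at most \<open>O(\<epsilon>\<^sup>2)\<close>, which is the equilibrium property.

  As the noise is additive, Dynkin's formula follows from moments of increments alone. For a smooth
  test function, a Taylor expansion over a time step of length \<open>\<eta>\<close> leaves, besides a remainder of
  mean \<open>O(\<eta>\<^sup>3\<^sup>/\<^sup>2)\<close>, only terms that are orthogonal to the past (\<open>local_expansion\<close>,
  \<open>nonanticipating_orthogonal\<close>). Hence the compensated process has constant means
  (\<open>Q_martingale\<close>), and stopping it along finer and finer grids gives the formula at the ruin time.
  The kink is removed by replacing \<open>\<phi>\<close> with the difference quotients of its antiderivative: their
  second derivatives are difference quotients of \<open>\<phi>'\<close> and converge to the right derivative of
  \<open>\<phi>'\<close> at every point, the threshold included (\<open>dynkin_formula\<close>).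
\<close>


section \<open>Moments and independence of Brownian increments\<close>

lemma normal_moment_abs_odd_le:
  assumes "0 < (s::real)"
  shows "(\<integral>x. normal_density 0 s x * \<bar>x\<bar> ^ (2*k+1) \<partial>lborel) \<le> 2^k * fact k * s^(2*k+1)"
proof -
  have "sqrt (2/pi) \<le> 1" using pi_ge_two by simp
  then have "2^k * s^(2*k+1) * fact k * sqrt (2/pi) \<le> 2^k * s^(2*k+1) * fact k * 1"
    using assms by (intro mult_left_mono) auto
  moreover have "(\<integral>x. normal_density 0 s x * \<bar>x - 0\<bar> ^ (2*k+1) \<partial>lborel) = 2^k * s^(2*k+1) * fact k * sqrt (2/pi)"
    by (rule integral_normal_moment_abs_odd) fact
  ultimately show ?thesis by (simp add: mult_ac)
qed

context brownian_motion
begin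

lemma measurable_F: "0 \<le> s \<Longrightarrow> f \<in> borel_measurable (F s) \<Longrightarrow> f \<in> borel_measurable M"
  using sets_F_le[of s] by (auto simp: measurable_def space_F)

lemma W_measurable: "0 \<le> s \<Longrightarrow> W s \<in> borel_measurable M"
  using adapted measurable_F by blast

lemma increment_abs_moment_odd:
  assumes "0 \<le> v" "v < u"
  shows "integrable M (\<lambda>\<omega>. \<bar>W u \<omega> - W v \<omega>\<bar> ^ (2*k+1))"
    and "(\<integral>\<omega>. \<bar>W u \<omega> - W v \<omega>\<bar> ^ (2*k+1) \<partial>M) \<le> 2^k * fact k * sqrt (u - v) ^ (2*k+1)"
proof -
  have *: "0 < sqrt (u - v)" using assms by simp
  note D = increment_normal[OF assms]
  show "integrable M (\<lambda>\<omega>. \<bar>W u \<omega> - W v \<omega>\<bar> ^ (2*k+1))"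
    using integrable_normal_moment_abs[OF *, of 0 "2*k+1"]
    by (subst distributed_integrable[OF D, symmetric]) auto
  have "(\<integral>\<omega>. \<bar>W u \<omega> - W v \<omega>\<bar> ^ (2*k+1) \<partial>M)
      = (\<integral>x. normal_density 0 (sqrt (u-v)) x * \<bar>x\<bar> ^ (2*k+1) \<partial>lborel)"
    by (subst distributed_integral[OF D, symmetric]) auto
  then show "(\<integral>\<omega>. \<bar>W u \<omega> - W v \<omega>\<bar> ^ (2*k+1) \<partial>M) \<le> 2^k * fact k * sqrt (u - v) ^ (2*k+1)"
    using normal_moment_abs_odd_le[OF *, of k] by simp
qed

lemma increment_moments:
  assumes "0 \<le> v" "v < u"
  shows "integrable M (\<lambda>\<omega>. (W u \<omega> - W v \<omega>))" "(\<integral>\<omega>. W u \<omega> - W v \<omega> \<partial>M) = 0"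
    and "integrable M (\<lambda>\<omega>. (W u \<omega> - W v \<omega>)\<^sup>2)" "(\<integral>\<omega>. (W u \<omega> - W v \<omega>)\<^sup>2 \<partial>M) = u - v"
proof -
  have *: "0 < sqrt (u - v)" using assms by simp
  note D = increment_normal[OF assms]
  show "integrable M (\<lambda>\<omega>. (W u \<omega> - W v \<omega>))"
    using integrable_normal_moment[OF *, of 0 1]
    by (subst distributed_integrable[OF D, symmetric, of "\<lambda>x. x"]) auto
  show "integrable M (\<lambda>\<omega>. (W u \<omega> - W v \<omega>)\<^sup>2)"
    using integrable_normal_moment[OF *, of 0 2]
    by (subst distributed_integrable[OF D, symmetric, of "\<lambda>x. x^2"]) auto
  show e: "(\<integral>\<omega>. W u \<omega> - W v \<omega> \<partial>M) = 0"
    using normal_distributed_expectation[OF * D] by simp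
  show "(\<integral>\<omega>. (W u \<omega> - W v \<omega>)\<^sup>2 \<partial>M) = u - v"
    using normal_distributed_variance[OF * D] e assms by simp
qed

text \<open>The independence of an increment from the whole past \<open>F v\<close> passes to any single
  \<open>F v\<close>-measurable variable, since the latter generates a smaller \<sigma>-algebra.\<close>
lemma indep_var_increment:
  assumes "0 \<le> v" "v < u" and H: "H \<in> borel_measurable (F v)"
  shows "indep_var borel H borel (\<lambda>\<omega>. W u \<omega> - W v \<omega>)"
  unfolding indep_var_eq
proof (intro conjI)
  let ?I = "\<lambda>\<omega>. W u \<omega> - W v \<omega>"
  show "random_variable borel H" using measurable_F assms by blast
  show "random_variable borel ?I" using W_measurable assms by auto
  have 1: "sigma_sets (space M) {H -` A \<inter> space M |A. A \<in> sets borel} \<subseteq> sets (F v)"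
  proof -
    have "{H -` A \<inter> space M |A. A \<in> sets borel} \<subseteq> sets (F v)"
      using measurable_sets[OF H] by (auto simp: space_F)
    then show ?thesis by (rule sets.sigma_sets_subset[of _ "F v", unfolded space_F])
  qed
  have 2: "sigma_sets (space M) {?I -` A \<inter> space M |A. A \<in> sets borel}
     = sets (vimage_algebra (space M) ?I borel)"
    by (simp add: sets_vimage_algebra)
  show "indep_set (sigma_sets (space M) {H -` A \<inter> space M |A. A \<in> sets borel})
       (sigma_sets (space M) {?I -` A \<inter> space M |A. A \<in> sets borel})"
    using increment_indep[OF assms(1,2)] 1 unfolding 2 indep_sets2_eq by blast
qed

text \<open>The filtration need not contain the null sets, whereas paths of \<open>W\<close> are continuous only almost
  surely. Expressions built from a version with continuous paths are therefore adapted merely up to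
  a null set, which is all that expectations can see.\<close>
definition nonanticipating :: "real \<Rightarrow> ('a \<Rightarrow> real) \<Rightarrow> bool" where
  "nonanticipating v H \<longleftrightarrow> H \<in> borel_measurable M \<and>
     (\<exists>H0\<in>borel_measurable (F v). AE \<omega> in M. H \<omega> = H0 \<omega>)"

lemma nonanticipatingI:
  assumes "0 \<le> v" and H: "H \<in> borel_measurable (F v)"
  shows "nonanticipating v H"
proof -
  have "AE \<omega> in M. H \<omega> = H \<omega>" by simp
  with measurable_F[OF assms] H show ?thesis unfolding nonanticipating_def by blast
qed

lemma nonanticipating_compose2:
  assumes "nonanticipating v f" "nonanticipating v g" and k: "(\<lambda>(x,y). k x y) \<in> borel_measurable (borel \<Otimes>\<^sub>M borel)"
  shows "nonanticipating v (\<lambda>\<omega>. k (f \<omega>) (g \<omega>))"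
proof -
  obtain f0 g0 where *: "f0 \<in> borel_measurable (F v)" "g0 \<in> borel_measurable (F v)"
    and a: "AE \<omega> in M. f \<omega> = f0 \<omega>" "AE \<omega> in M. g \<omega> = g0 \<omega>"
    using assms unfolding nonanticipating_def by blast
  have m: "(\<lambda>\<omega>. k (f' \<omega>) (g' \<omega>)) \<in> borel_measurable A"
    if "f' \<in> borel_measurable A" "g' \<in> borel_measurable A" for f' g' :: "'a \<Rightarrow> real" and A
    using measurable_compose[OF measurable_Pair[OF that] k] by simp
  show ?thesis unfolding nonanticipating_def
  proof (intro conjI bexI[of _ "\<lambda>\<omega>. k (f0 \<omega>) (g0 \<omega>)"] m *)
    show "AE \<omega> in M. k (f \<omega>) (g \<omega>) = k (f0 \<omega>) (g0 \<omega>)" using a by eventually_elim simp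
  qed (use assms in \<open>simp_all add: nonanticipating_def\<close>)
qed

lemma nonanticipating_mult: "nonanticipating v f \<Longrightarrow> nonanticipating v g \<Longrightarrow> nonanticipating v (\<lambda>\<omega>. f \<omega> * g \<omega>)"
  by (rule nonanticipating_compose2) auto

lemma nonanticipating_compose:
  assumes "nonanticipating v f" "k \<in> borel_measurable borel" shows "nonanticipating v (\<lambda>\<omega>. k (f \<omega>))"
proof -
  have [measurable]: "k \<in> borel_measurable borel" by fact
  show ?thesis using nonanticipating_compose2[OF assms(1,1), of "\<lambda>x y. k x"] by auto
qed

text \<open>The first- and second-order noise terms of a Taylor expansion have mean zero when
  their coefficient is known at the beginning of the step.\<close>
lemma nonanticipating_orthogonal:
  assumes "0 \<le> v" "v < u" and H: "nonanticipating v H" and B: "\<And>\<omega>. \<omega> \<in> space M \<Longrightarrow> \<bar>H \<omega>\<bar> \<le> B"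
  shows "integrable M (\<lambda>\<omega>. H \<omega> * (W u \<omega> - W v \<omega>))"
    and "(\<integral>\<omega>. H \<omega> * (W u \<omega> - W v \<omega>) \<partial>M) = 0"
    and "integrable M (\<lambda>\<omega>. H \<omega> * ((W u \<omega> - W v \<omega>)\<^sup>2 - (u - v)))"
    and "(\<integral>\<omega>. H \<omega> * ((W u \<omega> - W v \<omega>)\<^sup>2 - (u - v)) \<partial>M) = 0"
proof -
  let ?I = "\<lambda>\<omega>. W u \<omega> - W v \<omega>"
  obtain H0 where H0: "H0 \<in> borel_measurable (F v)" and ae: "AE \<omega> in M. H \<omega> = H0 \<omega>"
    using H unfolding nonanticipating_def by blast
  have HM: "H \<in> borel_measurable M" using H by (simp add: nonanticipating_def)
  have iH: "integrable M H"
    using HM B by (intro integrable_const_bound[where B=B]) auto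
  have H0M: "H0 \<in> borel_measurable M" using measurable_F assms(1) H0 by blast
  have IM: "?I \<in> borel_measurable M" using W_measurable assms by auto
  have iH0: "integrable M H0" using iH integrable_cong_AE[OF HM H0M ae] by simp
  note mom = increment_moments[OF assms(1,2)]
  have ind: "indep_var borel H0 borel ?I" by (rule indep_var_increment) fact+
  have ind2: "indep_var borel H0 borel (\<lambda>\<omega>. (?I \<omega>)\<^sup>2 - (u - v))"
    using indep_var_compose[OF ind, of "\<lambda>x. x" borel "\<lambda>x. x^2 - (u-v)" borel] by (simp add: comp_def)
  have i2: "integrable M (\<lambda>\<omega>. (?I \<omega>)\<^sup>2 - (u - v))" using mom by auto
  have e2: "(\<integral>\<omega>. (?I \<omega>)\<^sup>2 - (u - v) \<partial>M) = 0" using mom by (simp add: prob_space)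
  have ae1: "AE \<omega> in M. H \<omega> * ?I \<omega> = H0 \<omega> * ?I \<omega>" using ae by eventually_elim simp
  have ae2: "AE \<omega> in M. H \<omega> * ((?I \<omega>)\<^sup>2 - (u-v)) = H0 \<omega> * ((?I \<omega>)\<^sup>2 - (u-v))"
    using ae by eventually_elim simp
  note m = HM H0M IM
  show "integrable M (\<lambda>\<omega>. H \<omega> * ?I \<omega>)"
    using indep_var_integrable[OF ind iH0 mom(1)]
    by (subst integrable_cong_AE[OF _ _ ae1]) (use m in auto)
  show "(\<integral>\<omega>. H \<omega> * ?I \<omega> \<partial>M) = 0"
    using indep_var_lebesgue_integral[OF ind iH0 mom(1)] mom(2)
    by (subst integral_cong_AE[OF _ _ ae1]) (use m in auto)
  show "integrable M (\<lambda>\<omega>. H \<omega> * ((?I \<omega>)\<^sup>2 - (u-v)))"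
    using indep_var_integrable[OF ind2 iH0 i2]
    by (subst integrable_cong_AE[OF _ _ ae2]) (use m in auto)
  show "(\<integral>\<omega>. H \<omega> * ((?I \<omega>)\<^sup>2 - (u-v)) \<partial>M) = 0"
    using indep_var_lebesgue_integral[OF ind2 iH0 i2] e2
    by (subst integral_cong_AE[OF _ _ ae2]) (use m in auto)
qed

end

section \<open>A second-order expansion along one short time step\<close>

lemma set_integrable_bounded_Icc:
  fixes f :: "real \<Rightarrow> real"
  assumes [measurable]: "f \<in> borel_measurable borel" and B: "\<And>u. a \<le> u \<Longrightarrow> u \<le> b \<Longrightarrow> \<bar>f u\<bar> \<le> B"
  shows "set_integrable lborel {a..b} f"
  unfolding set_integrable_def
  by (rule integrableI_bounded_set_indicator[where B=B]) (use B in \<open>auto simp: emeasure_lborel_Icc_eq\<close>)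

lemma set_integral_Icc_abs_le:
  fixes f g :: "real \<Rightarrow> real"
  assumes "set_integrable lborel {a..b} f" "set_integrable lborel {a..b} g"
    and "\<And>u. a \<le> u \<Longrightarrow> u \<le> b \<Longrightarrow> \<bar>f u\<bar> \<le> g u"
  shows "\<bar>LINT u:{a..b}|lborel. f u\<bar> \<le> (LINT u:{a..b}|lborel. g u)"
proof -
  have "\<bar>LINT u:{a..b}|lborel. f u\<bar> \<le> (LINT u:{a..b}|lborel. \<bar>f u\<bar>)"
    using set_integral_norm_bound[OF assms(1)] by simp
  also have "\<dots> \<le> (LINT u:{a..b}|lborel. g u)"
    by (rule set_integral_mono) (use assms set_integrable_abs[OF assms(1)] in auto)
  finally show ?thesis .
qed

lemma set_integral_Icc_const: "a \<le> b \<Longrightarrow> (LINT u:{a..b}|lborel. (c::real)) = c * (b - a)"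
  by (simp add: set_lebesgue_integral_def)

lemma set_integral_Icc_abs_le_const:
  fixes f :: "real \<Rightarrow> real"
  assumes "a \<le> b" "set_integrable lborel {a..b} f" "\<And>u. a \<le> u \<Longrightarrow> u \<le> b \<Longrightarrow> \<bar>f u\<bar> \<le> c"
  shows "\<bar>LINT u:{a..b}|lborel. f u\<bar> \<le> c * (b - a)"
proof -
  have "\<bar>LINT u:{a..b}|lborel. f u\<bar> \<le> (LINT u:{a..b}|lborel. c)"
    by (rule set_integral_Icc_abs_le[OF assms(2) set_integrable_bounded_Icc[where B="\<bar>c\<bar>"]]) (use assms(3) in auto)
  then show ?thesis by (simp only: set_integral_Icc_const[OF assms(1)])
qed

lemma set_integral_Icc_combine:
  fixes f :: "real \<Rightarrow> real"
  assumes "a \<le> b" "b \<le> c" "set_integrable lborel {a..c} f"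
  shows "(LINT u:{a..c}|lborel. f u) = (LINT u:{a..b}|lborel. f u) + (LINT u:{b..c}|lborel. f u)"
proof -
  have i: "set_integrable lborel {a..b} f" "set_integrable lborel {b..c} f"
    using assms by (auto intro: set_integrable_subset)
  have "(LINT u:{a..c}|lborel. f u) = (LINT u:{a..b} \<union> {b<..c}|lborel. f u)"
    using assms by (simp add: ivl_disj_un)
  also have "\<dots> = (LINT u:{a..b}|lborel. f u) + (LINT u:{b<..c}|lborel. f u)"
    by (rule set_integral_Un) (use i set_integrable_subset[OF i(2), of "{b<..c}"] in \<open>auto simp: greaterThanAtMost_subseteq_atLeastAtMost_iff\<close>)
  also have "(LINT u:{b<..c}|lborel. f u) = (LINT u:{b..c}|lborel. f u)"
    using AE_lborel_singleton[of b] i(2) set_integrable_subset[OF i(2), of "{b<..c}"]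
    by (intro set_integral_cong_set)
      (auto simp: set_borel_measurable_def set_integrable_def greaterThanAtMost_subseteq_atLeastAtMost_iff)
  finally show ?thesis .
qed

lemma taylor_lipschitz_second_derivative:
  fixes \<phi> :: "real \<Rightarrow> real"
  assumes d1: "\<And>x. (\<phi> has_real_derivative \<phi>' x) (at x)"
    and d2: "\<And>x. (\<phi>' has_real_derivative \<phi>'' x) (at x)"
    and lip: "\<And>x y. \<bar>\<phi>'' x - \<phi>'' y\<bar> \<le> C * \<bar>x - y\<bar>"
  shows "\<bar>\<phi> y - \<phi> x - \<phi>' x * (y - x) - \<phi>'' x / 2 * (y - x)\<^sup>2\<bar> \<le> C * \<bar>y - x\<bar> ^ 3"
proof (cases "x = y")
  case False
  define D where "D = (\<lambda>m::nat. if m = 0 then \<phi> else if m = 1 then \<phi>' else \<phi>'')"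
  have "\<exists>z. (if y < x then y < z \<and> z < x else x < z \<and> z < y) \<and>
      \<phi> y = (\<Sum>m<2. (D m x / fact m) * (y - x) ^ m) + (D 2 z / fact 2) * (y - x) ^ 2"
    by (rule Taylor[of 2 D \<phi> "min x y" "max x y"]) (use False d1 d2 in \<open>auto simp: D_def less_2_cases_iff\<close>)
  then obtain z where "if y < x then y < z \<and> z < x else x < z \<and> z < y"
    and eq: "\<phi> y = \<phi> x + \<phi>' x * (y - x) + \<phi>'' z / 2 * (y - x)\<^sup>2"
    by (auto simp: D_def numeral_2_eq_2)
  then have z: "\<bar>z - x\<bar> \<le> \<bar>y - x\<bar>" by (auto split: if_splits)
  have C: "0 \<le> C" using lip[of x y] False
    by (metis abs_ge_zero diff_gt_0_iff_gt eq_iff_diff_eq_0 linorder_not_less mult_less_0_iff order_trans zero_less_abs_iff)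
  have "\<bar>\<phi> y - \<phi> x - \<phi>' x * (y - x) - \<phi>'' x / 2 * (y - x)\<^sup>2\<bar> = \<bar>\<phi>'' z - \<phi>'' x\<bar> / 2 * \<bar>y - x\<bar>\<^sup>2"
  proof -
    have "\<phi> y - \<phi> x - \<phi>' x * (y - x) - \<phi>'' x / 2 * (y - x)\<^sup>2 = (\<phi>'' z - \<phi>'' x) / 2 * (y - x)\<^sup>2"
      unfolding eq by (simp add: algebra_simps diff_divide_distrib)
    then show ?thesis by (simp only: abs_mult abs_divide abs_numeral power2_abs abs_power2)
  qed
  also have "\<dots> \<le> (C * \<bar>y - x\<bar>) * \<bar>y - x\<bar>\<^sup>2"
  proof (rule mult_right_mono)
    have "C * \<bar>z - x\<bar> \<le> C * \<bar>y - x\<bar>" using z C by (rule mult_left_mono)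
    have "\<bar>\<phi>'' z - \<phi>'' x\<bar> / 2 \<le> \<bar>\<phi>'' z - \<phi>'' x\<bar>" by simp
    also note lip[of z x]
    also note \<open>C * \<bar>z - x\<bar> \<le> C * \<bar>y - x\<bar>\<close>
    finally show "\<bar>\<phi>'' z - \<phi>'' x\<bar> / 2 \<le> C * \<bar>y - x\<bar>" .
  qed simp
  also have "\<dots> = C * \<bar>y - x\<bar> ^ 3" by (simp add: power3_eq_cube power2_eq_square)
  finally show ?thesis .
qed simp

lemma exp_neg_diff_bounds:
  fixes \<rho> a \<eta> :: real
  assumes "0 \<le> \<rho>" "0 \<le> a" "0 \<le> \<eta>"
  shows "\<bar>exp (-\<rho>*(a+\<eta>)) - exp (-\<rho>*a)\<bar> \<le> \<rho> * \<eta>"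
    and "\<bar>exp (-\<rho>*(a+\<eta>)) - exp (-\<rho>*a) + \<rho>*\<eta>*exp (-\<rho>*a)\<bar> \<le> (\<rho>*\<eta>)\<^sup>2"
proof -
  let ?x = "\<rho>*\<eta>"
  have x: "0 \<le> ?x" using assms by simp
  have e: "0 \<le> exp (-\<rho>*a)" "exp (-\<rho>*a) \<le> 1" using assms by auto
  have l: "1 - ?x \<le> exp (-?x)" using exp_ge_add_one_self[of "-?x"] by simp
  have u1: "exp (-?x) \<le> 1" using x by simp
  have u2: "exp (-?x) \<le> 1 - ?x + ?x\<^sup>2"
  proof -
    have "exp (-?x) \<le> 1 / (1 + ?x)"
      using exp_ge_add_one_self[of ?x] x by (simp add: exp_minus field_simps)
    also have "\<dots> \<le> 1 - ?x + ?x\<^sup>2"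
    proof -
      have "(1 - ?x + ?x\<^sup>2) * (1 + ?x) = 1 + ?x^3" by (simp add: power2_eq_square power3_eq_cube algebra_simps)
      moreover have "0 \<le> ?x^3" using x by simp
      ultimately show ?thesis using x by (simp add: pos_divide_le_eq)
    qed
    finally show ?thesis .
  qed
  have s: "exp (-\<rho>*(a+\<eta>)) = exp (-\<rho>*a) * exp (-?x)" by (simp add: exp_add[symmetric] algebra_simps)
  have "\<bar>exp (-\<rho>*(a+\<eta>)) - exp (-\<rho>*a)\<bar> = exp (-\<rho>*a) * \<bar>exp (-?x) - 1\<bar>"
    unfolding s by (simp add: abs_mult right_diff_distrib[symmetric] flip: mult_1_right)
      (metis abs_exp_cancel abs_mult mult.right_neutral right_diff_distrib)
  also have "\<dots> \<le> 1 * \<bar>exp (-?x) - 1\<bar>" by (rule mult_right_mono) (use e in auto)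
  also have "\<dots> \<le> ?x" using l u1 by simp
  finally show "\<bar>exp (-\<rho>*(a+\<eta>)) - exp (-\<rho>*a)\<bar> \<le> ?x" .
  have "exp (-\<rho>*(a+\<eta>)) - exp (-\<rho>*a) + \<rho>*\<eta>*exp (-\<rho>*a) = exp (-\<rho>*a) * (exp (-?x) - 1 + ?x)"
    unfolding s by (simp add: algebra_simps)
  then have "\<bar>exp (-\<rho>*(a+\<eta>)) - exp (-\<rho>*a) + \<rho>*\<eta>*exp (-\<rho>*a)\<bar> = exp (-\<rho>*a) * \<bar>exp (-?x) - 1 + ?x\<bar>"
    by (simp only: abs_mult abs_exp_cancel)
  also have "\<dots> \<le> 1 * \<bar>exp (-?x) - 1 + ?x\<bar>" by (rule mult_right_mono) (use e in auto)
  also have "\<dots> \<le> ?x\<^sup>2" using l u2 by simp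
  finally show "\<bar>exp (-\<rho>*(a+\<eta>)) - exp (-\<rho>*a) + \<rho>*\<eta>*exp (-\<rho>*a)\<bar> \<le> ?x\<^sup>2" .
qed


text \<open>A single constant \<open>C \<ge> 1\<close> bounds all the data, so that every error term is at most a power of \<open>C\<close> times a
  quantity that depends on the noise and the step length only.\<close>
locale smooth_test =
  fixes \<phi> \<phi>' \<phi>'' :: "real \<Rightarrow> real" and C :: real
  assumes C1: "1 \<le> C"
    and d1: "\<And>x. (\<phi> has_real_derivative \<phi>' x) (at x)"
    and d2: "\<And>x. (\<phi>' has_real_derivative \<phi>'' x) (at x)"
    and lip2: "\<And>x y. \<bar>\<phi>'' x - \<phi>'' y\<bar> \<le> C * \<bar>x - y\<bar>"
    and bd: "\<And>x. \<bar>\<phi> x\<bar> \<le> C" "\<And>x. \<bar>\<phi>' x\<bar> \<le> C" "\<And>x. \<bar>\<phi>'' x\<bar> \<le> C"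
begin

lemma lip: "\<bar>\<phi> x - \<phi> y\<bar> \<le> C * \<bar>x - y\<bar>" "\<bar>\<phi>' x - \<phi>' y\<bar> \<le> C * \<bar>x - y\<bar>"
proof -
  show "\<bar>\<phi> x - \<phi> y\<bar> \<le> C * \<bar>x - y\<bar>"
    using field_differentiable_bound[of UNIV \<phi> \<phi>' C x y] d1 bd by auto
  show "\<bar>\<phi>' x - \<phi>' y\<bar> \<le> C * \<bar>x - y\<bar>"
    using field_differentiable_bound[of UNIV \<phi>' \<phi>'' C x y] d2 bd by auto
qed

lemma cont: "continuous_on S \<phi>" "continuous_on S \<phi>'" "continuous_on S \<phi>''"
proof -
  show "continuous_on S \<phi>" "continuous_on S \<phi>'"
    using DERIV_isCont[OF d1] DERIV_isCont[OF d2] by (auto intro!: continuous_at_imp_continuous_on)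
  have "C-lipschitz_on S \<phi>''"
    using lip2 C1 by (intro lipschitz_onI) (auto simp: dist_real_def)
  then show "continuous_on S \<phi>''" by (rule lipschitz_on_continuous_on)
qed

lemma meas [measurable]: "\<phi> \<in> borel_measurable borel" "\<phi>' \<in> borel_measurable borel" "\<phi>'' \<in> borel_measurable borel"
  by (rule borel_measurable_continuous_onI[OF cont(1)] borel_measurable_continuous_onI[OF cont(2)]
      borel_measurable_continuous_onI[OF cont(3)])+

definition gen :: "real \<Rightarrow> real \<Rightarrow> real \<Rightarrow> real \<Rightarrow> real" where
  "gen \<rho> \<sigma> \<theta> x = - \<rho> * \<phi> x + \<theta> * \<phi>' x + \<sigma>\<^sup>2 / 2 * \<phi>'' x"

lemma gen_bounds:
  assumes "0 \<le> \<rho>" "\<rho> \<le> C" "0 \<le> \<sigma>" "\<sigma> \<le> C" "\<bar>\<theta>\<bar> \<le> C"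
  shows "\<bar>gen \<rho> \<sigma> \<theta> x\<bar> \<le> 3 * C^3" "\<bar>gen \<rho> \<sigma> \<theta> x - gen \<rho> \<sigma> \<theta> y\<bar> \<le> 3 * C^3 * \<bar>x - y\<bar>"
proof -
  have C2: "C * C \<le> C^3" using C1 by (simp add: power3_eq_cube)
  have s: "\<sigma>\<^sup>2 \<le> C\<^sup>2" using assms by (intro power_mono) auto
  have t: "\<bar>\<rho> * a\<bar> \<le> C^3 * D" "\<bar>\<theta> * b\<bar> \<le> C^3 * D" "\<bar>\<sigma>\<^sup>2 / 2 * c\<bar> \<le> C^3 * D"
    if abc: "\<bar>a\<bar> \<le> C * D" "\<bar>b\<bar> \<le> C * D" "\<bar>c\<bar> \<le> C * D" and D: "0 \<le> D" for a b c D
  proof -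
    have *: "C * (C * D) \<le> C^3 * D" using mult_right_mono[OF C2 D] by (simp add: mult.assoc)
    have "\<bar>\<rho> * a\<bar> \<le> C * (C * D)" unfolding abs_mult using assms abc C1 D by (intro mult_mono) auto
    then show "\<bar>\<rho> * a\<bar> \<le> C^3 * D" using * by linarith
    have "\<bar>\<theta> * b\<bar> \<le> C * (C * D)" unfolding abs_mult using assms abc C1 D by (intro mult_mono) auto
    then show "\<bar>\<theta> * b\<bar> \<le> C^3 * D" using * by linarith
    have "\<bar>\<sigma>\<^sup>2 / 2 * c\<bar> \<le> C\<^sup>2 * (C * D)" unfolding abs_mult using s abc C1 D
      by (intro mult_mono) (auto intro: order_trans[OF s])
    then show "\<bar>\<sigma>\<^sup>2 / 2 * c\<bar> \<le> C^3 * D" by (simp add: power2_eq_square power3_eq_cube mult_ac)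
  qed
  show "\<bar>gen \<rho> \<sigma> \<theta> x\<bar> \<le> 3 * C^3"
    using t[of "\<phi> x" 1 "\<phi>' x" "\<phi>'' x"] bd[of x] unfolding gen_def by (simp add: abs_if split: if_splits)
  have e: "gen \<rho> \<sigma> \<theta> x - gen \<rho> \<sigma> \<theta> y =
     - (\<rho> * (\<phi> x - \<phi> y)) + \<theta> * (\<phi>' x - \<phi>' y) + \<sigma>\<^sup>2 / 2 * (\<phi>'' x - \<phi>'' y)"
    unfolding gen_def by (simp add: field_simps)
  show "\<bar>gen \<rho> \<sigma> \<theta> x - gen \<rho> \<sigma> \<theta> y\<bar> \<le> 3 * C^3 * \<bar>x - y\<bar>"
    using t[of "\<phi> x - \<phi> y" "\<bar>x - y\<bar>" "\<phi>' x - \<phi>' y" "\<phi>'' x - \<phi>'' y"] lip[of x y] lip2[of x y]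
    unfolding e by linarith
qed

text \<open>A pathwise statement. Over a step of length \<open>\<eta>\<close> the discounted test function minus its
  compensator changes by two noise terms, linear in \<open>\<xi>\<close> and in \<open>\<xi>\<^sup>2 - \<eta>\<close>, up to a remainder whose
  mean is of order \<open>\<eta> * sqrt \<eta>\<close> when \<open>w\<close> is a Brownian path. That order is what makes the
  remainders disappear in the sum over all steps. The integral of \<open>\<bar>w u - w v\<bar>\<close> pays for freezing the
  path at its left end point in the compensator; the drift \<open>\<theta>\<close> is not frozen, as it need not be continuous
  in time.\<close>
lemma local_expansion:
  fixes z w \<theta> :: "real \<Rightarrow> real" and \<rho> \<sigma> t v v' :: real
  defines "e \<equiv> (\<lambda>u. exp (-\<rho> * (u - t)))" and "\<eta> \<equiv> v' - v" and "\<xi> \<equiv> w v' - w v"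
  assumes par: "0 \<le> \<rho>" "\<rho> \<le> C" "0 \<le> \<sigma>" "\<sigma> \<le> C" and \<theta>: "\<And>u. \<bar>\<theta> u\<bar> \<le> C" and \<theta>m[measurable]: "\<theta> \<in> borel_measurable borel"
    and zc: "continuous_on UNIV z" and wc: "continuous_on UNIV w"
    and z: "\<And>u. v \<le> u \<Longrightarrow> u \<le> v' \<Longrightarrow> z u - z v = (LINT r:{v..u}|lborel. \<theta> r) + \<sigma> * (w u - w v)"
    and t: "t \<le> v" "v \<le> v'" "v' \<le> v + 1"
  shows "\<bar>e v' * \<phi> (z v') - e v * \<phi> (z v) - (LINT u:{v..v'}|lborel. e u * gen \<rho> \<sigma> (\<theta> u) (z u))
      - e v * (\<phi>' (z v) * \<sigma> * \<xi> + \<phi>'' (z v) / 2 * \<sigma>\<^sup>2 * (\<xi>\<^sup>2 - \<eta>))\<bar>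
    \<le> 20 * C^4 * (\<eta>\<^sup>2 + \<eta> * \<bar>\<xi>\<bar> + \<bar>\<xi>\<bar>^3 + (LINT u:{v..v'}|lborel. \<bar>w u - w v\<bar>))"
proof -
  have zm[measurable]: "z \<in> borel_measurable borel" and wm[measurable]: "w \<in> borel_measurable borel"
    using zc wc by (auto intro: borel_measurable_continuous_onI)
  have \<eta>: "0 \<le> \<eta>" "\<eta> \<le> 1" using t by (auto simp: \<eta>_def)
  define d where "d = (LINT r:{v..v'}|lborel. \<theta> r)"
  define \<Delta> where "\<Delta> = z v' - z v"
  have \<Delta>: "\<Delta> = d + \<sigma> * \<xi>" using z[of v'] t by (simp add: \<Delta>_def d_def \<xi>_def)
  have Cpos: "0 < C" "0 \<le> C" using C1 by auto
  have i\<theta>: "set_integrable lborel {a..b} \<theta>" for a b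
    by (rule set_integrable_bounded_Icc[where B=C]) (use \<theta> in auto)
  have di: "\<bar>LINT r:{v..u}|lborel. \<theta> r\<bar> \<le> C * (u - v)" if "v \<le> u" for u
    by (rule set_integral_Icc_abs_le_const[OF that i\<theta> \<theta>])
  have d: "\<bar>d\<bar> \<le> C * \<eta>" using di[of v'] t by (simp add: d_def \<eta>_def)
  have s\<xi>: "\<bar>\<sigma> * \<xi>\<bar> \<le> C * \<bar>\<xi>\<bar>" using par by (simp add: abs_mult mult_right_mono)
  have \<Delta>b: "\<bar>\<Delta>\<bar> \<le> C * (\<eta> + \<bar>\<xi>\<bar>)" using d s\<xi> unfolding \<Delta> by (simp add: distrib_left)
  have ev: "0 \<le> e u" "t \<le> u \<Longrightarrow> e u \<le> 1" for u using par by (auto simp: e_def)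
  have ed: "\<bar>e u - e v\<bar> \<le> C * \<eta>" "\<bar>e u - e v + \<rho> * (u - v) * e v\<bar> \<le> C\<^sup>2 * \<eta>\<^sup>2" if u: "v \<le> u" "u \<le> v'" for u
  proof -
    note b = exp_neg_diff_bounds[of \<rho> "v - t" "u - v"]
    have r: "\<rho> * (u - v) \<le> C * \<eta>" using u par \<eta> by (intro mult_mono) (auto simp: \<eta>_def)
    show "\<bar>e u - e v\<bar> \<le> C * \<eta>" using b(1) par t u r by (simp add: e_def)
    have "(\<rho> * (u - v))\<^sup>2 \<le> (C * \<eta>)\<^sup>2" using r par u by (intro power_mono) auto
    then show "\<bar>e u - e v + \<rho> * (u - v) * e v\<bar> \<le> C\<^sup>2 * \<eta>\<^sup>2" using b(2) par t u by (simp add: e_def power_mult_distrib)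
  qed
  define K where "K = C^4"
  have CK: "C \<le> K" "C^2 \<le> K" "C^3 \<le> K" using C1 power_increasing[of 1 4 C] power_increasing[of 2 4 C] power_increasing[of 3 4 C] by (auto simp: K_def)
  \<comment> \<open>The error splits into the interaction of discount and state, the second-order error of the
    discount, the Taylor remainder, the drift part of the squared increment, and the error of
    freezing the state in the compensator.\<close>
  define T1 where "T1 = (e v' - e v) * (\<phi> (z v') - \<phi> (z v))"
  define T2 where "T2 = \<phi> (z v) * (e v' - e v + \<rho> * \<eta> * e v)"
  define T3 where "T3 = e v * (\<phi> (z v') - \<phi> (z v) - \<phi>' (z v) * \<Delta> - \<phi>'' (z v) / 2 * \<Delta>\<^sup>2)"
  define T4 where "T4 = e v * (\<phi>'' (z v) / 2 * (d * (2 * (\<sigma> * \<xi>) + d)))"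
  define G where "G = (\<lambda>u. e u * gen \<rho> \<sigma> (\<theta> u) (z u))"
  define G0 where "G0 = (\<lambda>u. e v * gen \<rho> \<sigma> (\<theta> u) (z v))"
  define T5 where "T5 = (LINT u:{v..v'}|lborel. G u - G0 u)"
  have Gm: "G \<in> borel_measurable borel" "G0 \<in> borel_measurable borel" unfolding G_def G0_def e_def gen_def by measurable
  have Gb: "\<bar>G u\<bar> \<le> 3*C^3" "\<bar>G0 u\<bar> \<le> 3*C^3" if "v \<le> u" for u
  proof -
    have "\<bar>G u\<bar> \<le> 1 * (3*C^3)" unfolding G_def abs_mult
      using ev[of u] gen_bounds(1)[OF par \<theta>[of u]] that t by (intro mult_mono) auto
    then show "\<bar>G u\<bar> \<le> 3*C^3" by simp
    have "\<bar>G0 u\<bar> \<le> 1 * (3*C^3)" unfolding G0_def abs_mult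
      using ev[of v] gen_bounds(1)[OF par \<theta>[of u]] that t by (intro mult_mono) auto
    then show "\<bar>G0 u\<bar> \<le> 3*C^3" by simp
  qed
  have Gi: "set_integrable lborel {v..v'} G" "set_integrable lborel {v..v'} G0"
    using set_integrable_bounded_Icc Gm Gb by blast+
  have G0: "(LINT u:{v..v'}|lborel. G0 u) = e v * (- \<rho> * \<phi> (z v) * \<eta> + d * \<phi>' (z v) + \<sigma>\<^sup>2 / 2 * \<phi>'' (z v) * \<eta>)"
  proof -
    have G0_eq: "G0 = (\<lambda>u. (e v * \<phi>' (z v)) * \<theta> u + e v * (- \<rho> * \<phi> (z v) + \<sigma>\<^sup>2 / 2 * \<phi>'' (z v)))"
      by (auto simp: G0_def gen_def field_simps)
    have ic: "set_integrable lborel {v..v'} (\<lambda>u. c::real)" for c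
      by (rule set_integrable_bounded_Icc[where B="\<bar>c\<bar>"]) auto
    from G0_eq have "(LINT u:{v..v'}|lborel. G0 u) = (LINT u:{v..v'}|lborel. (e v * \<phi>' (z v)) * \<theta> u)
       + (LINT u:{v..v'}|lborel. e v * (- \<rho> * \<phi> (z v) + \<sigma>\<^sup>2 / 2 * \<phi>'' (z v)))"
      using i\<theta> ic by (simp only:) (intro set_integral_add set_integrable_mult_right)
    also have "\<dots> = (e v * \<phi>' (z v)) * d + e v * (- \<rho> * \<phi> (z v) + \<sigma>\<^sup>2 / 2 * \<phi>'' (z v)) * \<eta>"
      using t by (simp only: set_integral_mult_right set_integral_Icc_const d_def \<eta>_def)
    finally show ?thesis by (simp add: algebra_simps)
  qed
  have split: "e v' * \<phi> (z v') - e v * \<phi> (z v) - (LINT u:{v..v'}|lborel. G u)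
      - e v * (\<phi>' (z v) * \<sigma> * \<xi> + \<phi>'' (z v) / 2 * \<sigma>\<^sup>2 * (\<xi>\<^sup>2 - \<eta>)) = T1 + T2 + T3 + T4 - T5"
  proof -
    have 5: "T5 = (LINT u:{v..v'}|lborel. G u) - (LINT u:{v..v'}|lborel. G0 u)"
      unfolding T5_def using Gi by (rule set_integral_diff)
    show ?thesis unfolding 5 G0 T1_def T2_def T3_def T4_def \<Delta>
      by (simp add: field_simps power2_eq_square)
  qed
  have "\<bar>T1\<bar> \<le> (C * \<eta>) * (C * (C * (\<eta> + \<bar>\<xi>\<bar>)))"
    unfolding T1_def abs_mult
    using ed(1)[of v'] t lip(1)[of "z v'" "z v"] \<eta> Cpos \<Delta>b
    by (intro mult_mono) (auto simp: \<Delta>_def intro: order_trans mult_left_mono)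
  also have "\<dots> = C^3 * (\<eta>\<^sup>2 + \<eta> * \<bar>\<xi>\<bar>)" by (simp add: power2_eq_square power3_eq_cube algebra_simps)
  also have "\<dots> \<le> K * (\<eta>\<^sup>2 + \<eta> * \<bar>\<xi>\<bar>)" using CK \<eta> by (intro mult_right_mono) auto
  finally have T1: "\<bar>T1\<bar> \<le> K * (\<eta>\<^sup>2 + \<eta> * \<bar>\<xi>\<bar>)" .
  have "\<bar>T2\<bar> \<le> C * (C\<^sup>2 * \<eta>\<^sup>2)"
    unfolding T2_def abs_mult using ed(2)[of v'] t bd(1)[of "z v"] Cpos
    by (intro mult_mono) (auto simp: \<eta>_def)
  also have "\<dots> = C^3 * \<eta>\<^sup>2" by (simp add: power2_eq_square power3_eq_cube)
  also have "\<dots> \<le> K * \<eta>\<^sup>2" using CK by (intro mult_right_mono) auto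
  finally have T2: "\<bar>T2\<bar> \<le> K * \<eta>\<^sup>2" .
  have cube: "(\<eta> + a)^3 \<le> 4 * (\<eta>\<^sup>2 + a^3)" if "0 \<le> a" for a
  proof -
    have "4 * (\<eta>^3 + a^3) - (\<eta> + a)^3 = 3 * ((\<eta> + a) * (\<eta> - a)\<^sup>2)"
      by (simp add: power2_eq_square power3_eq_cube algebra_simps)
    also have "\<dots> \<ge> 0" using that \<eta> by simp
    finally have 1: "(\<eta> + a)^3 \<le> 4 * (\<eta>^3 + a^3)" by simp
    have "\<eta>^3 \<le> \<eta>\<^sup>2" using \<eta> by (intro power_decreasing) auto
    then have "4 * (\<eta>^3 + a^3) \<le> 4 * (\<eta>\<^sup>2 + a^3)" by simp
    with 1 show ?thesis by (rule order_trans)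
  qed
  have "\<bar>T3\<bar> \<le> 1 * (C * \<bar>\<Delta>\<bar>^3)"
    unfolding T3_def abs_mult using ev[of v] t taylor_lipschitz_second_derivative[OF d1 d2 lip2, of "z v'" "z v"]
    by (intro mult_mono) (auto simp: \<Delta>_def)
  also have "\<dots> \<le> C * (C * (\<eta> + \<bar>\<xi>\<bar>))^3" using \<Delta>b Cpos by (simp add: power_mono)
  also have "\<dots> = K * (\<eta> + \<bar>\<xi>\<bar>)^3" by (simp add: K_def power_mult_distrib power3_eq_cube power4_eq_xxxx)
  also have "\<dots> \<le> K * (4 * (\<eta>\<^sup>2 + \<bar>\<xi>\<bar>^3))" using cube[of "\<bar>\<xi>\<bar>"] CK Cpos by (intro mult_left_mono) auto
  finally have T3: "\<bar>T3\<bar> \<le> K * (4 * (\<eta>\<^sup>2 + \<bar>\<xi>\<bar>^3))" .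
  have "\<bar>T4\<bar> \<le> 1 * (C / 2 * ((C * \<eta>) * (2 * (C * \<bar>\<xi>\<bar>) + C * \<eta>)))"
  proof -
    have 2: "\<bar>2 * (\<sigma> * \<xi>) + d\<bar> \<le> 2 * (C * \<bar>\<xi>\<bar>) + C * \<eta>" using d s\<xi> by linarith
    show ?thesis
      unfolding T4_def abs_mult[of "e v"] abs_mult[of "\<phi>'' (z v) / 2"] abs_mult[of d]
      using ev[of v] t bd(3)[of "z v"] d 2 Cpos \<eta> by (intro mult_mono) auto
  qed
  also have "\<dots> = C^3 * (\<eta> * \<bar>\<xi>\<bar> + \<eta>\<^sup>2 / 2)" by (simp add: power2_eq_square power3_eq_cube field_simps)
  also have "\<dots> \<le> K * (\<eta> * \<bar>\<xi>\<bar> + \<eta>\<^sup>2 / 2)" using CK \<eta> by (intro mult_right_mono) auto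
  finally have T4: "\<bar>T4\<bar> \<le> K * (\<eta> * \<bar>\<xi>\<bar> + \<eta>\<^sup>2 / 2)" .
  let ?J = "LINT u:{v..v'}|lborel. \<bar>w u - w v\<bar>"
  have iw: "set_integrable lborel {v..v'} (\<lambda>u. \<bar>w u - w v\<bar>)"
    by (rule borel_integrable_atLeastAtMost') (intro continuous_intros continuous_on_subset[OF wc] subset_UNIV)
  have ic: "set_integrable lborel {v..v'} (\<lambda>u. c::real)" for c
    by (rule set_integrable_bounded_Icc[where B="\<bar>c\<bar>"]) auto
  have "\<bar>T5\<bar> \<le> (LINT u:{v..v'}|lborel. 6 * K * \<eta> + 3 * K * \<bar>w u - w v\<bar>)"
    unfolding T5_def
  proof (rule set_integral_Icc_abs_le)
    show "set_integrable lborel {v..v'} (\<lambda>u. G u - G0 u)" using Gi by (rule set_integral_diff)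
    show "set_integrable lborel {v..v'} (\<lambda>u. 6 * K * \<eta> + 3 * K * \<bar>w u - w v\<bar>)"
      using iw ic by (intro set_integral_add) auto
    fix u assume u: "v \<le> u" "u \<le> v'"
    have "\<bar>\<sigma> * (w u - w v)\<bar> \<le> C * \<bar>w u - w v\<bar>"
      unfolding abs_mult using par by (intro mult_right_mono) auto
    then have "\<bar>z u - z v\<bar> \<le> C * (u - v) + C * \<bar>w u - w v\<bar>"
      using di[OF u(1)] unfolding z[OF u] by linarith
    also have "\<dots> \<le> C * (\<eta> + \<bar>w u - w v\<bar>)" using u Cpos by (simp add: distrib_left \<eta>_def)
    finally have zz: "\<bar>z u - z v\<bar> \<le> C * (\<eta> + \<bar>w u - w v\<bar>)" .
    have eq: "G u - G0 u = (e u - e v) * gen \<rho> \<sigma> (\<theta> u) (z u) + e v * (gen \<rho> \<sigma> (\<theta> u) (z u) - gen \<rho> \<sigma> (\<theta> u) (z v))"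
      by (simp add: G_def G0_def algebra_simps)
    have "\<bar>G u - G0 u\<bar> \<le> \<bar>(e u - e v) * gen \<rho> \<sigma> (\<theta> u) (z u)\<bar> + \<bar>e v * (gen \<rho> \<sigma> (\<theta> u) (z u) - gen \<rho> \<sigma> (\<theta> u) (z v))\<bar>"
      unfolding eq by (rule abs_triangle_ineq)
    also have "\<dots> \<le> (C * \<eta>) * (3 * C^3) + 1 * (3 * C^3 * (C * (\<eta> + \<bar>w u - w v\<bar>)))"
      unfolding abs_mult
    proof (rule add_mono)
      show "\<bar>e u - e v\<bar> * \<bar>gen \<rho> \<sigma> (\<theta> u) (z u)\<bar> \<le> (C * \<eta>) * (3 * C^3)"
        by (rule mult_mono[OF ed(1)[OF u] gen_bounds(1)[OF par \<theta>]]) (use Cpos \<eta> in simp_all)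
      have 1: "3 * C^3 * \<bar>z u - z v\<bar> \<le> 3 * C^3 * (C * (\<eta> + \<bar>w u - w v\<bar>))"
        by (rule mult_left_mono[OF zz]) (use Cpos in simp)
      show "\<bar>e v\<bar> * \<bar>gen \<rho> \<sigma> (\<theta> u) (z u) - gen \<rho> \<sigma> (\<theta> u) (z v)\<bar> \<le> 1 * (3 * C^3 * (C * (\<eta> + \<bar>w u - w v\<bar>)))"
        by (rule mult_mono[OF _ order_trans[OF gen_bounds(2)[OF par \<theta>] 1]]) (use ev[of v] t in simp_all)
    qed
    also have "\<dots> = 6 * K * \<eta> + 3 * K * \<bar>w u - w v\<bar>"
      by (simp add: K_def power3_eq_cube power4_eq_xxxx algebra_simps)
    finally show "\<bar>G u - G0 u\<bar> \<le> 6 * K * \<eta> + 3 * K * \<bar>w u - w v\<bar>" .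
  qed
  also have "\<dots> = 6 * K * \<eta>\<^sup>2 + 3 * K * ?J"
  proof -
    have "(LINT u:{v..v'}|lborel. 6 * K * \<eta> + 3 * K * \<bar>w u - w v\<bar>) =
       (LINT u:{v..v'}|lborel. 6 * K * \<eta>) + (LINT u:{v..v'}|lborel. 3 * K * \<bar>w u - w v\<bar>)"
      using iw ic by (intro set_integral_add) auto
    then show ?thesis using t by (simp only: set_integral_Icc_const set_integral_mult_right) (simp add: \<eta>_def power2_eq_square)
  qed
  finally have T5: "\<bar>T5\<bar> \<le> K * (6 * \<eta>\<^sup>2 + 3 * ?J)" by (simp add: algebra_simps)
  have J: "0 \<le> ?J" using set_integral_Icc_abs_le[of v v' "\<lambda>u. 0" "\<lambda>u. \<bar>w u - w v\<bar>"] iw ic by simp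
  have "\<bar>T1 + T2 + T3 + T4 - T5\<bar> \<le> K * ((\<eta>\<^sup>2 + \<eta> * \<bar>\<xi>\<bar>) + \<eta>\<^sup>2 + 4 * (\<eta>\<^sup>2 + \<bar>\<xi>\<bar>^3) + (\<eta> * \<bar>\<xi>\<bar> + \<eta>\<^sup>2 / 2) + (6 * \<eta>\<^sup>2 + 3 * ?J))"
    using T1 T2 T3 T4 T5 unfolding distrib_left by linarith
  also have "\<dots> \<le> K * (20 * (\<eta>\<^sup>2 + \<eta> * \<bar>\<xi>\<bar> + \<bar>\<xi>\<bar>^3 + ?J))"
  proof (rule mult_left_mono)
    have arith: "(p + q) + p + 4 * (p + r) + (q + p / 2) + (6 * p + 3 * j) \<le> 20 * (p + q + r + j)"
      if "0 \<le> p" "0 \<le> q" "0 \<le> r" "0 \<le> j" for p q r j :: real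
      using that by (simp add: distrib_left)
    show "(\<eta>\<^sup>2 + \<eta> * \<bar>\<xi>\<bar>) + \<eta>\<^sup>2 + 4 * (\<eta>\<^sup>2 + \<bar>\<xi>\<bar>^3) + (\<eta> * \<bar>\<xi>\<bar> + \<eta>\<^sup>2 / 2) + (6 * \<eta>\<^sup>2 + 3 * ?J)
      \<le> 20 * (\<eta>\<^sup>2 + \<eta> * \<bar>\<xi>\<bar> + \<bar>\<xi>\<bar>^3 + ?J)"
      by (rule arith) (use \<eta> J in simp_all)
  qed (simp add: K_def)
  finally have "\<bar>T1 + T2 + T3 + T4 - T5\<bar> \<le> 20 * C^4 * (\<eta>\<^sup>2 + \<eta> * \<bar>\<xi>\<bar> + \<bar>\<xi>\<bar>^3 + ?J)" by (simp only: K_def mult.left_commute[of _ 20] mult.assoc)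
  then show ?thesis using split unfolding G_def by simp
qed

end

section \<open>Diffusions with bounded drift\<close>

lemma floor_quotient_tendsto: "(\<lambda>n. of_int \<lfloor>u * real (Suc n)\<rfloor> / real (Suc n)) \<longlonglongrightarrow> (u::real)"
proof (rule LIMSEQ_I)
  fix r :: real assume "0 < r"
  then obtain n0 where n0: "inverse (real (Suc n0)) < r" using reals_Archimedean by blast
  have "norm (of_int \<lfloor>u * real (Suc n)\<rfloor> / real (Suc n) - u) < r" if "n0 \<le> n" for n
  proof -
    have "\<bar>of_int \<lfloor>u * real (Suc n)\<rfloor> - u * real (Suc n)\<bar> \<le> 1" by linarith
    moreover have "of_int \<lfloor>u * real (Suc n)\<rfloor> / real (Suc n) - u = (of_int \<lfloor>u * real (Suc n)\<rfloor> - u * real (Suc n)) / real (Suc n)"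
      by (simp add: field_simps)
    ultimately have "\<bar>of_int \<lfloor>u * real (Suc n)\<rfloor> / real (Suc n) - u\<bar> \<le> 1 / real (Suc n)" by (simp add: divide_le_cancel)
    also have "\<dots> \<le> inverse (real (Suc n0))" using that by (simp add: field_simps)
    finally show ?thesis using n0 by simp
  qed
  then show "\<exists>no. \<forall>n\<ge>no. norm (of_int \<lfloor>u * real (Suc n)\<rfloor> / real (Suc n) - u) < r" by blast
qed

text \<open>Rounding the parameter down to a multiple of \<open>1 / Suc n\<close> makes the function jointly measurable,
  as only countably many values of the parameter occur; continuity gives the limit.\<close>
lemma measurable_pair_continuous_param:
  fixes f :: "real \<Rightarrow> 'a \<Rightarrow> real"
  assumes m: "\<And>u. f u \<in> borel_measurable A"
    and c: "\<And>\<omega>. \<omega> \<in> space A \<Longrightarrow> continuous_on UNIV (\<lambda>u. f u \<omega>)"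
  shows "(\<lambda>(u, \<omega>). f u \<omega>) \<in> borel_measurable (borel \<Otimes>\<^sub>M A)"
proof -
  define g where "g = (\<lambda>(n::nat) u. of_int \<lfloor>u * real (Suc n)\<rfloor> / real (Suc n) :: real)"
  have gm: "(\<lambda>(u, \<omega>). f (g n u) \<omega>) \<in> borel_measurable (borel \<Otimes>\<^sub>M A)" for n
  proof -
    have "(\<lambda>p. (\<lambda>(i::int) p. f (of_int i / real (Suc n)) (snd p)) \<lfloor>fst p * real (Suc n)\<rfloor> p)
        \<in> borel_measurable (borel \<Otimes>\<^sub>M A)"
    proof (rule measurable_compose_countable[where f="\<lambda>i p. f (of_int i / real (Suc n)) (snd p)" and g="\<lambda>p. \<lfloor>fst p * real (Suc n)\<rfloor>"])
      show "(\<lambda>p. f (of_int i / real (Suc n)) (snd p)) \<in> borel_measurable (borel \<Otimes>\<^sub>M A)" for i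
        using m by (rule measurable_compose[OF measurable_snd])
      show "(\<lambda>p. \<lfloor>fst p * real (Suc n)\<rfloor>) \<in> borel \<Otimes>\<^sub>M A \<rightarrow>\<^sub>M count_space UNIV" by measurable
    qed
    then show ?thesis by (simp add: g_def case_prod_unfold)
  qed
  show ?thesis
  proof (rule borel_measurable_LIMSEQ_real[where u="\<lambda>n (u, \<omega>). f (g n u) \<omega>", OF _ gm])
  fix p :: "real \<times> 'a" assume p: "p \<in> space (borel \<Otimes>\<^sub>M A)"
  obtain u \<omega> where p': "p = (u, \<omega>)" "\<omega> \<in> space A" using p by (auto simp: space_pair_measure)
  have lim: "(\<lambda>n. g n u) \<longlonglongrightarrow> u" unfolding g_def by (rule floor_quotient_tendsto)
  have "isCont (\<lambda>u. f u \<omega>) u" using c[OF p'(2)] by (simp add: continuous_on_eq_continuous_at)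
  from isCont_tendsto_compose[OF this lim] have "(\<lambda>n. f (g n u) \<omega>) \<longlonglongrightarrow> f u \<omega>" .
  then show "(\<lambda>n. (case p of (u, \<omega>) \<Rightarrow> f (g n u) \<omega>)) \<longlonglongrightarrow> (case p of (u, \<omega>) \<Rightarrow> f u \<omega>)"
    by (simp add: p')
  qed
qed

lemma constant_if_increments_superlinear:
  fixes m :: "real \<Rightarrow> real"
  assumes inc: "\<And>a b. s \<le> a \<Longrightarrow> a < b \<Longrightarrow> b \<le> a + 1 \<Longrightarrow> \<bar>m b - m a\<bar> \<le> K * ((b - a) * sqrt (b - a))"
    and "s \<le> v"
  shows "m v = m s"
proof -
  have "(m has_field_derivative 0) (at a within {s..})" if a: "a \<in> {s..}" for a
    unfolding has_field_derivative_iff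
  proof (rule Lim_null_comparison)
    show "((\<lambda>b. K * sqrt \<bar>b - a\<bar>) \<longlongrightarrow> 0) (at a within {s..})"
      by (auto intro!: tendsto_eq_intros)
    have "\<forall>\<^sub>F b in at a within {s..}. b \<in> {s..} \<and> b \<noteq> a \<and> dist b a < 1"
      unfolding eventually_at by (rule exI[of _ 1]) auto
    then show "\<forall>\<^sub>F b in at a within {s..}. norm ((m b - m a) / (b - a)) \<le> K * sqrt \<bar>b - a\<bar>"
    proof eventually_elim
      case (elim b)
      have "\<bar>m b - m a\<bar> \<le> K * (\<bar>b - a\<bar> * sqrt \<bar>b - a\<bar>)"
      proof (cases "a < b")
        case True then show ?thesis using inc[of a b] elim a by (simp add: dist_real_def)
      next
        case False
        then have "\<bar>m a - m b\<bar> \<le> K * ((a - b) * sqrt (a - b))" using inc[of b a] elim a by (simp add: dist_real_def)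
        then show ?thesis using False elim by (simp add: abs_minus_commute)
      qed
      then show ?case using elim by (simp add: abs_divide divide_le_eq mult_ac)
    qed
  qed
  from has_field_derivative_zero_constant[OF _ this] obtain c where "\<forall>x\<in>{s..}. m x = c" by auto
  then show ?thesis using \<open>s \<le> v\<close> by simp
qed

text \<open>A process with bounded, possibly non-Markovian drift \<open>\<theta>\<close> and constant volatility, defined for
  all times. Here \<open>w\<close> is a version of \<open>W\<close> minus its value at time \<open>t\<close> all of whose paths are continuous.\<close>
locale diffusion = brownian_motion M F W
  for M :: "'a measure" and F and W :: "real \<Rightarrow> 'a \<Rightarrow> real" +
  fixes t x \<sigma> K :: real and w \<theta> :: "real \<Rightarrow> 'a \<Rightarrow> real" and Z :: "real \<Rightarrow> 'a \<Rightarrow> real"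
  assumes t0: "0 \<le> t" and \<sigma>0: "0 \<le> \<sigma>"
    and w_cont: "\<And>\<omega>. \<omega> \<in> space M \<Longrightarrow> continuous_on UNIV (\<lambda>u. w u \<omega>)"
    and w_start: "\<And>\<omega>. w t \<omega> = 0"
    and w_meas [measurable]: "\<And>u. w u \<in> borel_measurable M"
    and w_eq: "\<And>u. t \<le> u \<Longrightarrow> AE \<omega> in M. w u \<omega> = W u \<omega> - W t \<omega>"
    and \<theta>_meas [measurable]: "(\<lambda>(u, \<omega>). \<theta> u \<omega>) \<in> borel_measurable (borel \<Otimes>\<^sub>M M)"
    and \<theta>_bound: "\<And>u \<omega>. \<bar>\<theta> u \<omega>\<bar> \<le> K"
    and Z_eq: "\<And>u \<omega>. Z u \<omega> = x + (LINT r:{t..u}|lborel. \<theta> r \<omega>) + \<sigma> * w u \<omega>"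
    and Z_nonanticipating: "\<And>u. t \<le> u \<Longrightarrow> nonanticipating u (Z u)"
begin

lemma \<theta>_path: "\<omega> \<in> space M \<Longrightarrow> (\<lambda>u. \<theta> u \<omega>) \<in> borel_measurable borel"
  using measurable_compose[OF measurable_Pair2', of \<omega> M "\<lambda>(u, \<omega>). \<theta> u \<omega>" borel borel] by simp

lemma \<theta>_int: "\<omega> \<in> space M \<Longrightarrow> set_integrable lborel {a..b} (\<lambda>u. \<theta> u \<omega>)"
  by (rule set_integrable_bounded_Icc[OF \<theta>_path]) (use \<theta>_bound in auto)

lemma K0: "0 \<le> K" using \<theta>_bound by (rule order_trans[OF abs_ge_zero])

lemma Z_incr:
  assumes "\<omega> \<in> space M" "t \<le> v" "v \<le> u"
  shows "Z u \<omega> - Z v \<omega> = (LINT r:{v..u}|lborel. \<theta> r \<omega>) + \<sigma> * (w u \<omega> - w v \<omega>)"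
  unfolding Z_eq using set_integral_Icc_combine[OF assms(2,3) \<theta>_int[OF assms(1)]]
  by (simp add: algebra_simps)

lemma Z_cont:
  assumes \<omega>: "\<omega> \<in> space M"
  shows "continuous_on UNIV (\<lambda>u. Z u \<omega>)"
proof -
  have *: "\<bar>(LINT r:{t..b}|lborel. \<theta> r \<omega>) - (LINT r:{t..a}|lborel. \<theta> r \<omega>)\<bar> \<le> K * (b - a)" if "a \<le> b" for a b
  proof (cases "t \<le> a")
    case True
    show ?thesis
      using set_integral_Icc_combine[OF True that \<theta>_int[OF \<omega>]] set_integral_Icc_abs_le_const[OF that \<theta>_int[OF \<omega>] \<theta>_bound]
      by simp
  next
    case False
    have 0: "(LINT r:{t..a}|lborel. \<theta> r \<omega>) = 0" using False by (simp add: set_lebesgue_integral_def)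
    show ?thesis
    proof (cases "t \<le> b")
      case True
      have "\<bar>LINT r:{t..b}|lborel. \<theta> r \<omega>\<bar> \<le> K * (b - t)"
        by (rule set_integral_Icc_abs_le_const[OF True \<theta>_int[OF \<omega>] \<theta>_bound])
      also have "\<dots> \<le> K * (b - a)" using False K0 by (simp add: mult_left_mono)
      finally show ?thesis by (simp add: 0)
    next
      case f: False
      then have "(LINT r:{t..b}|lborel. \<theta> r \<omega>) = 0" by (simp add: set_lebesgue_integral_def)
      then show ?thesis using 0 K0 that by simp
    qed
  qed
  have "K-lipschitz_on UNIV (\<lambda>b. LINT r:{t..b}|lborel. \<theta> r \<omega>)"
  proof (rule lipschitz_onI[OF _ K0])
    fix a b :: real
    show "dist (LINT r:{t..a}|lborel. \<theta> r \<omega>) (LINT r:{t..b}|lborel. \<theta> r \<omega>) \<le> K * dist a b"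
      using *[of a b] *[of b a] by (cases "a \<le> b") (auto simp: dist_real_def abs_minus_commute)
  qed
  then have "continuous_on UNIV (\<lambda>b. LINT r:{t..b}|lborel. \<theta> r \<omega>)" by (rule lipschitz_on_continuous_on)
  then show ?thesis unfolding Z_eq by (intro continuous_intros w_cont \<omega>)
qed

lemma Z_meas [measurable]: "Z u \<in> borel_measurable M"
proof -
  have [measurable]: "(\<lambda>(u, \<omega>). \<theta> u \<omega>) \<in> borel_measurable (lborel \<Otimes>\<^sub>M M)" using \<theta>_meas by simp
  have "(\<lambda>\<omega>. LINT r|lborel. indicator {t..u} r *\<^sub>R \<theta> r \<omega>) \<in> borel_measurable M"
    by (rule lborel.borel_measurable_lebesgue_integral) measurable
  then show ?thesis unfolding Z_eq set_lebesgue_integral_def by measurable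
qed

lemma Z_pair_meas [measurable]: "(\<lambda>(u, \<omega>). Z u \<omega>) \<in> borel_measurable (borel \<Otimes>\<^sub>M M)"
  by (rule measurable_pair_continuous_param[OF Z_meas Z_cont])

lemma w_pair_meas [measurable]: "(\<lambda>(u, \<omega>). w u \<omega>) \<in> borel_measurable (borel \<Otimes>\<^sub>M M)"
  by (rule measurable_pair_continuous_param[OF w_meas w_cont])

lemma w_incr_AE: "t \<le> v \<Longrightarrow> t \<le> u \<Longrightarrow> AE \<omega> in M. w u \<omega> - w v \<omega> = W u \<omega> - W v \<omega>"
proof -
  assume "t \<le> v" "t \<le> u"
  from w_eq[OF this(1)] w_eq[OF this(2)] show ?thesis by eventually_elim simp
qed

lemma w_incr_abs_moment:
  assumes "t \<le> v" "v < u"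
  shows "integrable M (\<lambda>\<omega>. \<bar>w u \<omega> - w v \<omega>\<bar> ^ (2*k+1))"
    and "(\<integral>\<omega>. \<bar>w u \<omega> - w v \<omega>\<bar> ^ (2*k+1) \<partial>M) \<le> 2^k * fact k * sqrt (u - v) ^ (2*k+1)"
proof -
  have "0 \<le> v" using assms t0 by simp
  note mom = increment_abs_moment_odd[OF this assms(2), of k]
  have [measurable]: "W u \<in> borel_measurable M" "W v \<in> borel_measurable M"
    using W_measurable t0 assms by auto
  have ae: "AE \<omega> in M. \<bar>w u \<omega> - w v \<omega>\<bar> ^ (2*k+1) = \<bar>W u \<omega> - W v \<omega>\<bar> ^ (2*k+1)"
    using w_incr_AE[of v u] assms by (auto elim: eventually_mono)
  show "integrable M (\<lambda>\<omega>. \<bar>w u \<omega> - w v \<omega>\<bar> ^ (2*k+1))"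
    using mom(1) by (subst integrable_cong_AE[OF _ _ ae]) measurable
  show "(\<integral>\<omega>. \<bar>w u \<omega> - w v \<omega>\<bar> ^ (2*k+1) \<partial>M) \<le> 2^k * fact k * sqrt (u - v) ^ (2*k+1)"
    using mom(2) by (subst integral_cong_AE[OF _ _ ae]) measurable
qed

text \<open>By Fubini, since the mean of \<open>\<bar>w u - w v\<bar>\<close> is at most \<open>sqrt (u - v)\<close>.\<close>
lemma w_area_moment:
  assumes "t \<le> v" "v \<le> v'"
  shows "integrable M (\<lambda>\<omega>. LINT u:{v..v'}|lborel. \<bar>w u \<omega> - w v \<omega>\<bar>)"
    and "(\<integral>\<omega>. (LINT u:{v..v'}|lborel. \<bar>w u \<omega> - w v \<omega>\<bar>) \<partial>M) \<le> (v' - v) * sqrt (v' - v)"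
proof -
  interpret P: pair_sigma_finite lborel M
    by (simp add: pair_sigma_finite_def sigma_finite_lborel sigma_finite_measure_axioms)
  define f where "f = (\<lambda>u \<omega>. indicator {v..v'} u *\<^sub>R \<bar>w u \<omega> - w v \<omega>\<bar>)"
  have [measurable]: "(\<lambda>(u, \<omega>). w u \<omega>) \<in> borel_measurable (lborel \<Otimes>\<^sub>M M)" using w_pair_meas by simp
  have fm[measurable]: "(\<lambda>(u, \<omega>). f u \<omega>) \<in> borel_measurable (lborel \<Otimes>\<^sub>M M)"
    unfolding f_def by measurable
  have fi: "integrable M (f u)" and fb: "\<bar>\<integral>\<omega>. f u \<omega> \<partial>M\<bar> \<le> sqrt (v' - v)" for u
  proof -
    have "integrable M (f u) \<and> (\<integral>\<omega>. f u \<omega> \<partial>M) \<le> sqrt (v' - v)"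
    proof (cases "v < u \<and> u \<le> v'")
      case True
      then have "f u = (\<lambda>\<omega>. \<bar>w u \<omega> - w v \<omega>\<bar>)" by (auto simp: f_def)
      moreover have "sqrt (u - v) \<le> sqrt (v' - v)" using True by simp
      ultimately show ?thesis using w_incr_abs_moment[of v u 0] assms True by (auto intro: order_trans)
    next
      case False
      then have "f u = (\<lambda>\<omega>. 0)" by (cases "u = v") (auto simp: f_def)
      then show ?thesis using assms by simp
    qed
    moreover have "0 \<le> (\<integral>\<omega>. f u \<omega> \<partial>M)" by (rule Bochner_Integration.integral_nonneg) (simp add: f_def)
    ultimately show "integrable M (f u)" "\<bar>\<integral>\<omega>. f u \<omega> \<partial>M\<bar> \<le> sqrt (v' - v)" by auto
  qed
  have Em[measurable]: "(\<lambda>u. \<integral>\<omega>. f u \<omega> \<partial>M) \<in> borel_measurable lborel"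
    by (rule borel_measurable_lebesgue_integral) (use fm in simp)
  have Es: "(\<lambda>u. \<integral>\<omega>. f u \<omega> \<partial>M) = (\<lambda>u. indicator {v..v'} u *\<^sub>R (\<integral>\<omega>. f u \<omega> \<partial>M))"
    by (auto simp: f_def indicator_def)
  have Ei: "set_integrable lborel {v..v'} (\<lambda>u. \<integral>\<omega>. f u \<omega> \<partial>M)"
    by (rule set_integrable_bounded_Icc[where B="sqrt (v' - v)"]) (use Em fb in auto)
  have norm_eq: "norm (f u \<omega>) = f u \<omega>" for u \<omega> by (simp add: f_def)
  have int: "integrable (lborel \<Otimes>\<^sub>M M) (\<lambda>(u, \<omega>). f u \<omega>)"
  proof (rule P.Fubini_integrable[OF fm])
    show "integrable lborel (\<lambda>u. \<integral>\<omega>. norm (case (u, \<omega>) of (u, \<omega>) \<Rightarrow> f u \<omega>) \<partial>M)"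
      using Ei unfolding set_integrable_def norm_eq prod.case by (subst Es)
    show "AE u in lborel. integrable M (\<lambda>\<omega>. case (u, \<omega>) of (u, \<omega>) \<Rightarrow> f u \<omega>)" using fi by simp
  qed
  have J: "(\<lambda>\<omega>. LINT u:{v..v'}|lborel. \<bar>w u \<omega> - w v \<omega>\<bar>) = (\<lambda>\<omega>. LINT u|lborel. f u \<omega>)"
    by (simp add: set_lebesgue_integral_def f_def)
  show "integrable M (\<lambda>\<omega>. LINT u:{v..v'}|lborel. \<bar>w u \<omega> - w v \<omega>\<bar>)"
    unfolding J using P.integrable_snd[OF int] by simp
  have "(\<integral>\<omega>. (LINT u|lborel. f u \<omega>) \<partial>M) = (LINT u|lborel. \<integral>\<omega>. f u \<omega> \<partial>M)"
    by (rule P.Fubini_integral[OF int])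
  also have "\<dots> = (LINT u:{v..v'}|lborel. \<integral>\<omega>. f u \<omega> \<partial>M)"
    unfolding set_lebesgue_integral_def by (subst Es) simp
  also have "\<dots> \<le> \<bar>\<dots>\<bar>" by simp
  also have "\<dots> \<le> (LINT u:{v..v'}|lborel. sqrt (v' - v))"
    by (rule set_integral_Icc_abs_le[OF Ei]) (use fb assms in \<open>auto intro!: set_integrable_bounded_Icc[where B="sqrt (v'-v)"]\<close>)
  also have "\<dots> = (v' - v) * sqrt (v' - v)" using assms by (simp add: set_integral_Icc_const)
  finally show "(\<integral>\<omega>. (LINT u:{v..v'}|lborel. \<bar>w u \<omega> - w v \<omega>\<bar>) \<partial>M) \<le> (v' - v) * sqrt (v' - v)"
    unfolding J .
qed

end

section \<open>Martingale property and optional stopping\<close>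

lemma set_integral_Icc_refl: "(LINT u:{a..a}|lborel. (f::real \<Rightarrow> real) u) = 0"
  unfolding set_lebesgue_integral_def
proof (rule integral_eq_zero_AE)
  show "AE u in lborel. indicator {a..a} u *\<^sub>R f u = 0"
    using AE_lborel_singleton[of a] by eventually_elim simp
qed

locale diffusion_test = diffusion M F W t x \<sigma> K w \<theta> Z + smooth_test \<phi> \<phi>' \<phi>'' C
  for M :: "'a measure" and F and W :: "real \<Rightarrow> 'a \<Rightarrow> real" and t x \<sigma> K w \<theta> Z \<phi> \<phi>' \<phi>'' C +
  fixes \<rho> :: real
  assumes \<rho>: "0 \<le> \<rho>" "\<rho> \<le> C" and \<sigma>C: "\<sigma> \<le> C" and KC: "K \<le> C"
begin

definition integrand :: "'a \<Rightarrow> real \<Rightarrow> real" where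
  "integrand \<omega> r = exp (-\<rho> * (r - t)) * gen \<rho> \<sigma> (\<theta> r \<omega>) (Z r \<omega>)"

text \<open>The compensated test function, which will turn out to be a martingale.\<close>
definition Q :: "real \<Rightarrow> 'a \<Rightarrow> real" where
  "Q v \<omega> = exp (-\<rho> * (v - t)) * \<phi> (Z v \<omega>) - (LINT r:{t..v}|lborel. integrand \<omega> r)"

lemma \<theta>C: "\<bar>\<theta> u \<omega>\<bar> \<le> C" using \<theta>_bound KC by (rule order_trans)

lemma integrand_pair_meas [measurable]: "(\<lambda>(r, \<omega>). integrand \<omega> r) \<in> borel_measurable (borel \<Otimes>\<^sub>M M)"
  unfolding integrand_def gen_def by measurable

lemma integrand_bound: "t \<le> r \<Longrightarrow> \<bar>integrand \<omega> r\<bar> \<le> 3 * C^3"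
proof -
  assume r: "t \<le> r"
  have "exp (-\<rho> * (r - t)) \<le> 1" using r \<rho> by simp
  then have "exp (-\<rho> * (r - t)) * \<bar>gen \<rho> \<sigma> (\<theta> r \<omega>) (Z r \<omega>)\<bar> \<le> 1 * (3 * C^3)"
    using gen_bounds(1)[OF \<rho> \<sigma>0 \<sigma>C \<theta>C] C1 by (intro mult_mono) auto
  then show ?thesis by (simp add: integrand_def abs_mult)
qed

lemma integrand_int:
  assumes "\<omega> \<in> space M" "t \<le> a" shows "set_integrable lborel {a..b} (integrand \<omega>)"
proof (rule set_integrable_bounded_Icc[where B="3 * C^3"])
  show "integrand \<omega> \<in> borel_measurable borel"
    using measurable_compose[OF measurable_Pair2'[OF assms(1)] integrand_pair_meas] by simp
qed (use assms integrand_bound in auto)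

lemma Q_meas [measurable]: "Q v \<in> borel_measurable M"
proof -
  have [measurable]: "(\<lambda>(r, \<omega>). integrand \<omega> r) \<in> borel_measurable (lborel \<Otimes>\<^sub>M M)" using integrand_pair_meas by simp
  have "(\<lambda>\<omega>. LINT r|lborel. indicator {t..v} r *\<^sub>R integrand \<omega> r) \<in> borel_measurable M"
    by (rule lborel.borel_measurable_lebesgue_integral) measurable
  then show ?thesis unfolding Q_def set_lebesgue_integral_def by measurable
qed

lemma set_integral_integrand_bound:
  assumes "\<omega> \<in> space M" "t \<le> a" "a \<le> b"
  shows "\<bar>LINT r:{a..b}|lborel. integrand \<omega> r\<bar> \<le> 3 * C^3 * (b - a)"
  by (rule set_integral_Icc_abs_le_const[OF assms(3) integrand_int[OF assms(1,2)] integrand_bound]) (use assms(2) in simp)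

lemma Q_bound:
  assumes "\<omega> \<in> space M" "t \<le> v" "v \<le> T"
  shows "\<bar>Q v \<omega>\<bar> \<le> C + 3 * C^3 * (T - t)"
proof -
  have "exp (-\<rho> * (v - t)) \<le> 1" using assms \<rho> by simp
  then have 1: "\<bar>exp (-\<rho> * (v - t)) * \<phi> (Z v \<omega>)\<bar> \<le> 1 * C"
    unfolding abs_mult using bd(1) C1 by (intro mult_mono) auto
  have "3 * C^3 * (v - t) \<le> 3 * C^3 * (T - t)" using assms C1 by (intro mult_left_mono) auto
  then show ?thesis using 1 set_integral_integrand_bound[OF assms(1) order_refl assms(2)]
    unfolding Q_def by linarith
qed

lemma Q_cont:
  assumes \<omega>: "\<omega> \<in> space M" shows "continuous_on {t..} (\<lambda>v. Q v \<omega>)"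
proof -
  have C0: "0 \<le> 3 * C^3" using C1 by simp
  have *: "\<bar>(LINT r:{t..b}|lborel. integrand \<omega> r) - (LINT r:{t..a}|lborel. integrand \<omega> r)\<bar> \<le> 3 * C^3 * (b - a)"
    if "t \<le> a" "a \<le> b" for a b
    using set_integral_Icc_combine[OF that integrand_int[OF \<omega>]] set_integral_integrand_bound[OF \<omega> that] by simp
  have "(3 * C^3)-lipschitz_on {t..} (\<lambda>b. LINT r:{t..b}|lborel. integrand \<omega> r)"
  proof (rule lipschitz_onI[OF _ C0])
    fix a b assume "a \<in> {t..}" "b \<in> {t..}"
    then show "dist (LINT r:{t..a}|lborel. integrand \<omega> r) (LINT r:{t..b}|lborel. integrand \<omega> r) \<le> 3 * C^3 * dist a b"
      using *[of a b] *[of b a] by (cases "a \<le> b") (auto simp: dist_real_def abs_minus_commute)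
  qed
  then have "continuous_on {t..} (\<lambda>b. LINT r:{t..b}|lborel. integrand \<omega> r)" by (rule lipschitz_on_continuous_on)
  moreover have "continuous_on {t..} (\<lambda>v. \<phi> (Z v \<omega>))"
    by (rule continuous_on_compose2[OF cont(1)[of UNIV]]) (use Z_cont[OF \<omega>] in \<open>auto intro: continuous_on_subset\<close>)
  ultimately show ?thesis unfolding Q_def by (intro continuous_intros)
qed

text \<open>Integrate the local expansion over an event \<open>A\<close> of the past: the noise terms have mean zero, as their
  coefficients are nonanticipating, and every part of the remainder has mean at most a multiple of
  \<open>(v' - v) * sqrt (v' - v)\<close>.\<close>
lemma Q_increment:
  assumes s: "t \<le> s" and A: "A \<in> sets (F s)" and v: "s \<le> v" "v < v'" "v' \<le> v + 1"
  shows "\<bar>(\<integral>\<omega>. indicator A \<omega> * Q v' \<omega> \<partial>M) - (\<integral>\<omega>. indicator A \<omega> * Q v \<omega> \<partial>M)\<bar>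
     \<le> 100 * C^4 * ((v' - v) * sqrt (v' - v))"
proof -
  have tv: "t \<le> v" "0 \<le> v" "0 \<le> s" using s v t0 by auto
  have AM[measurable]: "A \<in> sets M" using A sets_F_le by auto
  have AFv: "A \<in> sets (F v)" using A sets_F_mono[OF v(1)] by auto
  define \<eta> where "\<eta> = v' - v"
  have \<eta>: "0 < \<eta>" "\<eta> \<le> 1" using v by (auto simp: \<eta>_def)
  define \<xi> where "\<xi> = (\<lambda>\<omega>. w v' \<omega> - w v \<omega>)"
  define e where "e = exp (-\<rho> * (v - t))"
  have e: "0 \<le> e" "e \<le> 1" using \<rho> tv by (auto simp: e_def)
  define H1 where "H1 = (\<lambda>\<omega>. indicator A \<omega> * (e * \<sigma> * \<phi>' (Z v \<omega>)))"
  define H2 where "H2 = (\<lambda>\<omega>. indicator A \<omega> * (e * \<sigma>\<^sup>2 / 2 * \<phi>'' (Z v \<omega>)))"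
  define R where "R = (\<lambda>\<omega>. \<eta>\<^sup>2 + \<eta> * \<bar>\<xi> \<omega>\<bar> + \<bar>\<xi> \<omega>\<bar>^3 + (LINT u:{v..v'}|lborel. \<bar>w u \<omega> - w v \<omega>\<bar>))"
  have nA: "nonanticipating v (indicator A)" by (rule nonanticipatingI) (use tv AFv in auto)
  have nH1: "nonanticipating v H1" unfolding H1_def
    by (intro nonanticipating_mult[OF nA] nonanticipating_compose[OF Z_nonanticipating[OF tv(1)], of "\<lambda>z. e * \<sigma> * \<phi>' z"]) measurable
  have nH2: "nonanticipating v H2" unfolding H2_def
    by (intro nonanticipating_mult[OF nA] nonanticipating_compose[OF Z_nonanticipating[OF tv(1)], of "\<lambda>z. e * \<sigma>\<^sup>2 / 2 * \<phi>'' z"]) measurable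
  have b1: "\<bar>H1 \<omega>\<bar> \<le> C * C" for \<omega>
  proof -
    have "\<bar>e * \<sigma> * \<phi>' (Z v \<omega>)\<bar> \<le> (1 * C) * C"
      unfolding abs_mult using e \<sigma>0 \<sigma>C bd(2) C1 by (intro mult_mono) auto
    then show ?thesis using C1 by (auto simp: H1_def indicator_def)
  qed
  have b2: "\<bar>H2 \<omega>\<bar> \<le> C^2 * C" for \<omega>
  proof -
    have "\<sigma>\<^sup>2 / 2 \<le> C\<^sup>2" using power_mono[OF \<sigma>C \<sigma>0, of 2] zero_le_power2[of \<sigma>] by linarith
    then have "\<bar>e * (\<sigma>\<^sup>2 / 2) * \<phi>'' (Z v \<omega>)\<bar> \<le> (1 * C\<^sup>2) * C"
      unfolding abs_mult using e \<sigma>0 bd(3) C1 by (intro mult_mono) auto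
    then show ?thesis using C1 by (auto simp: H2_def indicator_def)
  qed
  note o1 = nonanticipating_orthogonal(1,2)[OF tv(2) v(2) nH1, of "C * C", OF b1]
  note o2 = nonanticipating_orthogonal(3,4)[OF tv(2) v(2) nH2, of "C^2 * C", OF b2]
  have Wm[measurable]: "W v \<in> borel_measurable M" "W v' \<in> borel_measurable M" using W_measurable tv v by auto
  have H1m[measurable]: "H1 \<in> borel_measurable M" and H2m[measurable]: "H2 \<in> borel_measurable M"
    using nH1 nH2 unfolding nonanticipating_def by blast+
  have \<xi>m[measurable]: "\<xi> \<in> borel_measurable M" unfolding \<xi>_def by measurable
  have \<xi>W: "AE \<omega> in M. \<xi> \<omega> = W v' \<omega> - W v \<omega>" using w_incr_AE[of v v'] tv v unfolding \<xi>_def by auto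
  have ae1: "AE \<omega> in M. H1 \<omega> * \<xi> \<omega> = H1 \<omega> * (W v' \<omega> - W v \<omega>)" using \<xi>W by eventually_elim simp
  have ae2: "AE \<omega> in M. H2 \<omega> * ((\<xi> \<omega>)\<^sup>2 - \<eta>) = H2 \<omega> * ((W v' \<omega> - W v \<omega>)\<^sup>2 - (v' - v))"
    using \<xi>W by eventually_elim (simp add: \<eta>_def)
  have i1: "integrable M (\<lambda>\<omega>. H1 \<omega> * \<xi> \<omega>)"
    using o1(1) by (subst integrable_cong_AE[OF _ _ ae1]) measurable
  have i2: "integrable M (\<lambda>\<omega>. H2 \<omega> * ((\<xi> \<omega>)\<^sup>2 - \<eta>))"
    using o2(1) by (subst integrable_cong_AE[OF _ _ ae2]) measurable
  have z1: "(\<integral>\<omega>. H1 \<omega> * \<xi> \<omega> \<partial>M) = 0"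
    using o1(2) by (subst integral_cong_AE[OF _ _ ae1]) measurable
  have z2: "(\<integral>\<omega>. H2 \<omega> * ((\<xi> \<omega>)\<^sup>2 - \<eta>) \<partial>M) = 0"
    using o2(2) by (subst integral_cong_AE[OF _ _ ae2]) measurable
  have m1: "integrable M (\<lambda>\<omega>. \<bar>\<xi> \<omega>\<bar>)" "(\<integral>\<omega>. \<bar>\<xi> \<omega>\<bar> \<partial>M) \<le> sqrt \<eta>"
    using w_incr_abs_moment[OF tv(1) v(2), of 0] by (auto simp: \<xi>_def \<eta>_def)
  have m3: "integrable M (\<lambda>\<omega>. \<bar>\<xi> \<omega>\<bar>^3)" "(\<integral>\<omega>. \<bar>\<xi> \<omega>\<bar>^3 \<partial>M) \<le> 2 * (\<eta> * sqrt \<eta>)"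
    using w_incr_abs_moment[OF tv(1) v(2), of 1] \<eta> by (auto simp: \<xi>_def \<eta>_def power3_eq_cube)
  have mJ: "integrable M (\<lambda>\<omega>. LINT u:{v..v'}|lborel. \<bar>w u \<omega> - w v \<omega>\<bar>)"
    "(\<integral>\<omega>. (LINT u:{v..v'}|lborel. \<bar>w u \<omega> - w v \<omega>\<bar>) \<partial>M) \<le> \<eta> * sqrt \<eta>"
    using w_area_moment[OF tv(1), of v'] v by (auto simp: \<eta>_def)
  have Ri: "integrable M R" unfolding R_def using m1 m3 mJ by (intro Bochner_Integration.integrable_add integrable_mult_right) auto
  have "(\<integral>\<omega>. R \<omega> \<partial>M) = \<eta>\<^sup>2 + \<eta> * (\<integral>\<omega>. \<bar>\<xi> \<omega>\<bar> \<partial>M) + (\<integral>\<omega>. \<bar>\<xi> \<omega>\<bar>^3 \<partial>M)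
      + (\<integral>\<omega>. (LINT u:{v..v'}|lborel. \<bar>w u \<omega> - w v \<omega>\<bar>) \<partial>M)"
    unfolding R_def using m1 m3 mJ by (simp add: prob_space)
  also have "\<dots> \<le> \<eta> * sqrt \<eta> + \<eta> * sqrt \<eta> + 2 * (\<eta> * sqrt \<eta>) + \<eta> * sqrt \<eta>"
  proof -
    have "\<eta> \<le> sqrt \<eta>" using \<eta> by (simp add: real_le_rsqrt power2_eq_square mult_left_le)
    then have "\<eta>\<^sup>2 \<le> \<eta> * sqrt \<eta>" using \<eta> by (simp add: power2_eq_square)
    moreover have "\<eta> * (\<integral>\<omega>. \<bar>\<xi> \<omega>\<bar> \<partial>M) \<le> \<eta> * sqrt \<eta>" using m1 \<eta> by simp
    ultimately show ?thesis using m3 mJ by linarith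
  qed
  finally have ER: "(\<integral>\<omega>. R \<omega> \<partial>M) \<le> 5 * (\<eta> * sqrt \<eta>)" by simp
  have Qi: "integrable M (\<lambda>\<omega>. indicator A \<omega> * Q u \<omega>)" if "t \<le> u" for u
  proof (rule integrable_const_bound[where B="C + 3 * C^3 * (u - t)"])
    show "AE \<omega> in M. norm (indicator A \<omega> * Q u \<omega>) \<le> C + 3 * C^3 * (u - t)"
    proof (rule AE_I2)
      fix \<omega> assume "\<omega> \<in> space M"
      from Q_bound[OF this that order_refl] that C1 show "norm (indicator A \<omega> * Q u \<omega>) \<le> C + 3 * C^3 * (u - t)"
        by (auto simp: indicator_def abs_mult)
    qed
  qed measurable
  have pw: "\<bar>indicator A \<omega> * Q v' \<omega> - indicator A \<omega> * Q v \<omega> - (H1 \<omega> * \<xi> \<omega> + H2 \<omega> * ((\<xi> \<omega>)\<^sup>2 - \<eta>))\<bar> \<le> 20 * C^4 * R \<omega>"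
    if \<omega>: "\<omega> \<in> space M" for \<omega>
  proof (cases "\<omega> \<in> A")
    case True
    note L = local_expansion[OF \<rho> \<sigma>0 \<sigma>C \<theta>C \<theta>_path[OF \<omega>] Z_cont[OF \<omega>] w_cont[OF \<omega>] Z_incr[OF \<omega> tv(1)] tv(1) less_imp_le[OF v(2)] v(3)]
    have "Q v' \<omega> - Q v \<omega> = exp (-\<rho> * (v' - t)) * \<phi> (Z v' \<omega>) - e * \<phi> (Z v \<omega>) - (LINT u:{v..v'}|lborel. integrand \<omega> u)"
      unfolding Q_def e_def using set_integral_Icc_combine[OF tv(1) less_imp_le[OF v(2)] integrand_int[OF \<omega> order_refl]] by simp
    then have "Q v' \<omega> - Q v \<omega> - (H1 \<omega> * \<xi> \<omega> + H2 \<omega> * ((\<xi> \<omega>)\<^sup>2 - \<eta>)) =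
       exp (-\<rho> * (v' - t)) * \<phi> (Z v' \<omega>) - e * \<phi> (Z v \<omega>) - (LINT u:{v..v'}|lborel. integrand \<omega> u)
       - e * (\<phi>' (Z v \<omega>) * \<sigma> * \<xi> \<omega> + \<phi>'' (Z v \<omega>) / 2 * \<sigma>\<^sup>2 * ((\<xi> \<omega>)\<^sup>2 - \<eta>))"
      using True by (simp add: H1_def H2_def algebra_simps)
    then show ?thesis using L True unfolding R_def \<xi>_def \<eta>_def e_def integrand_def by simp
  next
    case False
    have "0 \<le> R \<omega>" unfolding R_def using \<eta>
      by (intro add_nonneg_nonneg) (auto simp: set_lebesgue_integral_def intro!: Bochner_Integration.integral_nonneg)
    then show ?thesis using False C1 by (simp add: H1_def H2_def)
  qed
  let ?D = "\<lambda>\<omega>. indicator A \<omega> * Q v' \<omega> - indicator A \<omega> * Q v \<omega> - (H1 \<omega> * \<xi> \<omega> + H2 \<omega> * ((\<xi> \<omega>)\<^sup>2 - \<eta>))"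
  have q1: "integrable M (\<lambda>\<omega>. indicator A \<omega> * Q v' \<omega>)" and q2: "integrable M (\<lambda>\<omega>. indicator A \<omega> * Q v \<omega>)"
    using Qi tv v by auto
  have eq: "(\<integral>\<omega>. indicator A \<omega> * Q v' \<omega> \<partial>M) - (\<integral>\<omega>. indicator A \<omega> * Q v \<omega> \<partial>M) = (\<integral>\<omega>. ?D \<omega> \<partial>M)"
    using q1 q2 i1 i2 z1 z2 by (simp add: Bochner_Integration.integral_diff Bochner_Integration.integral_add)
  have Di: "integrable M ?D" using q1 q2 i1 i2 by (intro Bochner_Integration.integrable_diff Bochner_Integration.integrable_add)
  have "norm (\<integral>\<omega>. ?D \<omega> \<partial>M) \<le> (\<integral>\<omega>. 20 * C^4 * R \<omega> \<partial>M)"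
    by (rule order_trans[OF integral_norm_bound Bochner_Integration.integral_mono]) (use Di Ri pw in auto)
  also have "\<dots> = 20 * C^4 * (\<integral>\<omega>. R \<omega> \<partial>M)" by simp
  also have "\<dots> \<le> 20 * C^4 * (5 * (\<eta> * sqrt \<eta>))" using ER C1 by (intro mult_left_mono) auto
  finally show ?thesis unfolding eq by (simp add: \<eta>_def)
qed

text \<open>The means have increments of order \<open>3 / 2\<close> in the length of the time interval, hence zero
  derivative.\<close>
lemma Q_martingale:
  assumes "t \<le> s" "A \<in> sets (F s)" "s \<le> v"
  shows "(\<integral>\<omega>. indicator A \<omega> * Q v \<omega> \<partial>M) = (\<integral>\<omega>. indicator A \<omega> * Q s \<omega> \<partial>M)"
  using constant_if_increments_superlinear[of s "\<lambda>v. \<integral>\<omega>. indicator A \<omega> * Q v \<omega> \<partial>M", OF Q_increment[OF assms(1,2)] assms(3)] .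


text \<open>Round \<open>T\<close> up to a grid of mesh \<open>(T1 - t) / Suc n\<close>. The rounded time has index \<open>c n \<omega>\<close>, and the \<open>k\<close>-th
  step is made exactly when \<open>s n k < T \<omega>\<close>, an event known at time \<open>s n k\<close>; so each step
  has mean zero. Continuity of paths removes the rounding, by dominated convergence.\<close>
lemma optional_stopping_Q:
  fixes T :: "'a \<Rightarrow> real"
  assumes tw: "t < T1" and T: "\<And>\<omega>. \<omega> \<in> space M \<Longrightarrow> t \<le> T \<omega>" "\<And>\<omega>. \<omega> \<in> space M \<Longrightarrow> T \<omega> \<le> T1"
    and st: "\<And>v. t \<le> v \<Longrightarrow> v < T1 \<Longrightarrow> {\<omega> \<in> space M. v < T \<omega>} \<in> sets (F v)"
  shows "integrable M (\<lambda>\<omega>. Q (T \<omega>) \<omega>)" "(\<integral>\<omega>. Q (T \<omega>) \<omega> \<partial>M) = \<phi> x"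
proof -
  define s where "s = (\<lambda>n k. t + real k * ((T1 - t) / real (Suc n)))"
  define c where "c = (\<lambda>n \<omega>. nat \<lceil>(T \<omega> - t) * (real (Suc n) / (T1 - t))\<rceil>)"
  define B where "B = C + 3 * C^3 * (T1 - t)"
  have s_le: "t \<le> s n k" for n k using tw by (simp add: s_def)
  have s_lt: "s n k < T1" if "k < Suc n" for n k
  proof -
    have "real k / real (Suc n) * (T1 - t) < 1 * (T1 - t)"
      using that tw by (intro mult_strict_right_mono) auto
    then show ?thesis by (simp add: s_def)
  qed
  have sT1: "s n k \<le> T1" if "k \<le> Suc n" for n k
  proof -
    have "real k / real (Suc n) * (T1 - t) \<le> 1 * (T1 - t)"
      using that tw by (intro mult_right_mono) auto
    then show ?thesis by (simp add: s_def)
  qed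
  have below: "k < c n \<omega> \<longleftrightarrow> s n k < T \<omega>" for n k \<omega>
  proof -
    have "k < c n \<omega> \<longleftrightarrow> real k < (T \<omega> - t) * (real (Suc n) / (T1 - t))"
      unfolding c_def by (simp add: zless_nat_eq_int_zless less_ceiling_iff)
    also have "\<dots> \<longleftrightarrow> s n k < T \<omega>" using tw by (simp add: s_def field_simps)
    finally show ?thesis .
  qed
  have c_le: "c n \<omega> \<le> Suc n" if "\<omega> \<in> space M" for n \<omega>
  proof -
    have "\<not> Suc n < c n \<omega>" using T(2)[OF that] tw unfolding below by (simp add: s_def)
    then show ?thesis by simp
  qed
  have above: "T \<omega> \<le> s n (c n \<omega>)" for n \<omega> using below[of "c n \<omega>" n \<omega>] by simp
  have close: "s n (c n \<omega>) \<le> T \<omega> + (T1 - t) / real (Suc n)" if "\<omega> \<in> space M" for n \<omega>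
  proof (cases "c n \<omega>")
    case 0 then show ?thesis using T(1)[OF that] tw by (simp add: s_def add_increasing2)
  next
    case (Suc k)
    then have "s n k < T \<omega>" using below[of k n \<omega>] by simp
    then show ?thesis unfolding Suc s_def by (simp add: distrib_right add_divide_distrib)
  qed
  define g where "g = (\<lambda>n k \<omega>. indicator {\<omega> \<in> space M. s n k < T \<omega>} \<omega> * (Q (s n (Suc k)) \<omega> - Q (s n k) \<omega>))"
  define S where "S = (\<lambda>n \<omega>. Q (s n (c n \<omega>)) \<omega>)"
  have tele: "S n \<omega> = Q t \<omega> + (\<Sum>k<Suc n. g n k \<omega>)"
    if \<omega>: "\<omega> \<in> space M" for n \<omega>
  proof -
    have "(\<Sum>k<Suc n. g n k \<omega>)
       = (\<Sum>k<c n \<omega>. Q (s n (Suc k)) \<omega> - Q (s n k) \<omega>)"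
      unfolding g_def
      using c_le[OF \<omega>, of n] \<omega> by (intro sum.mono_neutral_cong_right) (auto simp: indicator_def below[symmetric])
    also have "\<dots> = Q (s n (c n \<omega>)) \<omega> - Q (s n 0) \<omega>" by (rule sum_lessThan_telescope)
    finally show ?thesis by (simp add: S_def s_def)
  qed
  have Qi: "integrable M (\<lambda>\<omega>. indicator A \<omega> * Q u \<omega>)" if "t \<le> u" "u \<le> T1" "A \<in> sets M" for u A
  proof (rule integrable_const_bound[where B=B])
    show "AE \<omega> in M. norm (indicator A \<omega> * Q u \<omega>) \<le> B"
    proof (rule AE_I2)
      fix \<omega> assume "\<omega> \<in> space M"
      from Q_bound[OF this that(1,2)] show "norm (indicator A \<omega> * Q u \<omega>) \<le> B"
        by (auto simp: indicator_def abs_mult B_def)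
    qed
    show "(\<lambda>\<omega>. indicator A \<omega> * Q u \<omega>) \<in> borel_measurable M" using that(3) by measurable
  qed
  have Qti: "integrable M (Q t)"
    by (rule integrable_const_bound[where B=B]) (use Q_bound[of _ t T1] tw in \<open>auto simp: B_def\<close>)
  have AM: "{\<omega> \<in> space M. s n k < T \<omega>} \<in> sets M" "{\<omega> \<in> space M. s n k < T \<omega>} \<in> sets (F (s n k))" if "k < Suc n" for n k
    using st[OF s_le s_lt[OF that]] sets_F_le by auto
  have step: "integrable M (g n k)"
    "(\<integral>\<omega>. g n k \<omega> \<partial>M) = 0" if k: "k < Suc n" for n k
  proof -
    note i = Qi[OF s_le sT1 AM(1)[OF k], of "Suc k"] Qi[OF s_le sT1 AM(1)[OF k], of k]
    have le: "s n k \<le> s n (Suc k)" using tw by (simp add: s_def divide_right_mono)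
    show "integrable M (g n k)"
      unfolding g_def right_diff_distrib using i k by auto
    show "(\<integral>\<omega>. g n k \<omega> \<partial>M) = 0"
      unfolding g_def right_diff_distrib using i k Q_martingale[OF s_le AM(2)[OF k] le] by simp
  qed
  have ESn: "(\<integral>\<omega>. S n \<omega> \<partial>M) = \<phi> x" for n
  proof -
    have Q0: "Q t \<omega> = \<phi> x" for \<omega> using set_integral_Icc_refl by (simp add: Q_def Z_eq w_start del: atLeastAtMost_singleton)
    have g: "integrable M (g n k)" "(\<integral>\<omega>. g n k \<omega> \<partial>M) = 0" if "k \<in> {..<Suc n}" for k
      using step[of k n] that by simp_all
    have "(\<integral>\<omega>. S n \<omega> \<partial>M) = (\<integral>\<omega>. Q t \<omega> + (\<Sum>k<Suc n. g n k \<omega>) \<partial>M)"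
      by (rule Bochner_Integration.integral_cong) (simp_all only: tele)
    also have "\<dots> = (\<integral>\<omega>. Q t \<omega> \<partial>M) + (\<integral>\<omega>. (\<Sum>k<Suc n. g n k \<omega>) \<partial>M)"
      by (rule Bochner_Integration.integral_add[OF Qti Bochner_Integration.integrable_sum[OF g(1)]])
    also have "(\<integral>\<omega>. (\<Sum>k<Suc n. g n k \<omega>) \<partial>M) = (\<Sum>k<Suc n. \<integral>\<omega>. g n k \<omega> \<partial>M)"
      by (rule Bochner_Integration.integral_sum[OF g(1)])
    also have "\<dots> = 0" by (rule sum.neutral) (use g(2) in blast)
    also have "(\<integral>\<omega>. Q t \<omega> \<partial>M) + 0 = \<phi> x" by (simp add: Q0 prob_space)
    finally show ?thesis .
  qed
  have Sm: "S n \<in> borel_measurable M" for n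
  proof -
    have "(\<lambda>\<omega>. Q t \<omega> + (\<Sum>k<Suc n. g n k \<omega>)) \<in> borel_measurable M"
      using step(1) by (intro borel_measurable_add borel_measurable_sum Q_meas borel_measurable_integrable) auto
    then show ?thesis by (subst measurable_cong[OF tele])
  qed
  have lim: "(\<lambda>n. S n \<omega>) \<longlonglongrightarrow> Q (T \<omega>) \<omega>" if \<omega>: "\<omega> \<in> space M" for \<omega>
    unfolding S_def
  proof (rule continuous_on_tendsto_compose[OF Q_cont[OF \<omega>]])
    have "(\<lambda>n. (T1 - t) / real (Suc n)) \<longlonglongrightarrow> 0" by (rule LIMSEQ_Suc[OF lim_const_over_n])
    then have "(\<lambda>n. T \<omega> + (T1 - t) / real (Suc n)) \<longlonglongrightarrow> T \<omega>" by (auto intro: tendsto_eq_intros)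
    note sw = tendsto_sandwich[OF _ _ tendsto_const this]
    show "(\<lambda>n. s n (c n \<omega>)) \<longlonglongrightarrow> T \<omega>"
      by (rule sw) (use above close[OF \<omega>] in auto)
    show "T \<omega> \<in> {t..}" using T(1)[OF \<omega>] by simp
  qed (use s_le in auto)
  have Tm: "(\<lambda>\<omega>. Q (T \<omega>) \<omega>) \<in> borel_measurable M"
    by (rule borel_measurable_LIMSEQ_real[OF lim Sm])
  have Sb: "norm (S n \<omega>) \<le> B" if "\<omega> \<in> space M" for n \<omega>
    unfolding S_def B_def real_norm_def by (rule Q_bound[OF that s_le sT1[OF c_le[OF that]]])
  show "integrable M (\<lambda>\<omega>. Q (T \<omega>) \<omega>)"
    by (rule integrable_const_bound[where B=B]) (use Q_bound T Tm in \<open>auto simp: B_def\<close>)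
  have "(\<lambda>n. \<integral>\<omega>. S n \<omega> \<partial>M) \<longlonglongrightarrow> (\<integral>\<omega>. Q (T \<omega>) \<omega> \<partial>M)"
    by (rule integral_dominated_convergence[where w="\<lambda>\<omega>. B"]) (use Tm Sm lim Sb in auto)
  then show "(\<integral>\<omega>. Q (T \<omega>) \<omega> \<partial>M) = \<phi> x" unfolding ESn by (simp add: LIMSEQ_const_iff)
qed

end

section \<open>Dynkin's formula for functions with a kink in the second derivative\<close>

lemma difference_quotient_seq:
  assumes "(f has_real_derivative D) (at x within {x..})"
  shows "(\<lambda>n. (f (x + 1 / real (Suc n)) - f x) * real (Suc n)) \<longlonglongrightarrow> D"
proof -
  have "filterlim (\<lambda>n. x + 1 / real (Suc n)) (at x within {x..}) sequentially"
    unfolding filterlim_at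
    using tendsto_add[OF tendsto_const LIMSEQ_Suc[OF lim_const_over_n], of x 1] by simp
  with assms have "(\<lambda>n. (f (x + 1 / real (Suc n)) - f x) / (x + 1 / real (Suc n) - x)) \<longlonglongrightarrow> D"
    unfolding has_field_derivative_iff by (rule filterlim_compose)
  then show ?thesis by (simp add: field_simps)
qed

text \<open>Test functions whose second derivative \<open>\<psi>\<close> exists only from the right. The Lipschitz bound on the
  first derivative bounds \<open>\<psi>\<close> and its approximations.\<close>
locale C11_test =
  fixes \<phi> \<phi>' \<psi> :: "real \<Rightarrow> real" and B :: real
  assumes D1: "\<And>x. (\<phi> has_real_derivative \<phi>' x) (at x)"
    and D2: "\<And>x. (\<phi>' has_real_derivative \<psi> x) (at x within {x..})"
    and Lip: "\<And>x y. \<bar>\<phi>' x - \<phi>' y\<bar> \<le> B * \<bar>x - y\<bar>"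
    and bnd: "\<And>x. \<bar>\<phi> x\<bar> \<le> B" "\<And>x. \<bar>\<phi>' x\<bar> \<le> B"
begin

lemma B0: "0 \<le> B" using bnd(1) by (rule order_trans[OF abs_ge_zero])

text \<open>An antiderivative of \<open>\<phi>\<close>. Its forward difference quotients have as first and second derivatives
  those of \<open>\<phi>\<close> and of \<open>\<phi>'\<close>, and thus form smooth test functions that approximate \<open>\<phi>\<close> together with
  \<open>\<phi>'\<close> and \<open>\<psi>\<close>.\<close>
definition \<Phi> :: "real \<Rightarrow> real" where
  "\<Phi> = (SOME \<Phi>. \<forall>x. (\<Phi> has_real_derivative \<phi> x) (at x))"

lemma D0: "(\<Phi> has_real_derivative \<phi> x) (at x)"
proof -
  have "\<exists>F. \<forall>x::real. -\<infinity> < ereal x \<longrightarrow> ereal x < \<infinity> \<longrightarrow> (F has_vector_derivative \<phi> x) (at x)"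
    using DERIV_isCont[OF D1] by (intro einterval_antiderivative) auto
  then have "\<exists>F. \<forall>x. (F has_real_derivative \<phi> x) (at x)"
    by (simp add: has_real_derivative_iff_has_vector_derivative)
  from someI_ex[OF this] show ?thesis unfolding \<Phi>_def by blast
qed

definition diffq :: "(real \<Rightarrow> real) \<Rightarrow> nat \<Rightarrow> real \<Rightarrow> real" where
  "diffq f n x = (f (x + 1 / real (Suc n)) - f x) * real (Suc n)"

lemma diffq_bound:
  assumes "\<And>x y. \<bar>f x - f y\<bar> \<le> B * \<bar>x - y\<bar>"
  shows "\<bar>diffq f n x\<bar> \<le> B"
proof -
  have "\<bar>diffq f n x\<bar> = \<bar>f (x + 1 / real (Suc n)) - f x\<bar> * real (Suc n)" by (simp add: diffq_def abs_mult)
  also have "\<dots> \<le> (B * \<bar>(x + 1 / real (Suc n)) - x\<bar>) * real (Suc n)"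
    by (rule mult_right_mono[OF assms]) simp
  also have "\<dots> = B" by (simp del: of_nat_Suc)
  finally show ?thesis .
qed

lemma lip_of_deriv:
  assumes "\<And>x. (f has_real_derivative g x) (at x)" "\<And>x. \<bar>g x\<bar> \<le> B"
  shows "\<bar>f x - f y\<bar> \<le> B * \<bar>x - y\<bar>"
  using field_differentiable_bound[of UNIV f g B x y] assms by auto

lemma diffq_deriv:
  assumes "\<And>x. (f has_real_derivative g x) (at x)"
  shows "(diffq f n has_real_derivative diffq g n x) (at x)"
  unfolding diffq_def
  by (rule DERIV_cmult_right DERIV_diff DERIV_shift[THEN iffD1] assms)+

definition Cn :: "nat \<Rightarrow> real" where "Cn n = 1 + 2 * B * real (Suc n) + B"

lemma smooth_test_diffq:
  assumes "Cn n \<le> C" shows "smooth_test (diffq \<Phi> n) (diffq \<phi> n) (diffq \<phi>' n) C"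
proof
  have C: "1 \<le> C" "B \<le> C" "2 * B * real (Suc n) \<le> C"
    using assms B0 mult_nonneg_nonneg[of "2*B" "real (Suc n)"] unfolding Cn_def by linarith+
  show "1 \<le> C" by fact
  show "(diffq \<Phi> n has_real_derivative diffq \<phi> n x) (at x)" for x by (rule diffq_deriv[OF D0])
  show "(diffq \<phi> n has_real_derivative diffq \<phi>' n x) (at x)" for x by (rule diffq_deriv[OF D1])
  show "\<bar>diffq \<Phi> n x\<bar> \<le> C" "\<bar>diffq \<phi> n x\<bar> \<le> C" "\<bar>diffq \<phi>' n x\<bar> \<le> C" for x
    by (rule order_trans[OF diffq_bound[OF lip_of_deriv[OF D0 bnd(1)]] C(2)]
        order_trans[OF diffq_bound[OF lip_of_deriv[OF D1 bnd(2)]] C(2)] order_trans[OF diffq_bound[OF Lip] C(2)])+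
  show "\<bar>diffq \<phi>' n x - diffq \<phi>' n y\<bar> \<le> C * \<bar>x - y\<bar>" for x y
  proof -
    let ?h = "1 / real (Suc n)"
    have "\<bar>diffq \<phi>' n x - diffq \<phi>' n y\<bar> = \<bar>(\<phi>' (x + ?h) - \<phi>' (y + ?h)) - (\<phi>' x - \<phi>' y)\<bar> * real (Suc n)"
    proof -
      have "diffq \<phi>' n x - diffq \<phi>' n y = ((\<phi>' (x + ?h) - \<phi>' (y + ?h)) - (\<phi>' x - \<phi>' y)) * real (Suc n)"
        by (simp add: diffq_def algebra_simps)
      then show ?thesis by (simp only: abs_mult abs_of_nat)
    qed
    also have "\<dots> \<le> (2 * B * \<bar>x - y\<bar>) * real (Suc n)"
      by (rule mult_right_mono) (use Lip[of x y] Lip[of "x + ?h" "y + ?h"] in auto)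
    also have "\<dots> = (2 * B * real (Suc n)) * \<bar>x - y\<bar>" by simp
    also have "\<dots> \<le> C * \<bar>x - y\<bar>" by (rule mult_right_mono[OF C(3)]) simp
    finally show ?thesis .
  qed
qed

lemma diffq_lims:
  "(\<lambda>n. diffq \<Phi> n x) \<longlonglongrightarrow> \<phi> x" "(\<lambda>n. diffq \<phi> n x) \<longlonglongrightarrow> \<phi>' x" "(\<lambda>n. diffq \<phi>' n x) \<longlonglongrightarrow> \<psi> x"
  unfolding diffq_def
  by (rule difference_quotient_seq[OF has_field_derivative_at_within[OF D0]]
      difference_quotient_seq[OF has_field_derivative_at_within[OF D1]] difference_quotient_seq[OF D2])+

lemma diffq_bounds: "\<bar>diffq \<Phi> n x\<bar> \<le> B" "\<bar>diffq \<phi> n x\<bar> \<le> B" "\<bar>diffq \<phi>' n x\<bar> \<le> B"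
  by (rule diffq_bound[OF lip_of_deriv[OF D0 bnd(1)]] diffq_bound[OF lip_of_deriv[OF D1 bnd(2)]] diffq_bound[OF Lip])+

lemma \<psi>_bound: "\<bar>\<psi> x\<bar> \<le> B"
  by (rule tendsto_upperbound[OF tendsto_rabs[OF diffq_lims(3)]]) (auto simp: diffq_bounds)

lemma C11_meas [measurable]: "\<phi> \<in> borel_measurable borel" "\<phi>' \<in> borel_measurable borel" "\<psi> \<in> borel_measurable borel"
proof -
  show 1: "\<phi> \<in> borel_measurable borel"
    by (rule borel_measurable_continuous_onI) (use DERIV_isCont[OF D1] in \<open>auto intro: continuous_at_imp_continuous_on\<close>)
  have [measurable]: "\<phi>' \<in> borel_measurable borel"
    by (rule borel_measurable_continuous_onI, rule lipschitz_on_continuous_on[of B], rule lipschitz_onI)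
      (use Lip B0 in \<open>auto simp: dist_real_def\<close>)
  then show "\<phi>' \<in> borel_measurable borel" .
  have "diffq \<phi>' n \<in> borel_measurable borel" for n unfolding diffq_def by measurable
  then show "\<psi> \<in> borel_measurable borel" by (rule borel_measurable_LIMSEQ_real[OF diffq_lims(3)])
qed

definition genR :: "real \<Rightarrow> real \<Rightarrow> real \<Rightarrow> real \<Rightarrow> real" where
  "genR \<rho> \<sigma> \<theta> x = - \<rho> * \<phi> x + \<theta> * \<phi>' x + \<sigma>\<^sup>2 / 2 * \<psi> x"

end

lemma gen_abs_le:
  fixes a b c :: real
  assumes "\<bar>a\<bar> \<le> B" "\<bar>b\<bar> \<le> B" "\<bar>c\<bar> \<le> B" "0 \<le> \<rho>" "\<bar>\<theta>\<bar> \<le> K"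
  shows "\<bar>- \<rho> * a + \<theta> * b + \<sigma>\<^sup>2 / 2 * c\<bar> \<le> (\<rho> + K + \<sigma>\<^sup>2 / 2) * B"
proof -
  have "\<bar>\<rho> * a\<bar> \<le> \<rho> * B" unfolding abs_mult using assms by (intro mult_mono) auto
  moreover have "\<bar>\<theta> * b\<bar> \<le> K * B" unfolding abs_mult using assms by (intro mult_mono) auto
  moreover have "\<bar>\<sigma>\<^sup>2 / 2 * c\<bar> \<le> \<sigma>\<^sup>2 / 2 * B" unfolding abs_mult using assms by (intro mult_mono) auto
  ultimately show ?thesis unfolding distrib_right by linarith
qed

text \<open>The bounds on the difference quotients do not depend on \<open>n\<close>, although the Lipschitz constants of their
  second derivatives do; hence optional stopping applies to each of them, and dominated convergence,
  first along a path and then over all paths, gives the formula in the limit. Forward quotients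
  converge to \<open>\<psi>\<close> at the kink too.\<close>
theorem (in diffusion) dynkin_formula:
  fixes T :: "'a \<Rightarrow> real" and \<rho> :: real
  assumes test: "C11_test \<phi> \<phi>' \<psi> B" and \<rho>: "0 \<le> \<rho>"
    and tw: "t < T1" and T: "\<And>\<omega>. \<omega> \<in> space M \<Longrightarrow> t \<le> T \<omega>" "\<And>\<omega>. \<omega> \<in> space M \<Longrightarrow> T \<omega> \<le> T1"
    and st: "\<And>v. t \<le> v \<Longrightarrow> v < T1 \<Longrightarrow> {\<omega> \<in> space M. v < T \<omega>} \<in> sets (F v)"
  defines "G \<equiv> (\<lambda>r \<omega>. exp (-\<rho> * (r - t)) * (- \<rho> * \<phi> (Z r \<omega>) + \<theta> r \<omega> * \<phi>' (Z r \<omega>) + \<sigma>\<^sup>2 / 2 * \<psi> (Z r \<omega>)))"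
  shows "integrable M (\<lambda>\<omega>. exp (-\<rho> * (T \<omega> - t)) * \<phi> (Z (T \<omega>) \<omega>) - (LINT r:{t..T \<omega>}|lborel. G r \<omega>))"
    and "(\<integral>\<omega>. exp (-\<rho> * (T \<omega> - t)) * \<phi> (Z (T \<omega>) \<omega>) - (LINT r:{t..T \<omega>}|lborel. G r \<omega>) \<partial>M) = \<phi> x"
proof -
  interpret C11_test \<phi> \<phi>' \<psi> B by fact
  define C where "C = (\<lambda>n. Cn n + \<rho> + \<sigma> + K)"
  have Cge: "Cn n \<le> C n" "\<rho> \<le> C n" "\<sigma> \<le> C n" "K \<le> C n" for n
    using \<rho> \<sigma>0 K0 B0 mult_nonneg_nonneg[of "2*B" "real (Suc n)"] by (auto simp: C_def Cn_def)
  have dt: "diffusion_test M F W t x \<sigma> K w \<theta> Z (diffq \<Phi> n) (diffq \<phi> n) (diffq \<phi>' n) (C n) \<rho>" for n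
    by (intro diffusion_test.intro diffusion_axioms smooth_test_diffq Cge diffusion_test_axioms.intro \<rho>)
  define Gn where "Gn = (\<lambda>n r \<omega>. exp (-\<rho> * (r - t)) * (- \<rho> * diffq \<Phi> n (Z r \<omega>) + \<theta> r \<omega> * diffq \<phi> n (Z r \<omega>) + \<sigma>\<^sup>2 / 2 * diffq \<phi>' n (Z r \<omega>)))"
  define Qn where "Qn = (\<lambda>n \<omega>. exp (-\<rho> * (T \<omega> - t)) * diffq \<Phi> n (Z (T \<omega>) \<omega>) - (LINT r:{t..T \<omega>}|lborel. Gn n r \<omega>))"
  define Qx where "Qx = (\<lambda>\<omega>. exp (-\<rho> * (T \<omega> - t)) * \<phi> (Z (T \<omega>) \<omega>) - (LINT r:{t..T \<omega>}|lborel. G r \<omega>))"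
  have Q: "integrable M (Qn n)" "(\<integral>\<omega>. Qn n \<omega> \<partial>M) = diffq \<Phi> n x" for n
  proof -
    interpret D: diffusion_test M F W t x \<sigma> K w \<theta> Z "diffq \<Phi> n" "diffq \<phi> n" "diffq \<phi>' n" "C n" \<rho> by (rule dt)
    have "Qn n = (\<lambda>\<omega>. D.Q (T \<omega>) \<omega>)"
      by (simp add: Qn_def D.Q_def D.integrand_def D.gen_def Gn_def)
    then show "integrable M (Qn n)" "(\<integral>\<omega>. Qn n \<omega> \<partial>M) = diffq \<Phi> n x"
      using D.optional_stopping_Q[OF tw T st] by simp_all
  qed
  let ?L = "(\<rho> + K + \<sigma>\<^sup>2 / 2) * B"
  have L0: "0 \<le> ?L" using \<rho> K0 B0 by simp
  have Gb: "\<bar>Gn n r \<omega>\<bar> \<le> ?L" if "t \<le> r" for n r \<omega>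
  proof -
    have "exp (-\<rho> * (r - t)) \<le> 1" using that \<rho> by simp
    then have "\<bar>Gn n r \<omega>\<bar> \<le> 1 * ?L" unfolding Gn_def abs_mult
      using gen_abs_le[OF diffq_bounds \<rho> \<theta>_bound] L0 by (intro mult_mono) auto
    then show ?thesis by simp
  qed
  have Glim: "(\<lambda>n. Gn n r \<omega>) \<longlonglongrightarrow> G r \<omega>" for r \<omega>
    unfolding Gn_def G_def by (intro tendsto_intros diffq_lims)
  have Gnm: "(\<lambda>r. Gn n r \<omega>) \<in> borel_measurable borel" if \<omega>: "\<omega> \<in> space M" for n \<omega>
  proof -
    interpret D: diffusion_test M F W t x \<sigma> K w \<theta> Z "diffq \<Phi> n" "diffq \<phi> n" "diffq \<phi>' n" "C n" \<rho> by (rule dt)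
    have "(\<lambda>r. Gn n r \<omega>) = D.integrand \<omega>" by (auto simp: Gn_def D.integrand_def D.gen_def)
    then show ?thesis using measurable_compose[OF measurable_Pair2'[OF \<omega>] D.integrand_pair_meas] by simp
  qed
  have Ilim: "(\<lambda>n. LINT r:{t..T \<omega>}|lborel. Gn n r \<omega>) \<longlonglongrightarrow> (LINT r:{t..T \<omega>}|lborel. G r \<omega>)" if \<omega>: "\<omega> \<in> space M" for \<omega>
    unfolding set_lebesgue_integral_def
  proof (rule integral_dominated_convergence[where w="\<lambda>r. indicator {t..T \<omega>} r *\<^sub>R ?L"])
    have Gm: "(\<lambda>r. G r \<omega>) \<in> borel_measurable borel" by (rule borel_measurable_LIMSEQ_real[OF Glim Gnm[OF \<omega>]])
    show "(\<lambda>r. indicator {t..T \<omega>} r *\<^sub>R G r \<omega>) \<in> borel_measurable lborel" using Gm by measurable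
    show "(\<lambda>r. indicator {t..T \<omega>} r *\<^sub>R Gn n r \<omega>) \<in> borel_measurable lborel" for n using Gnm[OF \<omega>, of n] by measurable
    show "integrable lborel (\<lambda>r. indicator {t..T \<omega>} r *\<^sub>R ?L)"
      using set_integrable_bounded_Icc[of "\<lambda>_. ?L" t "T \<omega>" ?L] L0 by (simp add: set_integrable_def)
    show "AE r in lborel. (\<lambda>n. indicator {t..T \<omega>} r *\<^sub>R Gn n r \<omega>) \<longlonglongrightarrow> indicator {t..T \<omega>} r *\<^sub>R G r \<omega>"
      by (intro AE_I2 tendsto_intros Glim)
    show "AE r in lborel. norm (indicator {t..T \<omega>} r *\<^sub>R Gn n r \<omega>) \<le> indicator {t..T \<omega>} r *\<^sub>R ?L" for n
      using Gb by (intro AE_I2) (auto simp: indicator_def)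
  qed
  have Qlim: "(\<lambda>n. Qn n \<omega>) \<longlonglongrightarrow> Qx \<omega>" if "\<omega> \<in> space M" for \<omega>
    unfolding Qn_def Qx_def by (intro tendsto_intros diffq_lims Ilim that)
  have Qb: "\<bar>Qn n \<omega>\<bar> \<le> B + ?L * (T1 - t)" if \<omega>: "\<omega> \<in> space M" for n \<omega>
  proof -
    have "exp (-\<rho> * (T \<omega> - t)) \<le> 1" using T(1)[OF \<omega>] \<rho> by simp
    then have 1: "\<bar>exp (-\<rho> * (T \<omega> - t)) * diffq \<Phi> n (Z (T \<omega>) \<omega>)\<bar> \<le> 1 * B"
      unfolding abs_mult using diffq_bounds B0 by (intro mult_mono) auto
    have "\<bar>LINT r:{t..T \<omega>}|lborel. Gn n r \<omega>\<bar> \<le> ?L * (T \<omega> - t)"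
      by (rule set_integral_Icc_abs_le_const[OF T(1)[OF \<omega>] set_integrable_bounded_Icc[where B="?L"]])
        (use Gb Gnm[OF \<omega>] in auto)
    also have "\<dots> \<le> ?L * (T1 - t)" using T(2)[OF \<omega>] L0 by (intro mult_left_mono) auto
    finally show ?thesis using 1 unfolding Qn_def by linarith
  qed
  have Qm: "Qx \<in> borel_measurable M"
    by (rule borel_measurable_LIMSEQ_real[OF Qlim borel_measurable_integrable[OF Q(1)]])
  have Qxb: "\<bar>Qx \<omega>\<bar> \<le> B + ?L * (T1 - t)" if "\<omega> \<in> space M" for \<omega>
    by (rule tendsto_upperbound[OF tendsto_rabs[OF Qlim[OF that]]]) (use Qb[OF that] in auto)
  have Qi: "integrable M Qx"
    by (rule integrable_const_bound[where B="B + ?L * (T1 - t)"]) (use Qxb Qm in auto)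
  have "(\<lambda>n. \<integral>\<omega>. Qn n \<omega> \<partial>M) \<longlonglongrightarrow> (\<integral>\<omega>. Qx \<omega> \<partial>M)"
    by (rule integral_dominated_convergence[where w="\<lambda>\<omega>. B + ?L * (T1 - t)"])
      (use Qm borel_measurable_integrable[OF Q(1)] Qlim Qb in auto)
  then have "(\<integral>\<omega>. Qx \<omega> \<partial>M) = \<phi> x"
    unfolding Q(2) using LIMSEQ_unique[OF _ diffq_lims(1)] by blast
  then show "(\<integral>\<omega>. exp (-\<rho> * (T \<omega> - t)) * \<phi> (Z (T \<omega>) \<omega>) - (LINT r:{t..T \<omega>}|lborel. G r \<omega>) \<partial>M) = \<phi> x"
    by (simp add: Qx_def)
  show "integrable M (\<lambda>\<omega>. exp (-\<rho> * (T \<omega> - t)) * \<phi> (Z (T \<omega>) \<omega>) - (LINT r:{t..T \<omega>}|lborel. G r \<omega>))"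
    using Qi by (simp add: Qx_def)
qed

section \<open>The controlled process as a diffusion up to ruin\<close>

lemma ruin_time_ge: "ereal t \<le> ruin_time t Y \<omega>"
  unfolding ruin_time_def by (auto intro: Inf_greatest)

lemma pos_before_ruin: "t \<le> u \<Longrightarrow> ereal u < ruin_time t Y \<omega> \<Longrightarrow> 0 < Y u \<omega>"
  unfolding ruin_time_def by (metis (mono_tags, lifting) Inf_lower imageI leD linorder_not_less mem_Collect_eq)

lemma less_ruin_time_iff:
  assumes c: "continuous_on {t..} (\<lambda>s. Y s \<omega>)" and u: "t \<le> u"
  shows "ereal u < ruin_time t Y \<omega> \<longleftrightarrow> (\<forall>v\<in>{t..u}. 0 < Y v \<omega>)"
proof
  assume "ereal u < ruin_time t Y \<omega>"
  then have "ereal v < ruin_time t Y \<omega>" if "v \<le> u" for v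
    using that by (meson ereal_less_eq(3) le_less_trans)
  then show "\<forall>v\<in>{t..u}. 0 < Y v \<omega>" using pos_before_ruin[of t _ Y \<omega>] by auto
next
  assume pos: "\<forall>v\<in>{t..u}. 0 < Y v \<omega>"
  have "((\<lambda>s. Y s \<omega>) \<longlongrightarrow> Y u \<omega>) (at u within {t..})" using c u by (auto simp: continuous_on_def)
  then have "\<forall>\<^sub>F s in at u within {t..}. 0 < Y s \<omega>" using pos u by (auto intro: order_tendstoD)
  then obtain d where d: "0 < d" "\<And>s. s \<in> {t..} \<Longrightarrow> s \<noteq> u \<Longrightarrow> dist s u < d \<Longrightarrow> 0 < Y s \<omega>"
    unfolding eventually_at by blast
  have "ereal (u + d) \<le> ruin_time t Y \<omega>" unfolding ruin_time_def
  proof (rule Inf_greatest)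
    fix z assume "z \<in> ereal ` {s. t \<le> s \<and> Y s \<omega> \<le> 0}"
    then obtain s where s: "z = ereal s" "t \<le> s" "Y s \<omega> \<le> 0" by auto
    have "u + d \<le> s"
    proof (rule ccontr)
      assume n: "\<not> u + d \<le> s"
      have "u < s" using pos s by force
      then show False using d(2)[of s] n s by (auto simp: dist_real_def)
    qed
    then show "ereal (u + d) \<le> z" using s by simp
  qed
  then show "ereal u < ruin_time t Y \<omega>" using d(1) by (auto elim: order.strict_trans2[rotated])
qed

text \<open>Ruin happens exactly at level \<open>0\<close>, not below, by continuity. The hypothesis on the initial value
  matters when \<open>T = t\<close>.\<close>
lemma at_ruin_time:
  assumes c: "continuous_on {t..} (\<lambda>s. Y s \<omega>)" and T: "ruin_time t Y \<omega> = ereal T" and Yt: "0 \<le> Y t \<omega>"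
  shows "t \<le> T" "Y T \<omega> = 0"
proof -
  show tT: "t \<le> T" using ruin_time_ge[of t Y \<omega>] T by simp
  have "\<not> (\<forall>v\<in>{t..T}. 0 < Y v \<omega>)" using less_ruin_time_iff[of t Y \<omega>, OF c tT] T by simp
  then obtain v where v: "t \<le> v" "v \<le> T" "Y v \<omega> \<le> 0" by force
  have "\<not> ereal v < ruin_time t Y \<omega>" using pos_before_ruin[of t v Y \<omega>] v by linarith
  then have "\<not> v < T" by (simp add: T)
  with v(2) have "v = T" by linarith
  with v(3) have le: "Y T \<omega> \<le> 0" by simp
  have "0 \<le> Y T \<omega>"
  proof (cases "t = T")
    case True then show ?thesis using Yt by simp
  next
    case False
    have "((\<lambda>s. Y s \<omega>) \<longlongrightarrow> Y T \<omega>) (at T within {t..})" using c tT by (auto simp: continuous_on_def)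
    then have "((\<lambda>s. Y s \<omega>) \<longlongrightarrow> Y T \<omega>) (at T within {t..T})" by (rule tendsto_within_subset) auto
    moreover have "at T within {t..T} \<noteq> bot"
      using False tT by (simp add: at_within_Icc_at_left)
    moreover have "\<forall>\<^sub>F s in at T within {t..T}. 0 \<le> Y s \<omega>"
      unfolding eventually_at using T pos_before_ruin[of t _ Y \<omega>]
      by (intro exI[of _ 1]) (auto intro!: less_imp_le)
    ultimately show ?thesis by (intro tendsto_lowerbound)
  qed
  then show "Y T \<omega> = 0" using le by simp
qed

locale controlled = brownian_motion M F W
  for M :: "'a measure" and F and W :: "real \<Rightarrow> 'a \<Rightarrow> real" +
  fixes \<mu> \<sigma> Lmax t x :: real and l :: control and Y :: "real \<Rightarrow> 'a \<Rightarrow> real"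
  assumes \<sigma>0: "0 < \<sigma>" and L0: "0 < Lmax" and t0: "0 \<le> t" and x0: "0 \<le> x"
    and l: "l \<in> controls Lmax" and Y: "controlled_process M F W \<mu> \<sigma> l t x Y"
begin

abbreviation \<tau> :: "'a \<Rightarrow> ereal" where "\<tau> \<equiv> ruin_time t Y"

lemma Y_adapted: "t \<le> s \<Longrightarrow> Y s \<in> borel_measurable (F s)"
  and Y_cont: "\<omega> \<in> space M \<Longrightarrow> continuous_on {t..} (\<lambda>s. Y s \<omega>)"
  using Y by (auto simp: controlled_process_def)

lemma Y_adapted': "t \<le> s \<Longrightarrow> s \<le> u \<Longrightarrow> Y s \<in> borel_measurable (F u)"
  using Y_adapted[of s] sets_F_mono[of s u] by (auto simp: measurable_def space_F)

lemma Y_meas: "t \<le> s \<Longrightarrow> Y s \<in> borel_measurable M"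
  using Y_adapted[of s] t0 measurable_F[of s] by auto

text \<open>A continuous path stays positive on \<open>[t,u]\<close> iff it is bounded below by some \<open>1 / Suc m\<close> on the countably
  many points \<open>g n k\<close>, all of which lie in \<open>[t,u]\<close>.\<close>
lemma not_ruined_event:
  assumes u: "t \<le> u"
  shows "{\<omega> \<in> space M. ereal u < \<tau> \<omega>} \<in> sets (F u)"
proof -
  define g where "g = (\<lambda>(n::nat) (k::nat). t + real (min k (Suc n)) / real (Suc n) * (u - t))"
  have g: "t \<le> g n k" "g n k \<le> u" for n k
  proof -
    have "real (min k (Suc n)) / real (Suc n) \<le> 1" by simp
    then have "real (min k (Suc n)) / real (Suc n) * (u - t) \<le> 1 * (u - t)"
      using u by (intro mult_right_mono) auto
    then show "g n k \<le> u" by (simp add: g_def)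
    show "t \<le> g n k" using u by (simp add: g_def)
  qed
  have [measurable]: "Y (g n k) \<in> borel_measurable (F u)" for n k using Y_adapted'[OF g] .
  have "ereal u < \<tau> \<omega> \<longleftrightarrow> (\<exists>m::nat. \<forall>n k. 1 / real (Suc m) \<le> Y (g n k) \<omega>)" if \<omega>: "\<omega> \<in> space M" for \<omega>
  proof -
    note c = Y_cont[OF \<omega>]
    have "(\<forall>v\<in>{t..u}. 0 < Y v \<omega>) \<longleftrightarrow> (\<exists>m::nat. \<forall>n k. 1 / real (Suc m) \<le> Y (g n k) \<omega>)"
    proof
      assume pos: "\<forall>v\<in>{t..u}. 0 < Y v \<omega>"
      have "continuous_on {t..u} (\<lambda>s. Y s \<omega>)" using c by (rule continuous_on_subset) auto
      then obtain v where v: "v \<in> {t..u}" "\<And>r. r \<in> {t..u} \<Longrightarrow> Y v \<omega> \<le> Y r \<omega>"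
        using continuous_attains_inf[of "{t..u}" "\<lambda>s. Y s \<omega>"] u by auto
      then obtain m where "inverse (real (Suc m)) < Y v \<omega>" using reals_Archimedean pos by blast
      then have "1 / real (Suc m) \<le> Y (g n k) \<omega>" for n k
        using v(2)[of "g n k"] g[of n k] by (simp add: inverse_eq_divide)
      then show "\<exists>m::nat. \<forall>n k. 1 / real (Suc m) \<le> Y (g n k) \<omega>" by blast
    next
      assume "\<exists>m::nat. \<forall>n k. 1 / real (Suc m) \<le> Y (g n k) \<omega>"
      then obtain m where m: "\<And>n k. 1 / real (Suc m) \<le> Y (g n k) \<omega>" by blast
      show "\<forall>v\<in>{t..u}. 0 < Y v \<omega>"
      proof
        fix v assume v: "v \<in> {t..u}"
        define s where "s = (if t = u then 0 else (v - t) / (u - t))"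
        have s: "0 \<le> s" "s \<le> 1" "v = t + s * (u - t)" using v by (auto simp: s_def field_simps)
        define k where "k = (\<lambda>n. nat \<lfloor>s * real (Suc n)\<rfloor>)"
        have kle: "k n \<le> Suc n" for n
        proof -
          have "s * real (Suc n) \<le> 1 * real (Suc n)" using s by (intro mult_right_mono) auto
          from floor_mono[OF this] have "\<lfloor>s * real (Suc n)\<rfloor> \<le> int (Suc n)" by (simp del: of_nat_Suc)
          then show ?thesis unfolding k_def by (simp only: nat_le_iff)
        qed
        have kn: "real (k n) = of_int \<lfloor>s * real (Suc n)\<rfloor>" for n using s by (simp add: k_def)
        have "(\<lambda>n. t + of_int \<lfloor>s * real (Suc n)\<rfloor> / real (Suc n) * (u - t)) \<longlonglongrightarrow> t + s * (u - t)"
          by (intro tendsto_intros floor_quotient_tendsto)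
        then have "(\<lambda>n. g n (k n)) \<longlonglongrightarrow> v"
          using kle by (simp add: g_def min_absorb1 kn s(3) del: of_nat_Suc)
        then have "(\<lambda>n. Y (g n (k n)) \<omega>) \<longlonglongrightarrow> Y v \<omega>"
          using v g by (intro continuous_on_tendsto_compose[OF c]) auto
        then have "1 / real (Suc m) \<le> Y v \<omega>" by (rule tendsto_lowerbound) (intro always_eventually allI m, simp)
        moreover have "0 < 1 / real (Suc m)" by simp
        ultimately show "0 < Y v \<omega>" by linarith
      qed
    qed
    then show ?thesis using less_ruin_time_iff[of t Y \<omega>, OF c u] by simp
  qed
  then have "{\<omega> \<in> space M. ereal u < \<tau> \<omega>} = {\<omega> \<in> space (F u). \<exists>m::nat. \<forall>n k. 1 / real (Suc m) \<le> Y (g n k) \<omega>}"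
    by (auto simp: space_F)
  also have "\<dots> \<in> sets (F u)" by measurable
  finally show ?thesis .
qed

lemma controls_ext_meas:
  fixes h :: "real \<Rightarrow> real \<Rightarrow> real"
  assumes "(\<lambda>p. h (fst p) (snd p)) \<in> borel_measurable (restrict_space borel ({0..} \<times> {0..}))"
  shows "(\<lambda>(r, y). if 0 \<le> r \<and> 0 \<le> y then h r y else 0) \<in> borel_measurable (borel \<Otimes>\<^sub>M borel)"
proof -
  have c: "closed ({0..} \<times> {0..} :: (real \<times> real) set)" by (intro closed_Times closed_atLeast)
  have "(\<lambda>p. indicator ({0..} \<times> {0..}) p *\<^sub>R h (fst p) (snd p)) \<in> borel_measurable borel"
    using assms c by (subst borel_measurable_restrict_space_iff[symmetric]) (auto simp: borel_closed)
  moreover have "(\<lambda>p. indicator ({0..} \<times> {0..}) p *\<^sub>R h (fst p) (snd p)) = (\<lambda>(r, y). if 0 \<le> r \<and> 0 \<le> y then h r y else 0)"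
    by (auto simp: indicator_def fun_eq_iff)
  ultimately show ?thesis by (simp add: borel_prod)
qed

text \<open>Progressive measurability: \<open>A\<close> is a \<sigma>-algebra that knows the events before time \<open>s\<close>. For \<open>s = \<infinity>\<close>
  this is plain joint measurability.\<close>

lemma running_meas_aux:
  fixes h :: "real \<Rightarrow> real \<Rightarrow> real" and s :: ereal
  assumes h: "(\<lambda>p. h (fst p) (snd p)) \<in> borel_measurable (restrict_space borel ({0..} \<times> {0..}))"
    and A: "space A = space M" "\<And>q. t \<le> q \<Longrightarrow> ereal q < s \<Longrightarrow> {\<omega> \<in> space M. ereal q < \<tau> \<omega>} \<in> sets A"
    and Yc: "\<And>u. Yc u \<in> borel_measurable A" "\<And>\<omega>. \<omega> \<in> space M \<Longrightarrow> continuous_on UNIV (\<lambda>u. Yc u \<omega>)"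
      "\<And>u \<omega>. t \<le> u \<Longrightarrow> ereal u < s \<Longrightarrow> Yc u \<omega> = Y u \<omega>"
  shows "(\<lambda>(r, \<omega>). if t \<le> r \<and> ereal r < s \<and> ereal r < \<tau> \<omega> then h r (Y r \<omega>) else 0) \<in> borel_measurable (borel \<Otimes>\<^sub>M A)"
proof -
  let ?k = "\<lambda>(r, y). if 0 \<le> r \<and> 0 \<le> y then h r y else 0"
  let ?P = "\<lambda>p. \<exists>q. t \<le> fst p \<and> fst p < real_of_rat q \<and> (t \<le> real_of_rat q \<and> ereal (real_of_rat q) < s \<and> ereal (real_of_rat q) < \<tau> (snd p))"
  have Ym: "(\<lambda>(u, \<omega>). Yc u \<omega>) \<in> borel_measurable (borel \<Otimes>\<^sub>M A)"
    by (rule measurable_pair_continuous_param[OF Yc(1)]) (simp add: Yc(2) A(1))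
  have km: "?k \<in> borel_measurable (borel \<Otimes>\<^sub>M borel)"
    by (rule controls_ext_meas[OF h])
  have qm: "Measurable.pred A (\<lambda>\<omega>. t \<le> real_of_rat q \<and> ereal (real_of_rat q) < s \<and> ereal (real_of_rat q) < \<tau> \<omega>)" for q
  proof (cases "t \<le> real_of_rat q \<and> ereal (real_of_rat q) < s")
    case True
    with A(2)[of "real_of_rat q"] have "Measurable.pred A (\<lambda>\<omega>. ereal (real_of_rat q) < \<tau> \<omega>)"
      unfolding pred_def A(1) by blast
    with True show ?thesis by simp
  next
    case False
    then have "(\<lambda>\<omega>. t \<le> real_of_rat q \<and> ereal (real_of_rat q) < s \<and> ereal (real_of_rat q) < \<tau> \<omega>) = (\<lambda>\<omega>. False)" by blast
    then show ?thesis by simp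
  qed
  have eq: "t \<le> r \<and> ereal r < s \<and> ereal r < \<tau> \<omega> \<longleftrightarrow>
      (\<exists>q. t \<le> r \<and> r < real_of_rat q \<and> (t \<le> real_of_rat q \<and> ereal (real_of_rat q) < s \<and> ereal (real_of_rat q) < \<tau> \<omega>))" for r \<omega>
  proof
    assume a: "t \<le> r \<and> ereal r < s \<and> ereal r < \<tau> \<omega>"
    then have "ereal r < min s (\<tau> \<omega>)" by simp
    then obtain z where z: "ereal r < ereal z" "ereal z < min s (\<tau> \<omega>)" using ereal_dense2 by blast
    then obtain q where q: "r < real_of_rat q" "real_of_rat q < z" using of_rat_dense by auto
    then have "ereal (real_of_rat q) < min s (\<tau> \<omega>)" using z(2) by (auto elim: order.strict_trans[rotated])
    then show "\<exists>q. t \<le> r \<and> r < real_of_rat q \<and> (t \<le> real_of_rat q \<and> ereal (real_of_rat q) < s \<and> ereal (real_of_rat q) < \<tau> \<omega>)"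
      using a q by (intro exI[of _ q]) auto
  next
    assume "\<exists>q. t \<le> r \<and> r < real_of_rat q \<and> (t \<le> real_of_rat q \<and> ereal (real_of_rat q) < s \<and> ereal (real_of_rat q) < \<tau> \<omega>)"
    then obtain q where q: "t \<le> r" "ereal r < ereal (real_of_rat q)" "ereal (real_of_rat q) < s" "ereal (real_of_rat q) < \<tau> \<omega>" by auto
    then show "t \<le> r \<and> ereal r < s \<and> ereal r < \<tau> \<omega>" by (meson order.strict_trans)
  qed
  have "(\<lambda>(r, \<omega>). if t \<le> r \<and> ereal r < s \<and> ereal r < \<tau> \<omega> then h r (Y r \<omega>) else 0) =
     (\<lambda>(r, \<omega>). if (\<exists>q. t \<le> r \<and> r < real_of_rat q \<and> (t \<le> real_of_rat q \<and> ereal (real_of_rat q) < s \<and> ereal (real_of_rat q) < \<tau> \<omega>))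
        then (if 0 \<le> r \<and> 0 \<le> Yc r \<omega> then h r (Yc r \<omega>) else 0) else 0)"
  proof (intro ext, clarify)
    fix r \<omega>
    show "(if t \<le> r \<and> ereal r < s \<and> ereal r < \<tau> \<omega> then h r (Y r \<omega>) else 0) =
     (if (\<exists>q. t \<le> r \<and> r < real_of_rat q \<and> (t \<le> real_of_rat q \<and> ereal (real_of_rat q) < s \<and> ereal (real_of_rat q) < \<tau> \<omega>))
        then (if 0 \<le> r \<and> 0 \<le> Yc r \<omega> then h r (Yc r \<omega>) else 0) else 0)"
      unfolding eq[symmetric] using t0 Yc(3)[of r \<omega>] pos_before_ruin[of t r Y \<omega>] by auto
  qed
  also have "\<dots> = (\<lambda>p. if ?P p then ?k (fst p, (\<lambda>(u, \<omega>). Yc u \<omega>) p) else 0)"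
    by (simp only: case_prod_unfold fst_conv snd_conv)
  also have "\<dots> \<in> borel_measurable (borel \<Otimes>\<^sub>M A)"
  proof (rule measurable_If)
    show "(\<lambda>p. ?k (fst p, (\<lambda>(u, \<omega>). Yc u \<omega>) p)) \<in> borel_measurable (borel \<Otimes>\<^sub>M A)"
      by (rule measurable_compose[OF measurable_Pair[OF measurable_fst Ym] km])
    have "Measurable.pred (borel \<Otimes>\<^sub>M A) ?P"
    proof -
      define R where "R = (\<lambda>q \<omega>. t \<le> real_of_rat q \<and> ereal (real_of_rat q) < s \<and> ereal (real_of_rat q) < \<tau> \<omega>)"
      have [measurable]: "Measurable.pred A (R q)" for q using qm[of q] by (simp only: R_def)
      have "Measurable.pred (borel \<Otimes>\<^sub>M A) (\<lambda>p. \<exists>q. t \<le> fst p \<and> fst p < real_of_rat q \<and> R q (snd p))"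
        by measurable
      then show ?thesis by (simp only: R_def)
    qed
    then show "{p \<in> space (borel \<Otimes>\<^sub>M A). ?P p} \<in> sets (borel \<Otimes>\<^sub>M A)" by (simp only: pred_def)
  qed (rule measurable_const, simp)
  finally show ?thesis .
qed

lemma running_meas:
  fixes h :: "real \<Rightarrow> real \<Rightarrow> real"
  assumes h: "(\<lambda>p. h (fst p) (snd p)) \<in> borel_measurable (restrict_space borel ({0..} \<times> {0..}))"
  shows "(\<lambda>(r, \<omega>). if t \<le> r \<and> ereal r < \<tau> \<omega> then h r (Y r \<omega>) else 0) \<in> borel_measurable (borel \<Otimes>\<^sub>M M)"
    and "t \<le> s \<Longrightarrow> (\<lambda>(r, \<omega>). if t \<le> r \<and> r < s \<and> ereal r < \<tau> \<omega> then h r (Y r \<omega>) else 0) \<in> borel_measurable (borel \<Otimes>\<^sub>M F s)"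
proof -
  have c: "continuous_on UNIV (\<lambda>u. Y (max t u) \<omega>)" if "\<omega> \<in> space M" for \<omega>
    by (rule continuous_on_compose2[OF Y_cont[OF that]]) (auto intro!: continuous_intros)
  show "(\<lambda>(r, \<omega>). if t \<le> r \<and> ereal r < \<tau> \<omega> then h r (Y r \<omega>) else 0) \<in> borel_measurable (borel \<Otimes>\<^sub>M M)"
    using running_meas_aux[OF h, of M \<infinity> "\<lambda>u. Y (max t u)"] not_ruined_event sets_F_le Y_meas c by auto
  assume s: "t \<le> s"
  have c: "continuous_on UNIV (\<lambda>u. Y (max t (min s u)) \<omega>)" if "\<omega> \<in> space M" for \<omega>
    by (rule continuous_on_compose2[OF Y_cont[OF that]]) (auto intro!: continuous_intros)
  show "(\<lambda>(r, \<omega>). if t \<le> r \<and> r < s \<and> ereal r < \<tau> \<omega> then h r (Y r \<omega>) else 0) \<in> borel_measurable (borel \<Otimes>\<^sub>M F s)"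
  proof -
    have 1: "{\<omega> \<in> space M. ereal q < \<tau> \<omega>} \<in> sets (F s)" if "t \<le> q" "ereal q < ereal s" for q
      using not_ruined_event[OF that(1)] sets_F_mono[of q s] that by auto
    have 2: "Y (max t (min s u)) \<in> borel_measurable (F s)" for u using s by (intro Y_adapted') auto
    have 3: "Y (max t (min s u)) \<omega> = Y u \<omega>" if "t \<le> u" "ereal u < ereal s" for u \<omega>
      using that by simp
    from running_meas_aux[where s="ereal s", OF h space_F 1 2 c 3] show ?thesis by simp
  qed
qed


definition drift_bound :: real where "drift_bound = \<bar>\<mu>\<bar> + Lmax"

text \<open>The drift is switched off at ruin, beyond which the controlled process is unspecified. The resulting
  diffusion \<open>Z\<close> is defined for all times and agrees with \<open>Y\<close> until ruin.\<close>
definition \<theta> :: "real \<Rightarrow> 'a \<Rightarrow> real" where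
  "\<theta> r \<omega> = (if t \<le> r \<and> ereal r < \<tau> \<omega> then \<mu> - l r (Y r \<omega>) else 0)"

text \<open>Almost sure continuity of \<open>W\<close> provides no particular exceptional set; this is a choice of one, and it
  is measurable.\<close>
definition bad :: "'a set" where
  "bad = (SOME N. N \<in> null_sets M \<and> {\<omega> \<in> space M. \<not> continuous_on {0..} (\<lambda>s. W s \<omega>)} \<subseteq> N)"

definition w :: "real \<Rightarrow> 'a \<Rightarrow> real" where
  "w u \<omega> = (if \<omega> \<in> bad then 0 else W (max t u) \<omega> - W t \<omega>)"

definition Z :: "real \<Rightarrow> 'a \<Rightarrow> real" where
  "Z u \<omega> = x + (LINT r:{t..u}|lborel. \<theta> r \<omega>) + \<sigma> * w u \<omega>"

lemma bad: "bad \<in> null_sets M" "\<omega> \<in> space M \<Longrightarrow> \<omega> \<notin> bad \<Longrightarrow> continuous_on {0..} (\<lambda>s. W s \<omega>)"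
proof -
  have "\<exists>N. N \<in> null_sets M \<and> {\<omega> \<in> space M. \<not> continuous_on {0..} (\<lambda>s. W s \<omega>)} \<subseteq> N"
    using continuous_paths unfolding eventually_ae_filter by blast
  from someI_ex[OF this] show "bad \<in> null_sets M"
    "\<omega> \<in> space M \<Longrightarrow> \<omega> \<notin> bad \<Longrightarrow> continuous_on {0..} (\<lambda>s. W s \<omega>)"
    unfolding bad_def by blast+
qed

lemma l_bounds: "t \<le> r \<Longrightarrow> 0 \<le> y \<Longrightarrow> 0 \<le> l r y \<and> l r y \<le> Lmax"
  using l t0 by (auto simp: controls_def)

lemma l_meas: "(\<lambda>p. l (fst p) (snd p)) \<in> borel_measurable (restrict_space borel ({0..} \<times> {0..}))"
  using l by (simp add: controls_def)

lemma drift_meas: "(\<lambda>p. \<mu> - l (fst p) (snd p)) \<in> borel_measurable (restrict_space borel ({0..} \<times> {0..}))"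
  using l_meas by (rule borel_measurable_diff[OF borel_measurable_const])

lemma \<theta>_bound: "\<bar>\<theta> u \<omega>\<bar> \<le> drift_bound"
  unfolding \<theta>_def drift_bound_def
  using l_bounds[of u "Y u \<omega>"] pos_before_ruin[of t u Y \<omega>] L0 by auto

lemma \<theta>_meas: "(\<lambda>(r, \<omega>). \<theta> r \<omega>) \<in> borel_measurable (borel \<Otimes>\<^sub>M M)"
  unfolding \<theta>_def by (rule running_meas(1)[OF drift_meas])

lemma \<theta>_meas_before: "t \<le> s \<Longrightarrow> (\<lambda>(r, \<omega>). if r < s then \<theta> r \<omega> else 0) \<in> borel_measurable (borel \<Otimes>\<^sub>M F s)"
proof -
  assume s: "t \<le> s"
  have "(\<lambda>(r, \<omega>). if r < s then \<theta> r \<omega> else 0) = (\<lambda>(r, \<omega>). if t \<le> r \<and> r < s \<and> ereal r < \<tau> \<omega> then \<mu> - l r (Y r \<omega>) else 0)"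
    by (auto simp: \<theta>_def fun_eq_iff)
  then show ?thesis using running_meas(2)[OF drift_meas s] by simp
qed

lemma w_cont: "\<omega> \<in> space M \<Longrightarrow> continuous_on UNIV (\<lambda>u. w u \<omega>)"
proof -
  assume \<omega>: "\<omega> \<in> space M"
  show ?thesis
  proof (cases "\<omega> \<in> bad")
    case False
    have "continuous_on UNIV (\<lambda>u. W (max t u) \<omega>)"
      by (rule continuous_on_compose2[OF bad(2)[OF \<omega> False]]) (use t0 in \<open>auto intro!: continuous_intros\<close>)
    then show ?thesis using False by (auto simp: w_def intro!: continuous_intros)
  qed (simp add: w_def)
qed

lemma w_meas: "w u \<in> borel_measurable M"
proof -
  have [measurable]: "W (max t u) \<in> borel_measurable M" "W t \<in> borel_measurable M" "bad \<in> sets M"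
    using W_measurable t0 bad(1) by auto
  show ?thesis unfolding w_def by measurable
qed

lemma w_eq: "t \<le> u \<Longrightarrow> AE \<omega> in M. w u \<omega> = W u \<omega> - W t \<omega>"
  using AE_not_in[OF bad(1)] by (auto simp: w_def elim: eventually_mono)

text \<open>Only the drift before time \<open>u\<close> enters, and that part is measurable with respect to \<open>F u\<close>; the value
  at \<open>u\<close> itself is lost, but a single instant does not affect the integral.\<close>
lemma Z_nonanticipating:
  assumes u: "t \<le> u" shows "nonanticipating u (Z u)"
  unfolding nonanticipating_def
proof (intro conjI bexI)
  have [measurable]: "(\<lambda>(r, \<omega>). \<theta> r \<omega>) \<in> borel_measurable (lborel \<Otimes>\<^sub>M M)" using \<theta>_meas by simp
  have [measurable]: "w u \<in> borel_measurable M" by (rule w_meas)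
  have "(\<lambda>\<omega>. LINT r|lborel. indicator {t..u} r *\<^sub>R \<theta> r \<omega>) \<in> borel_measurable M"
    by (rule lborel.borel_measurable_lebesgue_integral) measurable
  then show "Z u \<in> borel_measurable M" unfolding Z_def set_lebesgue_integral_def by measurable
  let ?D = "\<lambda>\<omega>. LINT r|lborel. (if r < u then \<theta> r \<omega> else 0)"
  have "(\<lambda>(r, \<omega>). if r < u then \<theta> r \<omega> else 0) \<in> borel_measurable (lborel \<Otimes>\<^sub>M F u)"
    using \<theta>_meas_before[OF u] by simp
  then have "(\<lambda>(\<omega>, r). if r < u then \<theta> r \<omega> else 0) \<in> borel_measurable (F u \<Otimes>\<^sub>M lborel)"
    using measurable_pair_swap_iff by fastforce
  then have [measurable]: "?D \<in> borel_measurable (F u)"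
    by (rule lborel.borel_measurable_lebesgue_integral)
  have [measurable]: "W u \<in> borel_measurable (F u)" using adapted t0 u by auto
  have [measurable]: "W t \<in> borel_measurable (F u)"
    using adapted[OF t0] sets_F_mono[OF u] by (auto simp: measurable_def space_F)
  show "(\<lambda>\<omega>. x + ?D \<omega> + \<sigma> * (W u \<omega> - W t \<omega>)) \<in> borel_measurable (F u)" by measurable
  have D: "(LINT r:{t..u}|lborel. \<theta> r \<omega>) = ?D \<omega>" if \<omega>: "\<omega> \<in> space M" for \<omega>
    unfolding set_lebesgue_integral_def
  proof (rule integral_cong_AE)
    have [measurable]: "(\<lambda>r. \<theta> r \<omega>) \<in> borel_measurable borel"
      using measurable_compose[OF measurable_Pair2'[OF \<omega>] \<theta>_meas] by simp
    show "(\<lambda>r. indicator {t..u} r *\<^sub>R \<theta> r \<omega>) \<in> borel_measurable lborel"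
      "(\<lambda>r. if r < u then \<theta> r \<omega> else 0) \<in> borel_measurable lborel" by measurable
    show "AE r in lborel. indicator {t..u} r *\<^sub>R \<theta> r \<omega> = (if r < u then \<theta> r \<omega> else 0)"
      using AE_lborel_singleton[of u] by eventually_elim (auto simp: \<theta>_def indicator_def)
  qed
  show "AE \<omega> in M. Z u \<omega> = x + ?D \<omega> + \<sigma> * (W u \<omega> - W t \<omega>)"
    using w_eq[OF u] AE_space by eventually_elim (simp add: Z_def D)
qed

sublocale diffusion M F W t x \<sigma> drift_bound w \<theta> Z
proof
  show "w t \<omega> = 0" for \<omega> by (simp add: w_def)
  show "0 \<le> \<sigma>" using \<sigma>0 by simp
qed (use t0 w_cont w_meas w_eq \<theta>_meas \<theta>_bound Z_nonanticipating in \<open>simp_all add: Z_def\<close>)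

text \<open>The drifts of both equations coincide strictly before ruin. At the ruin time they may differ,
  which changes the integral at a single point only.\<close>
lemma Y_eq_Z: "AE \<omega> in M. \<forall>s\<ge>t. ereal s \<le> \<tau> \<omega> \<longrightarrow> Z s \<omega> = Y s \<omega>"
proof -
  have "AE \<omega> in M. \<forall>s\<ge>t. ereal s \<le> \<tau> \<omega> \<longrightarrow>
        Y s \<omega> = x + (LINT u:{t..s}|lborel. \<mu> - l u (Y u \<omega>)) + \<sigma> * (W s \<omega> - W t \<omega>)"
    using Y by (simp add: controlled_process_def)
  then show ?thesis using AE_not_in[OF bad(1)] AE_space
  proof eventually_elim
    fix \<omega> assume eq: "\<forall>s\<ge>t. ereal s \<le> \<tau> \<omega> \<longrightarrow>
        Y s \<omega> = x + (LINT u:{t..s}|lborel. \<mu> - l u (Y u \<omega>)) + \<sigma> * (W s \<omega> - W t \<omega>)"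
      and nb: "\<omega> \<notin> bad" and \<omega>: "\<omega> \<in> space M"
    show "\<forall>s\<ge>t. ereal s \<le> \<tau> \<omega> \<longrightarrow> Z s \<omega> = Y s \<omega>"
    proof (intro allI impI)
      fix s assume s: "t \<le> s" "ereal s \<le> \<tau> \<omega>"
      let ?f = "\<lambda>r. indicator {t..s} r *\<^sub>R (\<mu> - l r (Y r \<omega>))"
      let ?g = "\<lambda>r. indicator {t..s} r *\<^sub>R \<theta> r \<omega>"
      have [measurable]: "(\<lambda>r. \<theta> r \<omega>) \<in> borel_measurable borel"
        using measurable_compose[OF measurable_Pair2'[OF \<omega>] \<theta>_meas] by simp
      have gm: "?g \<in> borel_measurable lborel" by measurable
      have fg: "?f r = ?g r" if "r \<noteq> s" for r
      proof (cases "r \<in> {t..s}")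
        case True
        then have "ereal r < ereal s" using that by simp
        then have "ereal r < \<tau> \<omega>" using s(2) by (rule order.strict_trans2)
        then show ?thesis using True by (simp add: \<theta>_def)
      qed simp
      have "?f = (\<lambda>r. ?g r + indicator {s} r * (?f s - ?g s))"
        using fg by (auto simp: fun_eq_iff indicator_def)
      also have "\<dots> \<in> borel_measurable lborel" using gm by measurable
      finally have fm: "?f \<in> borel_measurable lborel" .
      have "(LINT u:{t..s}|lborel. \<mu> - l u (Y u \<omega>)) = (LINT u:{t..s}|lborel. \<theta> u \<omega>)"
        unfolding set_lebesgue_integral_def
      proof (rule integral_cong_AE[OF fm gm])
        show "AE r in lborel. ?f r = ?g r"
          using AE_lborel_singleton[of s] by eventually_elim (rule fg)
      qed
      then show "Z s \<omega> = Y s \<omega>" using eq s nb by (simp add: Z_def w_def)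
    qed
  qed
qed

end

section \<open>Integrals up to ruin and the resolvent equation\<close>

lemma exp_neg_tendsto_0:
  fixes \<rho> t :: real
  assumes "0 < \<rho>" shows "((\<lambda>r. exp (-\<rho> * (r - t))) \<longlongrightarrow> 0) at_top"
proof -
  have "filterlim (\<lambda>r. \<rho> * (- t + r)) at_top at_top"
    by (intro filterlim_tendsto_pos_mult_at_top[OF tendsto_const assms] filterlim_tendsto_add_at_top[OF tendsto_const] filterlim_ident)
  then have "filterlim (\<lambda>r. - (\<rho> * (- t + r))) at_bot at_top"
    by (rule filterlim_compose[OF filterlim_uminus_at_bot_at_top])
  from filterlim_compose[OF exp_at_bot this] show ?thesis by (simp add: algebra_simps)
qed

lemma exp_tail:
  fixes \<rho> a t :: real
  assumes "0 < \<rho>"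
  shows "set_integrable lborel {a..} (\<lambda>r. exp (-\<rho> * (r - t)))"
    and "(LINT r:{a..}|lborel. exp (-\<rho> * (r - t))) = exp (-\<rho> * (a - t)) / \<rho>"
proof -
  have lim: "((\<lambda>r. - exp (-\<rho> * (r - t)) / \<rho>) \<longlongrightarrow> 0) at_top"
    using tendsto_divide[OF tendsto_minus[OF exp_neg_tendsto_0[OF assms]] tendsto_const, of \<rho>] assms by simp
  have *: "(\<integral>\<^sup>+ r. ennreal (exp (-\<rho> * (r - t))) * indicator {a..} r \<partial>lborel) = ennreal (0 - (- exp (-\<rho> * (a - t)) / \<rho>))"
    by (rule nn_integral_FTC_atLeast[OF _ _ _ lim]) (use assms in \<open>auto intro!: derivative_eq_intros\<close>)
  have "(\<integral>\<^sup>+ r. ennreal (indicator {a..} r *\<^sub>R exp (-\<rho> * (r - t))) \<partial>lborel) = ennreal (exp (-\<rho> * (a - t)) / \<rho>)"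
  proof -
    have "ennreal (indicator {a..} r *\<^sub>R exp (-\<rho> * (r - t))) = ennreal (exp (-\<rho> * (r - t))) * indicator {a..} r" for r
      by (cases "r \<in> {a..}") auto
    with * show ?thesis by simp
  qed
  then have "has_bochner_integral lborel (\<lambda>r. indicator {a..} r *\<^sub>R exp (-\<rho> * (r - t))) (exp (-\<rho> * (a - t)) / \<rho>)"
    by (intro has_bochner_integral_nn_integral) (use assms in \<open>auto simp: less_imp_le\<close>)
  then show "set_integrable lborel {a..} (\<lambda>r. exp (-\<rho> * (r - t)))"
    "(LINT r:{a..}|lborel. exp (-\<rho> * (r - t))) = exp (-\<rho> * (a - t)) / \<rho>"
    by (auto simp: set_integrable_def set_lebesgue_integral_def has_bochner_integral_iff)
qed

text \<open>Running rewards with an exponentially decreasing bound: they are integrable over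
  \<open>[t,\<infinity>)\<close> uniformly in the path, so that no question of convergence arises for integrals up to ruin.\<close>
definition damped :: "real \<Rightarrow> (real \<Rightarrow> real \<Rightarrow> real) \<Rightarrow> bool" where
  "damped t h \<longleftrightarrow> (\<lambda>p. h (fst p) (snd p)) \<in> borel_measurable (restrict_space borel ({0..} \<times> {0..})) \<and>
     (\<exists>\<rho>>0. \<exists>L\<ge>0. \<forall>r\<ge>t. \<forall>y\<ge>0. \<bar>h r y\<bar> \<le> L * exp (-\<rho> * (r - t)))"

lemma dampedE:
  assumes "damped t h"
  obtains \<rho> L where "0 < \<rho>" "0 \<le> L" "\<And>r y. t \<le> r \<Longrightarrow> 0 \<le> y \<Longrightarrow> \<bar>h r y\<bar> \<le> L * exp (-\<rho> * (r - t))"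
  using conjunct2[OF assms[unfolded damped_def]] that by blast

lemma damped_meas: "damped t h \<Longrightarrow> (\<lambda>p. h (fst p) (snd p)) \<in> borel_measurable (restrict_space borel ({0..} \<times> {0..}))"
  unfolding damped_def by (rule conjunct1)

lemma dampedI:
  assumes "(\<lambda>p. h (fst p) (snd p)) \<in> borel_measurable (restrict_space borel ({0..} \<times> {0..}))"
    and "0 < \<rho>" "0 \<le> L" "\<And>r y. t \<le> r \<Longrightarrow> 0 \<le> y \<Longrightarrow> \<bar>h r y\<bar> \<le> L * exp (-\<rho> * (r - t))"
  shows "damped t h"
  unfolding damped_def
proof (rule conjI[OF assms(1)])
  show "\<exists>\<rho>>0. \<exists>L\<ge>0. \<forall>r\<ge>t. \<forall>y\<ge>0. \<bar>h r y\<bar> \<le> L * exp (-\<rho> * (r - t))"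
    using assms(2-) by blast
qed

lemma damped_add:
  assumes "damped t f" "damped t g" shows "damped t (\<lambda>r y. f r y + g r y)"
proof -
  obtain \<rho>1 L1 \<rho>2 L2 where p: "0 < \<rho>1" "0 \<le> L1" "0 < \<rho>2" "0 \<le> L2"
    and b: "\<And>r y. t \<le> r \<Longrightarrow> 0 \<le> y \<Longrightarrow> \<bar>f r y\<bar> \<le> L1 * exp (-\<rho>1 * (r - t))"
      "\<And>r y. t \<le> r \<Longrightarrow> 0 \<le> y \<Longrightarrow> \<bar>g r y\<bar> \<le> L2 * exp (-\<rho>2 * (r - t))"
    using dampedE[OF assms(1)] dampedE[OF assms(2)] by metis
  define \<rho> where "\<rho> = min \<rho>1 \<rho>2"
  have "\<bar>f r y + g r y\<bar> \<le> (L1 + L2) * exp (-\<rho> * (r - t))" if "t \<le> r" "0 \<le> y" for r y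
  proof -
    have "\<rho> * (r - t) \<le> \<rho>1 * (r - t)" "\<rho> * (r - t) \<le> \<rho>2 * (r - t)"
      using that by (auto intro!: mult_right_mono simp: \<rho>_def)
    then have "L1 * exp (-\<rho>1 * (r - t)) \<le> L1 * exp (-\<rho> * (r - t))" "L2 * exp (-\<rho>2 * (r - t)) \<le> L2 * exp (-\<rho> * (r - t))"
      using p by (auto intro!: mult_left_mono)
    then show ?thesis using b(1)[OF that] b(2)[OF that] unfolding distrib_right by linarith
  qed
  then show ?thesis
    using dampedI[OF borel_measurable_add[OF damped_meas[OF assms(1)] damped_meas[OF assms(2)]], of \<rho> "L1 + L2" t] p
    by (simp add: \<rho>_def)
qed

lemma damped_cmult:
  assumes "damped t f" shows "damped t (\<lambda>r y. c * f r y)"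
proof -
  obtain \<rho> L where p: "0 < \<rho>" "0 \<le> L" "\<And>r y. t \<le> r \<Longrightarrow> 0 \<le> y \<Longrightarrow> \<bar>f r y\<bar> \<le> L * exp (-\<rho> * (r - t))"
    using dampedE[OF assms] by blast
  have "\<bar>c * f r y\<bar> \<le> (\<bar>c\<bar> * L) * exp (-\<rho> * (r - t))" if "t \<le> r" "0 \<le> y" for r y
    unfolding abs_mult mult.assoc using p(3)[OF that] by (rule mult_left_mono) simp
  then show ?thesis
    using dampedI[OF borel_measurable_times[OF borel_measurable_const damped_meas[OF assms]], of \<rho> "\<bar>c\<bar> * L" t c] p
    by simp
qed

lemma damped_discounted:
  assumes "(\<lambda>p. k (fst p) (snd p)) \<in> borel_measurable (restrict_space borel ({0..} \<times> {0..}))"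
    and "\<And>r y. t \<le> r \<Longrightarrow> 0 \<le> y \<Longrightarrow> \<bar>k r y\<bar> \<le> L" and "0 < \<rho>"
  shows "damped t (\<lambda>r y. exp (-\<rho> * (r - t)) * k r y)"
proof -
  have "(\<lambda>p::real\<times>real. exp (-\<rho> * (fst p - t))) \<in> borel_measurable (restrict_space borel ({0..} \<times> {0..}))"
    by (rule measurable_restrict_space1, rule borel_measurable_continuous_onI) (intro continuous_intros)
  moreover have "\<bar>exp (-\<rho> * (r - t)) * k r y\<bar> \<le> max L 0 * exp (-\<rho> * (r - t))" if "t \<le> r" "0 \<le> y" for r y
  proof -
    have "exp (-\<rho> * (r - t)) * \<bar>k r y\<bar> \<le> exp (-\<rho> * (r - t)) * max L 0"
      using assms(2)[OF that] by (intro mult_left_mono) auto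
    then show ?thesis by (simp add: abs_mult mult.commute)
  qed
  ultimately show ?thesis
    by (intro dampedI[where \<rho>=\<rho> and L="max L 0"] borel_measurable_times assms(1,3)) simp_all
qed

lemma quadrant_meas_snd:
  assumes "f \<in> borel_measurable borel"
  shows "(\<lambda>p::real\<times>real. (f (snd p) :: real)) \<in> borel_measurable (restrict_space borel ({0..} \<times> {0..}))"
  by (rule measurable_restrict_space1, rule measurable_compose[OF _ assms], rule borel_measurable_continuous_onI)
    (intro continuous_intros)

context controlled
begin

definition run :: "(real \<Rightarrow> real \<Rightarrow> real) \<Rightarrow> 'a \<Rightarrow> real" where
  "run h \<omega> = (LINT r:{s. t \<le> s \<and> ereal s < \<tau> \<omega>}|lborel. h r (Y r \<omega>))"

lemma run_alt: "run h \<omega> = (LINT r|lborel. (if t \<le> r \<and> ereal r < \<tau> \<omega> then h r (Y r \<omega>) else 0))"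
  unfolding run_def set_lebesgue_integral_def by (rule Bochner_Integration.integral_cong) auto

lemma running_path_meas:
  assumes "damped t h" "\<omega> \<in> space M"
  shows "(\<lambda>r. if t \<le> r \<and> ereal r < \<tau> \<omega> then h r (Y r \<omega>) else 0) \<in> borel_measurable borel"
proof -
  have "(\<lambda>(r, \<omega>). if t \<le> r \<and> ereal r < \<tau> \<omega> then h r (Y r \<omega>) else 0) \<in> borel_measurable (borel \<Otimes>\<^sub>M M)"
    by (rule running_meas(1)) (rule damped_meas[OF assms(1)])
  from measurable_compose[OF measurable_Pair2'[OF assms(2)] this] show ?thesis by simp
qed

lemma run_bounds:
  assumes m: "(\<lambda>p. h (fst p) (snd p)) \<in> borel_measurable (restrict_space borel ({0..} \<times> {0..}))"
    and b: "\<And>r y. t \<le> r \<Longrightarrow> 0 \<le> y \<Longrightarrow> \<bar>h r y\<bar> \<le> L * exp (-\<rho> * (r - t))" and p: "0 < \<rho>" "0 \<le> L" and \<omega>: "\<omega> \<in> space M"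
  shows "integrable lborel (\<lambda>r. if t \<le> r \<and> ereal r < \<tau> \<omega> then h r (Y r \<omega>) else 0)"
    and "\<bar>run h \<omega>\<bar> \<le> L / \<rho>"
proof -
  have "damped t h" by (rule dampedI[OF m p b])
  note meas = running_path_meas[OF this \<omega>]
  have i: "integrable lborel (\<lambda>r. L * (indicator {t..} r *\<^sub>R exp (-\<rho> * (r - t))))"
    using exp_tail(1)[OF p(1), of t t] unfolding set_integrable_def by (rule integrable_mult_right)
  have le: "\<bar>if t \<le> r \<and> ereal r < \<tau> \<omega> then h r (Y r \<omega>) else 0\<bar> \<le> L * (indicator {t..} r *\<^sub>R exp (-\<rho> * (r - t)))" for r
    using b[of r "Y r \<omega>"] pos_before_ruin[of t r Y \<omega>] p by (auto simp: indicator_def)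
  show int: "integrable lborel (\<lambda>r. if t \<le> r \<and> ereal r < \<tau> \<omega> then h r (Y r \<omega>) else 0)"
  proof (rule Bochner_Integration.integrable_bound[OF i])
    show "(\<lambda>r. if t \<le> r \<and> ereal r < \<tau> \<omega> then h r (Y r \<omega>) else 0) \<in> borel_measurable lborel" using meas by simp
    show "AE r in lborel. norm (if t \<le> r \<and> ereal r < \<tau> \<omega> then h r (Y r \<omega>) else 0)
        \<le> norm (L * (indicator {t..} r *\<^sub>R exp (-\<rho> * (r - t))))"
      unfolding real_norm_def by (intro AE_I2 order_trans[OF le abs_ge_self])
  qed
  have "\<bar>run h \<omega>\<bar> \<le> (LINT r|lborel. norm (if t \<le> r \<and> ereal r < \<tau> \<omega> then h r (Y r \<omega>) else 0))"
    unfolding run_alt real_norm_def[symmetric] by (rule integral_norm_bound)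
  also have "\<dots> \<le> (LINT r|lborel. L * (indicator {t..} r *\<^sub>R exp (-\<rho> * (r - t))))"
    by (rule Bochner_Integration.integral_mono[OF integrable_norm[OF int] i]) (simp only: real_norm_def le)
  also have "\<dots> = L * (1 / \<rho>)"
    using exp_tail(2)[OF p(1), of t t] unfolding set_lebesgue_integral_def by simp
  finally show "\<bar>run h \<omega>\<bar> \<le> L / \<rho>" by simp
qed

lemma run_path_integrable:
  assumes h: "damped t h" and \<omega>: "\<omega> \<in> space M"
  shows "set_integrable lborel {s. t \<le> s \<and> ereal s < \<tau> \<omega>} (\<lambda>r. h r (Y r \<omega>))"
proof -
  have *: "(\<lambda>r. indicator {s. t \<le> s \<and> ereal s < \<tau> \<omega>} r *\<^sub>R h r (Y r \<omega>)) = (\<lambda>r. if t \<le> r \<and> ereal r < \<tau> \<omega> then h r (Y r \<omega>) else 0)"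
    by (auto simp: indicator_def)
  obtain \<rho> L where "0 < \<rho>" "0 \<le> L" "\<And>r y. t \<le> r \<Longrightarrow> 0 \<le> y \<Longrightarrow> \<bar>h r y\<bar> \<le> L * exp (-\<rho> * (r - t))"
    using dampedE[OF h] by blast
  from run_bounds(1)[OF damped_meas[OF h] this(3,1,2) \<omega>] * show ?thesis unfolding set_integrable_def by simp
qed

lemma run_meas:
  assumes "damped t h" shows "run h \<in> borel_measurable M"
proof -
  have "(\<lambda>(r, \<omega>). if t \<le> r \<and> ereal r < \<tau> \<omega> then h r (Y r \<omega>) else 0) \<in> borel_measurable (lborel \<Otimes>\<^sub>M M)"
    using running_meas(1)[OF damped_meas[OF assms]] by simp
  then have "(\<lambda>(\<omega>, r). if t \<le> r \<and> ereal r < \<tau> \<omega> then h r (Y r \<omega>) else 0) \<in> borel_measurable (M \<Otimes>\<^sub>M lborel)"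
    using measurable_pair_swap_iff by fastforce
  then show ?thesis unfolding run_alt by (rule lborel.borel_measurable_lebesgue_integral)
qed

lemma run_integrable:
  assumes h: "damped t h" shows "integrable M (run h)"
proof -
  obtain \<rho> L where p: "0 < \<rho>" "0 \<le> L" "\<And>r y. t \<le> r \<Longrightarrow> 0 \<le> y \<Longrightarrow> \<bar>h r y\<bar> \<le> L * exp (-\<rho> * (r - t))"
    using dampedE[OF h] by blast
  have "\<bar>run h \<omega>\<bar> \<le> L / \<rho>" if "\<omega> \<in> space M" for \<omega>
    by (rule run_bounds(2)[OF damped_meas[OF h] p(3) p(1,2) that])
  then show ?thesis by (intro integrable_const_bound[where B="L / \<rho>"] run_meas[OF h]) auto
qed

lemma run_add:
  assumes "damped t f" "damped t g" "\<omega> \<in> space M"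
  shows "run (\<lambda>r y. f r y + g r y) \<omega> = run f \<omega> + run g \<omega>"
  unfolding run_def by (rule set_integral_add) (use assms run_path_integrable in auto)

lemma run_cmult: "run (\<lambda>r y. c * f r y) \<omega> = c * run f \<omega>"
  unfolding run_def by (rule set_integral_mult_right)

lemma run_cong: "(\<And>r y. t \<le> r \<Longrightarrow> 0 < y \<Longrightarrow> f r y = g r y) \<Longrightarrow> run f \<omega> = run g \<omega>"
  unfolding run_alt using pos_before_ruin[of t _ Y \<omega>] by (intro Bochner_Integration.integral_cong) auto

definition stop :: "real \<Rightarrow> 'a \<Rightarrow> real" where
  "stop v \<omega> = real_of_ereal (min (ereal v) (\<tau> \<omega>))"

lemma ereal_stop: "t \<le> v \<Longrightarrow> ereal (stop v \<omega>) = min (ereal v) (\<tau> \<omega>)"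
  using ruin_time_ge[of t Y \<omega>] unfolding stop_def
  by (cases "\<tau> \<omega>") (auto simp: min_def)

lemma stop_bounds: "t \<le> v \<Longrightarrow> t \<le> stop v \<omega>" "t \<le> v \<Longrightarrow> stop v \<omega> \<le> v" "t \<le> v \<Longrightarrow> ereal (stop v \<omega>) \<le> \<tau> \<omega>"
proof -
  assume v: "t \<le> v"
  have "ereal t \<le> ereal (stop v \<omega>)" using ereal_stop[OF v] ruin_time_ge[of t Y \<omega>] v by simp
  then show "t \<le> stop v \<omega>" by simp
  have "ereal (stop v \<omega>) \<le> ereal v" using ereal_stop[OF v] by simp
  then show "stop v \<omega> \<le> v" by simp
  show "ereal (stop v \<omega>) \<le> \<tau> \<omega>" using ereal_stop[OF v] by simp
qed

lemma less_stop: "t \<le> v \<Longrightarrow> u < v \<Longrightarrow> u < stop v \<omega> \<longleftrightarrow> ereal u < \<tau> \<omega>"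
proof -
  assume "t \<le> v" "u < v"
  have "u < stop v \<omega> \<longleftrightarrow> ereal u < ereal (stop v \<omega>)" by simp
  also have "\<dots> \<longleftrightarrow> ereal u < \<tau> \<omega>" unfolding ereal_stop[OF \<open>t \<le> v\<close>] using \<open>u < v\<close> by simp
  finally show ?thesis .
qed

lemma stop_meas: assumes v: "t \<le> v" shows "stop v \<in> borel_measurable M"
  unfolding borel_measurable_iff_greater
proof
  fix a
  consider "a < t" | "t \<le> a" "a < v" | "v \<le> a" by linarith
  then show "{\<omega> \<in> space M. a < stop v \<omega>} \<in> sets M"
  proof cases
    case 1
    then have "a < stop v \<omega>" for \<omega> using stop_bounds(1)[OF v, of \<omega>] by linarith
    then show ?thesis by simp
  next
    case 2
    then show ?thesis using less_stop[OF v 2(2)] not_ruined_event[OF 2(1)] sets_F_le by auto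
  next
    case 3
    then have "\<not> a < stop v \<omega>" for \<omega> using stop_bounds(2)[OF v, of \<omega>] by linarith
    then show ?thesis by simp
  qed
qed

lemma Y_stop_meas: assumes v: "t \<le> v" shows "(\<lambda>\<omega>. Y (stop v \<omega>) \<omega>) \<in> borel_measurable M"
proof -
  have c: "continuous_on UNIV (\<lambda>u. Y (max t u) \<omega>)" if "\<omega> \<in> space M" for \<omega>
    by (rule continuous_on_compose2[OF Y_cont[OF that]]) (auto intro!: continuous_intros)
  have "(\<lambda>(u, \<omega>). Y (max t u) \<omega>) \<in> borel_measurable (borel \<Otimes>\<^sub>M M)"
    by (rule measurable_pair_continuous_param[OF Y_meas c]) auto
  from measurable_compose[OF measurable_Pair[OF stop_meas[OF v] measurable_ident] this]
  have "(\<lambda>\<omega>. Y (max t (stop v \<omega>)) \<omega>) \<in> borel_measurable M" by simp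
  then show ?thesis using stop_bounds(1)[OF v] by (simp add: max_absorb2)
qed

lemma Y_start: "AE \<omega> in M. Y t \<omega> = x"
  using Y_eq_Z
proof eventually_elim
  case (elim \<omega>)
  then have "Y t \<omega> = Z t \<omega>" using ruin_time_ge[of t Y \<omega>] by simp
  also have "\<dots> = x" unfolding Z_eq set_integral_Icc_refl by (simp add: w_start)
  finally show ?case .
qed

text \<open>Either ruin has come before \<open>v\<close>, and \<open>k\<close> is evaluated at \<open>0\<close>, or the discount factor is that of time
  \<open>v\<close>. This settles every boundary term at infinity.\<close>
lemma stopped_decay_AE:
  assumes v: "t \<le> v" and k: "\<And>y. 0 \<le> y \<Longrightarrow> \<bar>k y\<bar> \<le> B" "k 0 = 0"
  shows "AE \<omega> in M. \<bar>exp (-\<rho> * (stop v \<omega> - r)) * k (Y (stop v \<omega>) \<omega>)\<bar> \<le> exp (-\<rho> * (v - r)) * B"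
  using Y_start AE_space
proof eventually_elim
  case (elim \<omega>)
  have B: "0 \<le> B" using k(1)[of 0] by simp
  show ?case
  proof (cases "ereal v < \<tau> \<omega>")
    case True
    then have "ereal (stop v \<omega>) = ereal v" using ereal_stop[OF v, of \<omega>] by simp
    then have s: "stop v \<omega> = v" by simp
    have "0 < Y v \<omega>" using pos_before_ruin[OF v True] .
    then show ?thesis unfolding s abs_mult using k(1)[of "Y v \<omega>"] by (simp add: mult_left_mono)
  next
    case False
    then have "\<tau> \<omega> = ereal (stop v \<omega>)" using ereal_stop[OF v, of \<omega>] by simp
    from at_ruin_time(2)[OF Y_cont[OF elim(2)] this] have "Y (stop v \<omega>) \<omega> = 0" using elim(1) x0 by simp
    then show ?thesis using k(2) B by simp
  qed
qed

lemma stopped_decay: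
  assumes k: "\<And>y. 0 \<le> y \<Longrightarrow> \<bar>k y\<bar> \<le> B" "k 0 = 0" and km: "k \<in> borel_measurable borel" and \<rho>: "0 < \<rho>"
  shows "t \<le> v \<Longrightarrow> integrable M (\<lambda>\<omega>. exp (-\<rho> * (stop v \<omega> - r)) * k (Y (stop v \<omega>) \<omega>))"
    and "((\<lambda>v. \<integral>\<omega>. exp (-\<rho> * (stop v \<omega> - r)) * k (Y (stop v \<omega>) \<omega>) \<partial>M) \<longlongrightarrow> 0) at_top"
proof -
  have int: "integrable M (\<lambda>\<omega>. exp (-\<rho> * (stop v \<omega> - r)) * k (Y (stop v \<omega>) \<omega>))" if v: "t \<le> v" for v
  proof (rule integrable_const_bound)
    show "AE \<omega> in M. norm (exp (-\<rho> * (stop v \<omega> - r)) * k (Y (stop v \<omega>) \<omega>)) \<le> exp (-\<rho> * (v - r)) * B"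
      using stopped_decay_AE[of v k, OF v k] by simp
    have [measurable]: "stop v \<in> borel_measurable M" "(\<lambda>\<omega>. Y (stop v \<omega>) \<omega>) \<in> borel_measurable M"
      using stop_meas[OF v] Y_stop_meas[OF v] by auto
    show "(\<lambda>\<omega>. exp (-\<rho> * (stop v \<omega> - r)) * k (Y (stop v \<omega>) \<omega>)) \<in> borel_measurable M"
      by (intro borel_measurable_times measurable_compose[OF _ km]) measurable
  qed
  then show "t \<le> v \<Longrightarrow> integrable M (\<lambda>\<omega>. exp (-\<rho> * (stop v \<omega> - r)) * k (Y (stop v \<omega>) \<omega>))" .
  show "((\<lambda>v. \<integral>\<omega>. exp (-\<rho> * (stop v \<omega> - r)) * k (Y (stop v \<omega>) \<omega>) \<partial>M) \<longlongrightarrow> 0) at_top"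
  proof (rule Lim_null_comparison)
    show "((\<lambda>v. exp (-\<rho> * (v - r)) * B) \<longlongrightarrow> 0) at_top" using tendsto_mult_left_zero[OF exp_neg_tendsto_0[OF \<rho>]] .
    show "\<forall>\<^sub>F v in at_top. norm (\<integral>\<omega>. exp (-\<rho> * (stop v \<omega> - r)) * k (Y (stop v \<omega>) \<omega>) \<partial>M) \<le> exp (-\<rho> * (v - r)) * B"
      using eventually_ge_at_top[of t]
    proof eventually_elim
      case (elim v)
      have "norm (\<integral>\<omega>. exp (-\<rho> * (stop v \<omega> - r)) * k (Y (stop v \<omega>) \<omega>) \<partial>M)
          \<le> (\<integral>\<omega>. norm (exp (-\<rho> * (stop v \<omega> - r)) * k (Y (stop v \<omega>) \<omega>)) \<partial>M)" by (rule integral_norm_bound)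
      also have "\<dots> \<le> (\<integral>\<omega>. exp (-\<rho> * (v - r)) * B \<partial>M)"
        by (rule integral_mono_AE) (use int[OF elim] stopped_decay_AE[of v k, OF elim k] in auto)
      also have "\<dots> = exp (-\<rho> * (v - r)) * B" by (simp add: prob_space)
      finally show ?case .
    qed
  qed
qed


text \<open>Dynkin's formula at the times \<open>stop (v n)\<close>, with \<open>v n\<close> increasing to infinity. In the limit the boundary term
  vanishes by \<open>stopped_decay_AE\<close>.\<close>
theorem resolvent_representation:
  assumes test: "C11_test \<phi> \<phi>' \<psi> B" and \<phi>0: "\<phi> 0 = 0" and \<rho>: "0 < \<rho>"
  defines "h \<equiv> (\<lambda>r y. exp (-\<rho> * (r - t)) * (- \<rho> * \<phi> y + (\<mu> - l r y) * \<phi>' y + \<sigma>\<^sup>2 / 2 * \<psi> y))"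
  shows "damped t h" and "(\<integral>\<omega>. run h \<omega> \<partial>M) = - \<phi> x"
proof -
  interpret C11_test \<phi> \<phi>' \<psi> B by fact
  let ?k = "\<lambda>r y. - \<rho> * \<phi> y + (\<mu> - l r y) * \<phi>' y + \<sigma>\<^sup>2 / 2 * \<psi> y"
  let ?G = "\<lambda>r \<omega>. exp (-\<rho> * (r - t)) * (- \<rho> * \<phi> (Z r \<omega>) + \<theta> r \<omega> * \<phi>' (Z r \<omega>) + \<sigma>\<^sup>2 / 2 * \<psi> (Z r \<omega>))"
  define L where "L = (\<rho> + drift_bound + \<sigma>\<^sup>2 / 2) * B"
  have L: "0 \<le> L" using \<rho> K0 B0 by (simp add: L_def)
  have kb: "\<bar>?k r y\<bar> \<le> L" if "t \<le> r" "0 \<le> y" for r y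
    unfolding L_def
  proof (rule gen_abs_le)
    show "\<bar>\<mu> - l r y\<bar> \<le> drift_bound" using l_bounds[OF that] unfolding drift_bound_def by linarith
  qed (use bnd \<psi>_bound \<rho> in auto)
  have km: "(\<lambda>p. ?k (fst p) (snd p)) \<in> borel_measurable (restrict_space borel ({0..} \<times> {0..}))"
    by (intro borel_measurable_add borel_measurable_times drift_meas borel_measurable_const quadrant_meas_snd C11_meas)
  show dh: "damped t h" unfolding h_def by (rule damped_discounted[OF km kb \<rho>])
  have hb: "\<bar>h r y\<bar> \<le> L * exp (-\<rho> * (r - t))" if "t \<le> r" "0 \<le> y" for r y
    using mult_left_mono[OF kb[OF that], of "exp (-\<rho> * (r - t))"] by (simp add: h_def abs_mult mult.commute)
  define H where "H = (\<lambda>r \<omega>. if t \<le> r \<and> ereal r < \<tau> \<omega> then h r (Y r \<omega>) else 0)"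
  define v where "v = (\<lambda>n::nat. t + real (Suc n))"
  have v: "t < v n" "t \<le> v n" for n by (auto simp: v_def)
  define Q where "Q = (\<lambda>n \<omega>. exp (-\<rho> * (stop (v n) \<omega> - t)) * \<phi> (Z (stop (v n) \<omega>) \<omega>)
     - (LINT r:{t..stop (v n) \<omega>}|lborel. ?G r \<omega>))"
  have st: "{\<omega> \<in> space M. u < stop (v n) \<omega>} \<in> sets (F u)" if "t \<le> u" "u < v n" for u n
    using not_ruined_event[OF that(1)] less_stop[OF v(2) that(2)] by simp
  note D = dynkin_formula[OF test less_imp_le[OF \<rho>] v(1) stop_bounds(1)[OF v(2)] stop_bounds(2)[OF v(2)] st]
  have Q: "integrable M (Q n)" "(\<integral>\<omega>. Q n \<omega> \<partial>M) = \<phi> x" for n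
    unfolding Q_def by (rule D; assumption)+
  have Q_eq: "AE \<omega> in M. Q n \<omega> = exp (-\<rho> * (stop (v n) \<omega> - t)) * \<phi> (Y (stop (v n) \<omega>) \<omega>) - (LINT r:{t..stop (v n) \<omega>}|lborel. H r \<omega>)" for n
    using Y_eq_Z AE_space
  proof eventually_elim
    case (elim \<omega>)
    have 1: "Z (stop (v n) \<omega>) \<omega> = Y (stop (v n) \<omega>) \<omega>"
      using elim(1) stop_bounds[OF v(2), of n \<omega>] by blast
    have 2: "(LINT r:{t..stop (v n) \<omega>}|lborel. ?G r \<omega>)
        = (LINT r:{t..stop (v n) \<omega>}|lborel. H r \<omega>)"
      unfolding set_lebesgue_integral_def
    proof (rule integral_cong_AE)
      have [measurable]: "(\<lambda>r. \<theta> r \<omega>) \<in> borel_measurable borel" by (rule \<theta>_path[OF elim(2)])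
      have [measurable]: "(\<lambda>r. Z r \<omega>) \<in> borel_measurable borel" by (rule borel_measurable_continuous_onI[OF Z_cont[OF elim(2)]])
      have [measurable]: "(\<lambda>r. H r \<omega>) \<in> borel_measurable borel"
        unfolding H_def by (rule running_path_meas[OF dh elim(2)])
      show "(\<lambda>r. indicator {t..stop (v n) \<omega>} r *\<^sub>R ?G r \<omega>) \<in> borel_measurable lborel"
        by measurable
      show "(\<lambda>r. indicator {t..stop (v n) \<omega>} r *\<^sub>R H r \<omega>) \<in> borel_measurable lborel" by measurable
      show "AE r in lborel. indicator {t..stop (v n) \<omega>} r *\<^sub>R ?G r \<omega>
          = indicator {t..stop (v n) \<omega>} r *\<^sub>R H r \<omega>"
        using AE_lborel_singleton[of "stop (v n) \<omega>"]
      proof eventually_elim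
        fix r assume r: "r \<noteq> stop (v n) \<omega>"
        show "indicator {t..stop (v n) \<omega>} r *\<^sub>R ?G r \<omega>
          = indicator {t..stop (v n) \<omega>} r *\<^sub>R H r \<omega>"
        proof (cases "r \<in> {t..stop (v n) \<omega>}")
          case True
          then have "r < stop (v n) \<omega>" "r < v n" using r stop_bounds(2)[OF v(2), of n \<omega>] by auto
          then have lt: "ereal r < \<tau> \<omega>" using less_stop[OF v(2)] by blast
          then have "Z r \<omega> = Y r \<omega>" using elim(1) True by auto
          then show ?thesis using True lt by (simp add: H_def h_def \<theta>_def)
        qed simp
      qed
    qed
    show ?case unfolding Q_def 1 2 ..
  qed
  have Hb: "\<bar>H r \<omega>\<bar> \<le> L * (indicator {t..} r *\<^sub>R exp (-\<rho> * (r - t)))" for r \<omega>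
    using hb[of r "Y r \<omega>"] pos_before_ruin[of t r Y \<omega>] L by (auto simp: H_def indicator_def)
  have Hib: "norm (indicator {t..stop (v n) \<omega>} r *\<^sub>R H r \<omega>) \<le> L * (indicator {t..} r *\<^sub>R exp (-\<rho> * (r - t)))" for n r \<omega>
  proof -
    have "norm (indicator {t..stop (v n) \<omega>} r *\<^sub>R H r \<omega>) \<le> \<bar>H r \<omega>\<bar>" by (simp add: indicator_def)
    then show ?thesis using Hb by (rule order_trans)
  qed
  have Li: "integrable lborel (\<lambda>r. L * (indicator {t..} r *\<^sub>R exp (-\<rho> * (r - t))))"
    using exp_tail(1)[OF \<rho>, of t t] unfolding set_integrable_def by (rule integrable_mult_right)
  have Lv: "(LINT r|lborel. L * (indicator {t..} r *\<^sub>R exp (-\<rho> * (r - t)))) = L / \<rho>"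
    using exp_tail(2)[OF \<rho>, of t t] unfolding set_lebesgue_integral_def by simp
  have Hm: "(\<lambda>r. H r \<omega>) \<in> borel_measurable borel" if "\<omega> \<in> space M" for \<omega>
    unfolding H_def by (rule running_path_meas[OF dh that])
  have Ilim: "(\<lambda>n. LINT r:{t..stop (v n) \<omega>}|lborel. H r \<omega>) \<longlonglongrightarrow> run h \<omega>" if \<omega>: "\<omega> \<in> space M" for \<omega>
    unfolding set_lebesgue_integral_def run_alt H_def[symmetric]
  proof (rule integral_dominated_convergence[OF _ _ Li])
    show "(\<lambda>r. if t \<le> r \<and> ereal r < \<tau> \<omega> then h r (Y r \<omega>) else 0) \<in> borel_measurable lborel"
      using Hm[OF \<omega>] by (simp add: H_def)
    show "(\<lambda>r. indicator {t..stop (v n) \<omega>} r *\<^sub>R H r \<omega>) \<in> borel_measurable lborel" for n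
      using Hm[OF \<omega>] by measurable
    show "AE r in lborel. norm (indicator {t..stop (v n) \<omega>} r *\<^sub>R H r \<omega>) \<le> L * (indicator {t..} r *\<^sub>R exp (-\<rho> * (r - t)))" for n
      by (rule AE_I2) (rule Hib)
    show "AE r in lborel. (\<lambda>n. indicator {t..stop (v n) \<omega>} r *\<^sub>R H r \<omega>) \<longlonglongrightarrow> (if t \<le> r \<and> ereal r < \<tau> \<omega> then h r (Y r \<omega>) else 0)"
    proof (rule AE_I2)
      fix r
      show "(\<lambda>n. indicator {t..stop (v n) \<omega>} r *\<^sub>R H r \<omega>) \<longlonglongrightarrow> (if t \<le> r \<and> ereal r < \<tau> \<omega> then h r (Y r \<omega>) else 0)"
      proof (cases "t \<le> r \<and> ereal r < \<tau> \<omega>")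
        case True
        obtain n0 where n0: "r - t < real n0" using reals_Archimedean2 by blast
        have "indicator {t..stop (v n) \<omega>} r *\<^sub>R H r \<omega> = h r (Y r \<omega>)" if "n0 \<le> n" for n
        proof -
          have "r < v n" using n0 that by (simp add: v_def)
          then have "r < stop (v n) \<omega>" using True less_stop[OF v(2)] by blast
          then show ?thesis using True by (simp add: H_def)
        qed
        then have "\<forall>\<^sub>F n in sequentially. h r (Y r \<omega>) = indicator {t..stop (v n) \<omega>} r *\<^sub>R H r \<omega>"
          unfolding eventually_sequentially by (metis (no_types))
        then show ?thesis using True by (simp add: tendsto_eventually eventually_mono)
      next
        case False then show ?thesis unfolding H_def by (simp only: if_False) simp
      qed
    qed
  qed
  have Ib: "\<bar>LINT r:{t..stop (v n) \<omega>}|lborel. H r \<omega>\<bar> \<le> L / \<rho>" if \<omega>: "\<omega> \<in> space M" for n \<omega>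
  proof -
    have "norm (LINT r|lborel. indicator {t..stop (v n) \<omega>} r *\<^sub>R H r \<omega>) \<le> (LINT r|lborel. norm (indicator {t..stop (v n) \<omega>} r *\<^sub>R H r \<omega>))"
      by (rule integral_norm_bound)
    also have "\<dots> \<le> (LINT r|lborel. L * (indicator {t..} r *\<^sub>R exp (-\<rho> * (r - t))))"
      by (rule integral_mono_AE'[OF Li]) (use Hib L in \<open>auto intro!: AE_I2\<close>)
    finally show ?thesis unfolding Lv by (simp add: set_lebesgue_integral_def)
  qed
  have dec: "AE \<omega> in M. \<forall>n. \<bar>exp (-\<rho> * (stop (v n) \<omega> - t)) * \<phi> (Y (stop (v n) \<omega>) \<omega>)\<bar> \<le> exp (-\<rho> * (v n - t)) * B"
    unfolding AE_all_countable using stopped_decay_AE[of _ \<phi> B, OF v(2) bnd(1) \<phi>0] by blast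
  have vlim: "(\<lambda>n. exp (-\<rho> * (v n - t)) * B) \<longlonglongrightarrow> 0"
  proof -
    have "filterlim v at_top sequentially" unfolding v_def
      by (rule filterlim_tendsto_add_at_top[OF tendsto_const])
        (rule filterlim_compose[OF filterlim_real_sequentially filterlim_Suc])
    from tendsto_mult_left_zero[OF filterlim_compose[OF exp_neg_tendsto_0[OF \<rho>] this]] show ?thesis .
  qed
  have Qlim: "AE \<omega> in M. (\<lambda>n. Q n \<omega>) \<longlonglongrightarrow> - run h \<omega>"
  proof -
    have "AE \<omega> in M. \<forall>n. Q n \<omega> = exp (-\<rho> * (stop (v n) \<omega> - t)) * \<phi> (Y (stop (v n) \<omega>) \<omega>) - (LINT r:{t..stop (v n) \<omega>}|lborel. H r \<omega>)"
      unfolding AE_all_countable using Q_eq by blast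
    then show ?thesis using dec AE_space
    proof eventually_elim
      case (elim \<omega>)
      have "(\<lambda>n. exp (-\<rho> * (stop (v n) \<omega> - t)) * \<phi> (Y (stop (v n) \<omega>) \<omega>)) \<longlonglongrightarrow> 0"
        by (rule Lim_null_comparison[OF _ vlim]) (use elim(2) in auto)
      from tendsto_diff[OF this Ilim[OF elim(3)]] show ?case using elim(1) by simp
    qed
  qed
  have Qb: "AE \<omega> in M. norm (Q n \<omega>) \<le> B + L / \<rho>" for n
    using Q_eq[of n] dec AE_space
  proof eventually_elim
    case (elim \<omega>)
    have "exp (-\<rho> * (v n - t)) * B \<le> 1 * B" using v(2)[of n] \<rho> B0 by (intro mult_right_mono) auto
    moreover have "\<bar>exp (-\<rho> * (stop (v n) \<omega> - t)) * \<phi> (Y (stop (v n) \<omega>) \<omega>)\<bar> \<le> exp (-\<rho> * (v n - t)) * B" using elim(2) by blast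
    ultimately show ?case using Ib[OF elim(3), of n] unfolding elim(1) real_norm_def by linarith
  qed
  have "(\<lambda>n. \<integral>\<omega>. Q n \<omega> \<partial>M) \<longlonglongrightarrow> (\<integral>\<omega>. - run h \<omega> \<partial>M)"
    by (rule integral_dominated_convergence[where w="\<lambda>\<omega>. B + L / \<rho>"])
      (use Qlim Qb run_meas[OF dh] borel_measurable_integrable[OF Q(1)] in auto)
  then have "\<phi> x = (\<integral>\<omega>. - run h \<omega> \<partial>M)" unfolding Q(2) by (simp add: LIMSEQ_const_iff)
  then show "(\<integral>\<omega>. run h \<omega> \<partial>M) = - \<phi> x" by simp
qed

end

section \<open>The threshold equation\<close>

text \<open>The factorization of the characteristic polynomial says that both constants are roots. They have
  opposite signs because the square root in their definition exceeds \<open>\<bar>m / \<sigma>\<^sup>2\<bar>\<close>.\<close>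
lemma root_quadratic:
  assumes "0 < \<sigma>" "0 < k"
  shows "\<sigma>\<^sup>2 / 2 * (root1 m \<sigma> k)\<^sup>2 + m * root1 m \<sigma> k = k"
    and "\<sigma>\<^sup>2 / 2 * (root2 m \<sigma> k)\<^sup>2 + m * root2 m \<sigma> k = k"
    and "root2 m \<sigma> k < 0" "0 < root1 m \<sigma> k"
    and "\<sigma>\<^sup>2 / 2 * z\<^sup>2 + m * z - k = \<sigma>\<^sup>2 / 2 * ((z - root1 m \<sigma> k) * (z - root2 m \<sigma> k))"
proof -
  define s where "s = sqrt (m^2 / \<sigma>^4 + 2 * k / \<sigma>^2)"
  have r: "root1 m \<sigma> k = - m / \<sigma>^2 + s" "root2 m \<sigma> k = - m / \<sigma>^2 - s"
    by (simp_all add: root1_def root2_def s_def)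
  have s2: "s\<^sup>2 = (m / \<sigma>\<^sup>2)\<^sup>2 + 2 * k / \<sigma>^2"
    unfolding s_def using assms by (subst real_sqrt_pow2) (auto simp: power_divide)
  have s0: "0 \<le> s" using assms by (simp add: s_def)
  have lt: "(m / \<sigma>\<^sup>2)\<^sup>2 < s\<^sup>2" unfolding s2 using assms by simp
  then have "\<bar>m / \<sigma>\<^sup>2\<bar> < s" using s0 by (metis abs_of_nonneg power2_less_imp_less power2_abs)
  then have "m / \<sigma>\<^sup>2 < s" "- (m / \<sigma>\<^sup>2) < s" by (simp_all only: abs_less_iff)
  then show "root2 m \<sigma> k < 0" "0 < root1 m \<sigma> k" unfolding r by auto
  have f: "\<sigma>\<^sup>2 / 2 * z\<^sup>2 + m * z - k = \<sigma>\<^sup>2 / 2 * ((z - root1 m \<sigma> k) * (z - root2 m \<sigma> k))" for z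
  proof -
    have "(z - root1 m \<sigma> k) * (z - root2 m \<sigma> k) = (z + m / \<sigma>\<^sup>2)\<^sup>2 - s\<^sup>2"
      unfolding r by (simp add: power2_eq_square algebra_simps)
    also have "\<dots> = z\<^sup>2 + 2 * m / \<sigma>\<^sup>2 * z - 2 * k / \<sigma>^2"
      unfolding s2 by (simp add: power2_sum)
    finally have e: "(z - root1 m \<sigma> k) * (z - root2 m \<sigma> k) = z\<^sup>2 + 2 * m / \<sigma>\<^sup>2 * z - 2 * k / \<sigma>^2" .
    show ?thesis unfolding e using assms by (simp add: field_simps)
  qed
  then show "\<sigma>\<^sup>2 / 2 * z\<^sup>2 + m * z - k = \<sigma>\<^sup>2 / 2 * ((z - root1 m \<sigma> k) * (z - root2 m \<sigma> k))" .
  show "\<sigma>\<^sup>2 / 2 * (root1 m \<sigma> k)\<^sup>2 + m * root1 m \<sigma> k = k" using f[of "root1 m \<sigma> k"] by simp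
  show "\<sigma>\<^sup>2 / 2 * (root2 m \<sigma> k)\<^sup>2 + m * root2 m \<sigma> k = k" using f[of "root2 m \<sigma> k"] by simp
qed

text \<open>At \<open>root2 m \<sigma> k\<close> the polynomial with \<open>m\<close> replaced by \<open>m - L\<close> takes the positive value
  \<open>- L * root2 m \<sigma> k\<close>, so this negative point lies to the left of both roots of that polynomial.\<close>
lemma root2_shift:
  assumes "0 < \<sigma>" "0 < k" "0 < L"
  shows "root2 m \<sigma> k < root2 (m - L) \<sigma> k"
proof (rule ccontr)
  let ?a = "root2 m \<sigma> k"
  assume n: "\<not> ?a < root2 (m - L) \<sigma> k"
  have "\<sigma>\<^sup>2 / 2 * ?a\<^sup>2 + (m - L) * ?a - k = - L * ?a"
    using root_quadratic(2)[OF assms(1,2), of m] by (simp add: algebra_simps)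
  moreover have "0 < - L * ?a" using root_quadratic(3)[OF assms(1,2), of m] assms(3) by (simp add: mult_pos_neg)
  moreover have "(?a - root1 (m - L) \<sigma> k) * (?a - root2 (m - L) \<sigma> k) \<le> 0"
    using n root_quadratic(3)[OF assms(1,2), of m] root_quadratic(4)[OF assms(1,2), of "m - L"]
    by (intro mult_nonpos_nonneg) auto
  ultimately show False
    using root_quadratic(5)[OF assms(1,2), of ?a "m - L"] assms(1)
    by (metis half_gt_zero_iff linorder_not_less mult_pos_pos not_less_iff_gr_or_eq zero_less_mult_pos zero_less_power)
qed

locale dividend_problem =
  fixes \<mu> \<sigma> \<delta> \<beta> L lam :: real
  assumes pos: "0 < \<sigma>" "0 < \<delta>" "0 < \<beta>" "0 < L" and lam: "lam \<le> 0"
begin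

abbreviation "a1 \<equiv> root1 \<mu> \<sigma> \<delta>"
abbreviation "a2 \<equiv> root2 \<mu> \<sigma> \<delta>"
abbreviation "b2 \<equiv> root2 (\<mu> - L) \<sigma> \<delta>"
abbreviation "c1 \<equiv> root1 \<mu> \<sigma> \<beta>"
abbreviation "c2 \<equiv> root2 \<mu> \<sigma> \<beta>"
abbreviation "d2 \<equiv> root2 (\<mu> - L) \<sigma> \<beta>"
abbreviation "G \<equiv> threshold_fun \<mu> \<sigma> \<delta> \<beta> L lam"

lemma signs: "a2 < b2" "b2 < 0" "0 < a1" "c2 < d2" "d2 < 0" "0 < c1" "a2 < 0" "c2 < 0"
  using root2_shift[of \<sigma> \<delta> L \<mu>] root2_shift[of \<sigma> \<beta> L \<mu>] root_quadratic(3)[of \<sigma> \<delta> \<mu>] root_quadratic(3)[of \<sigma> \<beta> \<mu>]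
    root_quadratic(3)[of \<sigma> \<delta> "\<mu> - L"] root_quadratic(3)[of \<sigma> \<beta> "\<mu> - L"]
    root_quadratic(4)[of \<sigma> \<delta> \<mu>] root_quadratic(4)[of \<sigma> \<beta> \<mu>] pos by auto

definition E1 where "E1 b = (a1 - b2) * exp (a1 * b) + (b2 - a2) * exp (a2 * b)"
definition E2 where "E2 b = (d2 - c1) * exp (c1 * b) + (c2 - d2) * exp (c2 * b)"

lemma E1_pos: "0 < E1 b" unfolding E1_def using signs by (intro add_pos_pos mult_pos_pos) auto
lemma E2_neg: "E2 b < 0" unfolding E2_def using signs by (intro add_neg_neg mult_neg_pos) auto

definition s1 where "s1 b = (a1 * exp (a1 * b) - a2 * exp (a2 * b)) / E1 b"
definition s2 where "s2 b = (c2 - c1) * exp ((c1 + c2) * b) / E2 b"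

lemma G_eq: "G b = L / \<delta> * (- b2) * s1 b + lam * d2 * s2 b - 1"
  by (simp add: threshold_fun_def Let_def s1_def s2_def E1_def E2_def mult.assoc mult.left_commute[of d2])

text \<open>\<open>s1\<close> and \<open>s2\<close> are the parts of the slope at the threshold due to dividends and to the ruin payment. Cross
  multiplication reduces the first to the sign of \<open>b2 * (a1 - a2)\<close>.\<close>
lemma s1_decreasing: assumes "x < y" shows "s1 y < s1 x"
proof -
  have "(a1 * exp (a1 * x) - a2 * exp (a2 * x)) * E1 y - (a1 * exp (a1 * y) - a2 * exp (a2 * y)) * E1 x
     = (b2 * (a1 - a2)) * (exp (a1 * x) * exp (a2 * y) - exp (a2 * x) * exp (a1 * y))"
    unfolding E1_def by (simp add: algebra_simps)
  also have "\<dots> > 0"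
  proof (rule mult_neg_neg)
    show "b2 * (a1 - a2) < 0" using signs by (intro mult_neg_pos) auto
    have "(a1 - a2) * x < (a1 - a2) * y" using assms signs by (intro mult_strict_left_mono) auto
    then have "a1 * x + a2 * y < a2 * x + a1 * y" by (simp add: algebra_simps)
    then show "exp (a1 * x) * exp (a2 * y) - exp (a2 * x) * exp (a1 * y) < 0"
      by (simp add: exp_add[symmetric])
  qed
  finally show ?thesis unfolding s1_def using E1_pos[of x] E1_pos[of y] by (simp add: divide_simps mult.commute)
qed

lemma s2_alt: "s2 b = (c1 - c2) / ((c1 - d2) * exp (- c2 * b) + (d2 - c2) * exp (- c1 * b))"
proof -
  have "E2 b = - exp ((c1 + c2) * b) * ((c1 - d2) * exp (- c2 * b) + (d2 - c2) * exp (- c1 * b))"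
    unfolding E2_def by (simp add: algebra_simps exp_add[symmetric])
  then show ?thesis unfolding s2_def by (simp add: divide_simps)
qed

text \<open>The denominator in \<open>s2_alt\<close> increases on \<open>[0,\<infinity>)\<close>: its derivative increases in \<open>b\<close>, and at \<open>0\<close> it is
  \<open>- d2 * (c1 - c2) > 0\<close>.\<close>
lemma s2_nonincreasing: assumes "0 \<le> x" "x \<le> y" shows "s2 y \<le> s2 x"
proof -
  define k where "k = (\<lambda>b. (c1 - d2) * exp (- c2 * b) + (d2 - c2) * exp (- c1 * b))"
  have kpos: "0 < k b" for b unfolding k_def using signs by (intro add_pos_pos mult_pos_pos) auto
  have "k x \<le> k y"
  proof (rule DERIV_nonneg_imp_nondecreasing[OF assms(2)])
    fix b assume b: "x \<le> b" "b \<le> y"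
    have d: "(k has_real_derivative ((c1 - d2) * (- c2) * exp (- c2 * b) - (d2 - c2) * c1 * exp (- c1 * b))) (at b)"
      unfolding k_def by (auto intro!: derivative_eq_intros simp: algebra_simps)
    have "0 \<le> (c1 - d2) * (- c2) * 1 - (d2 - c2) * c1 * 1"
    proof -
      have "(c1 - d2) * (- c2) * 1 - (d2 - c2) * c1 * 1 = (- d2) * (c1 - c2)" by (simp add: algebra_simps)
      also have "\<dots> \<ge> 0" using signs by (intro mult_nonneg_nonneg) auto
      finally show ?thesis .
    qed
    also have "\<dots> \<le> (c1 - d2) * (- c2) * exp (- c2 * b) - (d2 - c2) * c1 * exp (- c1 * b)"
      using signs b assms by (intro diff_mono mult_left_mono mult_nonneg_nonneg) (auto simp: mult_le_0_iff)
    finally show "\<exists>D. (k has_real_derivative D) (at b) \<and> 0 \<le> D" using d by blast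
  qed
  then show ?thesis
  proof -
    have kk: "s2 b = (c1 - c2) / k b" for b unfolding s2_alt k_def ..
    show ?thesis unfolding kk using \<open>k x \<le> k y\<close> kpos signs by (intro divide_left_mono mult_pos_pos) auto
  qed
qed

lemma G_decreasing: assumes "0 \<le> x" "x < y" shows "G y < G x"
proof -
  have "L / \<delta> * (- b2) * s1 y < L / \<delta> * (- b2) * s1 x"
    using s1_decreasing[OF assms(2)] pos signs by (intro mult_strict_left_mono mult_pos_pos divide_pos_pos) auto
  moreover have "lam * d2 * s2 y \<le> lam * d2 * s2 x"
    using s2_nonincreasing[of x y] assms lam signs by (intro mult_left_mono) (auto intro: mult_nonpos_nonpos)
  ultimately show ?thesis unfolding G_eq by simp
qed

lemma G_tendsto: "(G \<longlongrightarrow> L / \<delta> * (- b2) * (a1 / (a1 - b2)) - 1) at_top"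
proof -
  have lim: "((\<lambda>b. exp (z * b)) \<longlongrightarrow> 0) at_top" if "z < 0" for z :: real
    using exp_neg_tendsto_0[of "- z" 0] that by simp
  have s1': "s1 = (\<lambda>b. (a1 - a2 * exp ((a2 - a1) * b)) / ((a1 - b2) + (b2 - a2) * exp ((a2 - a1) * b)))"
  proof
    fix b
    have e: "exp (a2 * b) = exp (a1 * b) * exp ((a2 - a1) * b)" by (simp add: exp_add[symmetric] algebra_simps)
    show "s1 b = (a1 - a2 * exp ((a2 - a1) * b)) / ((a1 - b2) + (b2 - a2) * exp ((a2 - a1) * b))"
    proof -
      have "a1 * exp (a1 * b) - a2 * exp (a2 * b) = exp (a1 * b) * (a1 - a2 * exp ((a2 - a1) * b))"
        "E1 b = exp (a1 * b) * ((a1 - b2) + (b2 - a2) * exp ((a2 - a1) * b))"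
        unfolding E1_def e by (simp_all add: algebra_simps)
      then show ?thesis unfolding s1_def by simp
    qed
  qed
  have s2': "s2 = (\<lambda>b. (c2 - c1) * exp (c2 * b) / ((d2 - c1) + (c2 - d2) * exp ((c2 - c1) * b)))"
  proof
    fix b
    have e: "exp (c2 * b) = exp (c1 * b) * exp ((c2 - c1) * b)" by (simp add: exp_add[symmetric] algebra_simps)
    have "E2 b = exp (c1 * b) * ((d2 - c1) + (c2 - d2) * exp ((c2 - c1) * b))"
      unfolding E2_def e by (simp add: algebra_simps)
    moreover have "exp ((c1 + c2) * b) = exp (c1 * b) * exp (c2 * b)" by (simp add: exp_add[symmetric] algebra_simps)
    ultimately show "s2 b = (c2 - c1) * exp (c2 * b) / ((d2 - c1) + (c2 - d2) * exp ((c2 - c1) * b))"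
      unfolding s2_def by simp
  qed
  have l1: "(s1 \<longlongrightarrow> (a1 - a2 * 0) / ((a1 - b2) + (b2 - a2) * 0)) at_top"
    unfolding s1' using signs by (intro tendsto_intros lim) auto
  have l2: "(s2 \<longlongrightarrow> (c2 - c1) * 0 / ((d2 - c1) + (c2 - d2) * 0)) at_top"
    unfolding s2' using signs by (intro tendsto_intros lim) auto
  have "(G \<longlongrightarrow> L / \<delta> * (- b2) * ((a1 - a2 * 0) / ((a1 - b2) + (b2 - a2) * 0)) + lam * d2 * ((c2 - c1) * 0 / ((d2 - c1) + (c2 - d2) * 0)) - 1) at_top"
    unfolding G_eq[abs_def] by (intro tendsto_intros l1 l2)
  then show ?thesis by simp
qed

text \<open>Eliminate \<open>\<mu>\<close> from the quadratic equations of \<open>a1\<close> and \<open>b2\<close>.\<close>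
lemma G_limit_negative: "L / \<delta> * (- b2) * (a1 / (a1 - b2)) - 1 < 0"
proof -
  note qa = root_quadratic(1)[OF pos(1,2), of \<mu>] and qb = root_quadratic(2)[OF pos(1,2), of "\<mu> - L"]
  have "a1 * (\<sigma>\<^sup>2 / 2 * b2\<^sup>2 + (\<mu> - L) * b2) - b2 * (\<sigma>\<^sup>2 / 2 * a1\<^sup>2 + \<mu> * a1)
      = (- b2) * a1 * (\<sigma>\<^sup>2 / 2 * (a1 - b2) + L)"
    by (simp add: power2_eq_square algebra_simps)
  then have "\<delta> * (a1 - b2) = (- b2) * a1 * (\<sigma>\<^sup>2 / 2 * (a1 - b2) + L)"
    unfolding qa qb by (simp add: algebra_simps)
  also have "\<dots> > (- b2) * a1 * L"
    using signs pos by (intro mult_strict_left_mono mult_pos_pos) auto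
  finally have "(- b2) * a1 * L < \<delta> * (a1 - b2)" .
  moreover have "0 < \<delta> * (a1 - b2)" using signs pos by simp
  ultimately show ?thesis using pos by (simp add: field_simps)
qed

lemma threshold_unique:
  assumes cond: "(- b2) * (L / \<delta>) + lam * d2 - 1 > 0"
  shows "\<exists>!b. 0 < b \<and> G b = 0"
proof -
  have G0: "0 < G 0"
  proof -
    have "s1 0 = 1" "s2 0 = 1" using signs by (simp_all add: s1_def s2_def E1_def E2_def)
    then show ?thesis using cond unfolding G_eq by (simp add: algebra_simps)
  qed
  have "\<forall>\<^sub>F b in at_top. G b < 0" using order_tendstoD(2)[OF G_tendsto G_limit_negative] .
  then have "\<forall>\<^sub>F b in at_top. G b < 0 \<and> 0 < b" using eventually_gt_at_top[of "0::real"] by eventually_elim simp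
  then obtain B where B: "G B < 0" "0 < B" using eventually_happens'[of "at_top :: real filter"] by auto
  have c: "isCont G b" for b
    unfolding G_eq[abs_def] s1_def s2_def E1_def[abs_def] E2_def[abs_def]
    using E1_pos[of b] E2_neg[of b] unfolding E1_def E2_def by (intro continuous_intros) auto
  obtain b where b: "0 \<le> b" "b \<le> B" "G b = 0"
    using IVT2[of G B 0 0] B G0 c by force
  show ?thesis
  proof (rule ex1I[of _ b])
    show "0 < b \<and> G b = 0" using b G0 by (cases "b = 0") auto
    fix b' assume "0 < b' \<and> G b' = 0"
    then show "b' = b" using G_decreasing[of b b'] G_decreasing[of b' b] b by (cases "b < b'"; cases "b' < b") auto
  qed
qed

end

section \<open>The candidate and its marginal value\<close>

definition glue :: "real \<Rightarrow> (real \<Rightarrow> real) \<Rightarrow> (real \<Rightarrow> real) \<Rightarrow> real \<Rightarrow> real" where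
  "glue c f g x = (if x < c then f x else g x)"

lemma glue_simps [simp]: "x < c \<Longrightarrow> glue c f g x = f x" "c \<le> x \<Longrightarrow> glue c f g x = g x"
  by (simp_all add: glue_def)

lemma DERIV_glue_left: "(f has_real_derivative D) (at x within S) \<Longrightarrow> x \<in> S \<Longrightarrow> x < c \<Longrightarrow> (glue c f g has_real_derivative D) (at x within S)"
  by (erule has_field_derivative_transform_within[where d="c - x"]) (auto simp: glue_def dist_real_def)

lemma DERIV_glue_right: "(g has_real_derivative D) (at x within S) \<Longrightarrow> x \<in> S \<Longrightarrow> c < x \<Longrightarrow> (glue c f g has_real_derivative D) (at x within S)"
  by (erule has_field_derivative_transform_within[where d="x - c"]) (auto simp: glue_def dist_real_def)

lemma DERIV_glue:
  assumes f: "\<And>x. x \<le> c \<Longrightarrow> (f has_real_derivative f' x) (at x)" and g: "\<And>x. c \<le> x \<Longrightarrow> (g has_real_derivative g' x) (at x)"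
    and "f c = g c" "f' c = g' c"
  shows "(glue c f g has_real_derivative glue c f' g' x) (at x)"
proof -
  consider "x < c" | "x = c" | "c < x" by linarith
  then show ?thesis
  proof cases
    case 1 then show ?thesis using DERIV_glue_left[OF f] by simp
  next
    case 3 then show ?thesis using DERIV_glue_right[OF g] by simp
  next
    case 2
    have "((\<lambda>y. (f y - f c) / (y - c)) \<longlongrightarrow> g' c) (at_left c)"
      using has_field_derivative_at_within[OF f[of c], of "{..<c}"] assms(4) by (simp add: has_field_derivative_iff)
    then have l: "((\<lambda>y. (glue c f g y - glue c f g c) / (y - c)) \<longlongrightarrow> g' c) (at_left c)"
      by (rule Lim_transform_eventually) (auto simp: eventually_at_filter assms(3))
    have "((\<lambda>y. (g y - g c) / (y - c)) \<longlongrightarrow> g' c) (at_right c)"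
      using has_field_derivative_at_within[OF g[of c], of "{c<..}"] by (simp add: has_field_derivative_iff)
    then have r: "((\<lambda>y. (glue c f g y - glue c f g c) / (y - c)) \<longlongrightarrow> g' c) (at_right c)"
      by (rule Lim_transform_eventually) (auto simp: eventually_at_filter)
    show ?thesis unfolding 2 has_field_derivative_iff using filterlim_split_at[OF l r] by simp
  qed
qed

lemma DERIV_right_glue:
  assumes f: "\<And>x. x < c \<Longrightarrow> (f has_real_derivative f' x) (at x within {x..})"
    and g: "\<And>x. c \<le> x \<Longrightarrow> (g has_real_derivative g' x) (at x within {x..})"
  shows "(glue c f g has_real_derivative glue c f' g' x) (at x within {x..})"
proof (cases "x < c")
  case True then show ?thesis using DERIV_glue_left[OF f[OF True]] by simp
next
  case False
  then have "(glue c f g has_real_derivative g' x) (at x within {x..})"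
    by (intro has_field_derivative_transform_within[OF g, of x 1]) auto
  then show ?thesis using False by simp
qed

lemma lipschitz_glue:
  assumes f: "\<And>x y. x \<in> S \<Longrightarrow> y \<in> S \<Longrightarrow> x \<le> c \<Longrightarrow> y \<le> c \<Longrightarrow> \<bar>f x - f y\<bar> \<le> B * \<bar>x - y\<bar>"
    and g: "\<And>x y. x \<in> S \<Longrightarrow> y \<in> S \<Longrightarrow> c \<le> x \<Longrightarrow> c \<le> y \<Longrightarrow> \<bar>g x - g y\<bar> \<le> B * \<bar>x - y\<bar>"
    and c: "f c = g c" "c \<in> S" and xy: "x \<in> S" "y \<in> S"
  shows "\<bar>glue c f g x - glue c f g y\<bar> \<le> B * \<bar>x - y\<bar>"
proof -
  have cross: "\<bar>f x - g y\<bar> \<le> B * \<bar>x - y\<bar>" if "x \<in> S" "y \<in> S" "x < c" "c \<le> y" for x y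
  proof -
    have "\<bar>f x - g y\<bar> \<le> \<bar>f x - f c\<bar> + \<bar>g c - g y\<bar>" using c by linarith
    also have "\<dots> \<le> B * \<bar>x - c\<bar> + B * \<bar>c - y\<bar>" using that c by (intro add_mono f g) auto
    also have "\<dots> = B * \<bar>x - y\<bar>" using that by (simp add: algebra_simps)
    finally show ?thesis .
  qed
  show ?thesis
    using f[OF xy] g[OF xy] cross[OF xy] cross[OF xy(2,1)]
    by (cases "x < c"; cases "y < c") (auto simp: abs_minus_commute)
qed

definition expo :: "real \<Rightarrow> real \<Rightarrow> real \<Rightarrow> real \<Rightarrow> real \<Rightarrow> real \<Rightarrow> real" where
  "expo k p z q w x = k + p * exp (z * x) + q * exp (w * x)"

lemma DERIV_expo: "(expo k p z q w has_real_derivative expo 0 (p * z) z (q * w) w x) (at x)"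
  unfolding expo_def by (auto intro!: derivative_eq_intros simp: algebra_simps)

lemma expo_ode:
  assumes "s * z\<^sup>2 + m * z = k" "s * w\<^sup>2 + m * w = k \<or> q = 0"
  shows "s * expo 0 (p * z * z) z (q * w * w) w x + m * expo 0 (p * z) z (q * w) w x = k * expo 0 p z q w x"
proof -
  have "s * expo 0 (p * z * z) z (q * w * w) w x + m * expo 0 (p * z) z (q * w) w x
      = (s * z\<^sup>2 + m * z) * (p * exp (z * x)) + (s * w\<^sup>2 + m * w) * (q * exp (w * x))"
    by (simp add: expo_def power2_eq_square algebra_simps)
  also have "\<dots> = k * expo 0 p z q w x" using assms by (auto simp: expo_def distrib_left)
  finally show ?thesis .
qed

lemma expo_shift: "expo k p z q w x = k + expo 0 p z q w x"
  by (simp add: expo_def)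

lemma expo_bounded_Icc: "\<exists>M. \<forall>x\<in>{0..b}. \<bar>expo k p z q w x\<bar> \<le> M"
proof -
  have "bounded (expo k p z q w ` {0..b})"
    by (intro compact_imp_bounded compact_continuous_image) (auto intro!: continuous_at_imp_continuous_on DERIV_isCont[OF DERIV_expo])
  then show ?thesis unfolding bounded_iff by auto
qed

lemma expo_bounded_Ici: "v \<le> 0 \<Longrightarrow> 0 \<le> x \<Longrightarrow> \<bar>expo m r v 0 0 x\<bar> \<le> \<bar>m\<bar> + \<bar>r\<bar>"
proof -
  assume "v \<le> 0" "0 \<le> x"
  then have "\<bar>r\<bar> * exp (v * x) \<le> \<bar>r\<bar> * 1" by (intro mult_left_mono) (auto simp: mult_nonpos_nonneg)
  then have "\<bar>r * exp (v * x)\<bar> \<le> \<bar>r\<bar>" by (simp add: abs_mult)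
  then show ?thesis unfolding expo_def by linarith
qed

lemma lipschitz_from_deriv:
  assumes "\<And>x::real. (f has_real_derivative f' x) (at x)" "convex S" "\<And>x. x \<in> S \<Longrightarrow> \<bar>f' x\<bar> \<le> B" "x \<in> S" "y \<in> S"
  shows "\<bar>f x - f y\<bar> \<le> B * \<bar>x - y\<bar>"
  using field_differentiable_bound[OF assms(2) has_field_derivative_at_within[OF assms(1)], of B x y] assms(3-) by auto

text \<open>The functions of interest live on \<open>[0,\<infinity>)\<close>, but a test function must be bounded on the whole line.
  The sine is the simplest bounded continuation to the negative axis that keeps value and slope at
  \<open>0\<close>; the second derivative may jump there as well.\<close>
lemma profile_C11:
  fixes b k p z q w m r v :: real
  defines "F \<equiv> expo k p z q w" and "F' \<equiv> expo 0 (p * z) z (q * w) w" and "F'' \<equiv> expo 0 (p * z * z) z (q * w * w) w"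
    and "H \<equiv> expo m r v 0 0" and "H' \<equiv> expo 0 (r * v) v 0 0" and "H'' \<equiv> expo 0 (r * v * v) v 0 0"
  assumes b: "0 < b" and v: "v < 0" and match: "F b = H b" "F' b = H' b"
  shows "\<exists>B. C11_test (glue 0 (\<lambda>x. F 0 + F' 0 * sin x) (glue b F H)) (glue 0 (\<lambda>x. F' 0 * cos x) (glue b F' H'))
           (glue 0 (\<lambda>x. - F' 0 * sin x) (glue b F'' H'')) B"
proof -
  let ?\<phi> = "glue 0 (\<lambda>x. F 0 + F' 0 * sin x) (glue b F H)"
  let ?\<phi>' = "glue 0 (\<lambda>x. F' 0 * cos x) (glue b F' H')"
  let ?\<psi> = "glue 0 (\<lambda>x. - F' 0 * sin x) (glue b F'' H'')"
  have dF: "(F has_real_derivative F' x) (at x)" "(F' has_real_derivative F'' x) (at x)"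
    "(H has_real_derivative H' x) (at x)" "(H' has_real_derivative H'' x) (at x)" for x
    using DERIV_expo[of k p z q w x] DERIV_expo[of 0 "p * z" z "q * w" w x] DERIV_expo[of m r v 0 0 x] DERIV_expo[of 0 "r * v" v 0 0 x]
    by (simp_all add: F_def F'_def F''_def H_def H'_def H''_def)
  obtain M0 M1 M2 where M: "\<And>x. x \<in> {0..b} \<Longrightarrow> \<bar>F x\<bar> \<le> M0" "\<And>x. x \<in> {0..b} \<Longrightarrow> \<bar>F' x\<bar> \<le> M1" "\<And>x. x \<in> {0..b} \<Longrightarrow> \<bar>F'' x\<bar> \<le> M2"
    unfolding F_def F'_def F''_def using expo_bounded_Icc by metis
  have M0: "0 \<le> M0" "0 \<le> M1" "0 \<le> M2"
    using M(1)[of 0] M(2)[of 0] M(3)[of 0] b by auto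
  define N where "N = (\<bar>m\<bar> + \<bar>r\<bar> + \<bar>r * v\<bar> + \<bar>r * v * v\<bar>) + (\<bar>F 0\<bar> + \<bar>F' 0\<bar>)"
  have N: "0 \<le> N" "\<bar>m\<bar> + \<bar>r\<bar> \<le> N" "\<bar>r * v\<bar> \<le> N" "\<bar>r * v * v\<bar> \<le> N" "\<bar>F 0\<bar> + \<bar>F' 0\<bar> \<le> N"
    unfolding N_def by (simp_all add: add_nonneg_nonneg)
  define B where "B = M0 + M1 + M2 + N"
  have FB: "\<bar>F x\<bar> \<le> B" "\<bar>F' x\<bar> \<le> B" "\<bar>F'' x\<bar> \<le> B" if "0 \<le> x" "x \<le> b" for x
    using M[of x] M0 N(1) that by (auto simp: B_def)
  have HB: "\<bar>H x\<bar> \<le> B" "\<bar>H' x\<bar> \<le> B" "\<bar>H'' x\<bar> \<le> B" if "0 \<le> x" for x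
    using expo_bounded_Ici[of v x m r] expo_bounded_Ici[of v x 0 "r * v"] expo_bounded_Ici[of v x 0 "r * v * v"] v that M0 N
    by (auto simp: B_def H_def H'_def H''_def)
  have SB: "\<bar>F 0 + F' 0 * sin x\<bar> \<le> B" "\<bar>F' 0 * cos x\<bar> \<le> B" "\<bar>- F' 0 * sin x\<bar> \<le> B" for x
  proof -
    have s: "\<bar>F' 0 * sin x\<bar> \<le> \<bar>F' 0\<bar> * 1" "\<bar>F' 0 * cos x\<bar> \<le> \<bar>F' 0\<bar> * 1"
      unfolding abs_mult by (intro mult_left_mono; simp)+
    have B: "\<bar>F 0\<bar> + \<bar>F' 0\<bar> \<le> B" using M0 N unfolding B_def by linarith
    show "\<bar>F 0 + F' 0 * sin x\<bar> \<le> B" "\<bar>F' 0 * cos x\<bar> \<le> B" using s B by linarith+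
    have "\<bar>- F' 0 * sin x\<bar> = \<bar>F' 0 * sin x\<bar>" by simp
    then show "\<bar>- F' 0 * sin x\<bar> \<le> B" using s B by linarith
  qed
  have inner: "(glue b F H has_real_derivative glue b F' H' x) (at x)" for x
    by (rule DERIV_glue) (use dF match in auto)
  have "C11_test ?\<phi> ?\<phi>' ?\<psi> B"
  proof
    fix x y :: real
    show "(?\<phi> has_real_derivative ?\<phi>' x) (at x)"
      by (rule DERIV_glue) (use inner b in \<open>auto intro!: derivative_eq_intros\<close>)
    show "(?\<phi>' has_real_derivative ?\<psi> x) (at x within {x..})"
    proof (rule DERIV_right_glue)
      fix x :: real
      show "((\<lambda>x. F' 0 * cos x) has_real_derivative - F' 0 * sin x) (at x within {x..})"
        by (auto intro!: derivative_eq_intros)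
      show "(glue b F' H' has_real_derivative glue b F'' H'' x) (at x within {x..})"
        by (rule DERIV_right_glue[OF has_field_derivative_at_within[OF dF(2)] has_field_derivative_at_within[OF dF(4)]])
    qed
    show "\<bar>?\<phi> x\<bar> \<le> B" using SB(1) FB(1) HB(1) b by (auto simp: glue_def)
    show "\<bar>?\<phi>' x\<bar> \<le> B" using SB(2) FB(2) HB(2) b by (auto simp: glue_def)
    show "\<bar>?\<phi>' x - ?\<phi>' y\<bar> \<le> B * \<bar>x - y\<bar>"
    proof (rule lipschitz_glue[where S=UNIV])
      fix x y :: real
      show "\<bar>F' 0 * cos x - F' 0 * cos y\<bar> \<le> B * \<bar>x - y\<bar>"
        by (rule lipschitz_from_deriv[where S=UNIV and f'="\<lambda>x. - F' 0 * sin x"]) (use SB in \<open>auto intro!: derivative_eq_intros\<close>)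
    next
      fix x y :: real assume "0 \<le> x" "0 \<le> y"
      then show "\<bar>glue b F' H' x - glue b F' H' y\<bar> \<le> B * \<bar>x - y\<bar>"
      proof (intro lipschitz_glue[where S="{0..}"])
        fix x y :: real assume "x \<in> {0..}" "y \<in> {0..}" "x \<le> b" "y \<le> b"
        then show "\<bar>F' x - F' y\<bar> \<le> B * \<bar>x - y\<bar>"
          by (intro lipschitz_from_deriv[where S="{0..b}", OF dF(2)]) (use FB in auto)
      next
        fix x y :: real assume "x \<in> {0..}" "y \<in> {0..}" "b \<le> x" "b \<le> y"
        then show "\<bar>H' x - H' y\<bar> \<le> B * \<bar>x - y\<bar>"
          by (intro lipschitz_from_deriv[where S="{0..}", OF dF(4)]) (use HB in auto)
      qed (use match b in auto)
    qed (use b in auto)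
  qed
  then show ?thesis ..
qed

text \<open>At the last point of \<open>[y,b]\<close> where \<open>f\<close> is nonnegative, \<open>f\<close> vanishes, and its derivative
  is positive there; yet \<open>f\<close> is negative right after it.\<close>
lemma negative_before_if_upcrossing:
  fixes f :: "real \<Rightarrow> real"
  assumes d: "\<And>x. (f has_real_derivative f' x) (at x)" and neg: "f b < 0"
    and up: "\<And>x. y \<le> x \<Longrightarrow> x < b \<Longrightarrow> f x = 0 \<Longrightarrow> 0 < f' x" and y: "y \<le> b"
  shows "f y < 0"
proof (rule ccontr)
  assume n: "\<not> f y < 0"
  have c: "isCont f x" for x using d by (rule DERIV_isCont)
  define S where "S = {x \<in> {y..b}. 0 \<le> f x}"
  have "S = {y..b} \<inter> {x. 0 \<le> f x}" by (auto simp: S_def)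
  moreover have "closed {x. 0 \<le> f x}"
    by (intro closed_Collect_le continuous_on_const continuous_at_imp_continuous_on ballI c)
  ultimately have "closed S" by (simp add: closed_Int)
  moreover have "bounded S" by (rule bounded_subset[OF bounded_closed_interval[of y b]]) (auto simp: S_def)
  ultimately have "compact S" by (simp add: compact_eq_bounded_closed)
  moreover have "S \<noteq> {}" using n y by (auto simp: S_def)
  ultimately obtain s where s: "s \<in> S" "\<And>x. x \<in> S \<Longrightarrow> x \<le> s" using compact_attains_sup[of S] by metis
  have sb: "s < b" using s(1) neg by (cases "s = b") (auto simp: S_def)
  have "f s = 0"
  proof (rule ccontr)
    assume "f s \<noteq> 0"
    then have "0 < f s" using s(1) by (simp add: S_def)
    then obtain u where u: "s \<le> u" "u \<le> b" "f u = 0" using IVT2[of f b 0 s] neg sb c by force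
    then have "u \<in> S" using s(1) by (auto simp: S_def)
    then have "u = s" using s(2)[of u] u by simp
    then show False using u \<open>f s \<noteq> 0\<close> by simp
  qed
  then have "0 < f' s" using up[of s] s(1) sb by (auto simp: S_def)
  from DERIV_pos_inc_right[OF d this] obtain e where e: "0 < e" "\<And>h. 0 < h \<Longrightarrow> h < e \<Longrightarrow> f s < f (s + h)" by blast
  define h where "h = min (e / 2) (b - s)"
  have h: "0 < h" "h < e" "s + h \<le> b" using e(1) sb by (auto simp: h_def)
  have "s + h \<in> S" using e(2)[OF h(1,2)] \<open>f s = 0\<close> h s(1) by (auto simp: S_def)
  then show False using s(2) h(1) by fastforce
qed

locale threshold_problem = dividend_problem +
  fixes b :: real
  assumes b: "0 < b" and Gb: "G b = 0"
begin

abbreviation "A \<equiv> coeff_A1 \<mu> \<sigma> \<delta> L b"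
abbreviation "B \<equiv> coeff_B2 \<mu> \<sigma> \<delta> L b"
abbreviation "C \<equiv> coeff_C1 \<mu> \<sigma> \<beta> L lam b"
abbreviation "D \<equiv> coeff_D2 \<mu> \<sigma> \<beta> L lam b"

lemma A_eq: "A = L / \<delta> * (- b2) / E1 b"
  by (simp add: coeff_A1_def Let_def E1_def)
lemma B_eq: "B * b2 * exp (b2 * b) = A * (a1 * exp (a1 * b) - a2 * exp (a2 * b))"
  using signs by (simp add: coeff_B2_def Let_def)
lemma C_eq: "C * E2 b = lam * (c2 - d2) * exp (c2 * b)"
  using E2_neg[of b] by (simp add: coeff_C1_def Let_def E2_def)
lemma D_eq: "D * exp (d2 * b) = C * exp (c1 * b) + (lam - C) * exp (c2 * b)"
  by (simp add: coeff_D2_def Let_def)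

lemma A_pos: "0 < A" unfolding A_eq using E1_pos signs pos by (intro divide_pos_pos mult_pos_pos) auto

lemma C_nonpos: "C \<le> 0" "lam - C \<le> 0"
proof -
  have C: "C = lam * ((c2 - d2) * exp (c2 * b) / E2 b)" using C_eq E2_neg[of b] by (simp add: field_simps)
  have "0 \<le> (c2 - d2) * exp (c2 * b) / E2 b"
    using signs E2_neg[of b] by (intro divide_nonpos_neg mult_nonpos_nonneg) auto
  then show "C \<le> 0" unfolding C by (rule mult_nonpos_nonneg[OF lam])
  have "(lam - C) * E2 b = lam * (d2 - c1) * exp (c1 * b)" unfolding left_diff_distrib C_eq by (simp add: E2_def algebra_simps)
  then have lC: "lam - C = lam * ((d2 - c1) * exp (c1 * b) / E2 b)" using E2_neg[of b] by (simp add: field_simps)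
  have "0 \<le> (d2 - c1) * exp (c1 * b) / E2 b"
    using signs E2_neg[of b] by (intro divide_nonpos_neg mult_nonpos_nonneg) auto
  then show "lam - C \<le> 0" unfolding lC by (rule mult_nonpos_nonneg[OF lam])
qed

text \<open>The pieces of \<open>g\<close> and \<open>h\<close> below (index \<open>0\<close>) and above (index \<open>1\<close>) the threshold, with their derivatives.\<close>
definition "g0 = expo 0 A a1 (- A) a2"
definition "g0' = expo 0 (A * a1) a1 (- A * a2) a2"
definition "g0'' = expo 0 (A * a1 * a1) a1 (- A * a2 * a2) a2"
definition "g1 = expo (L / \<delta>) B b2 0 0"
definition "g1' = expo 0 (B * b2) b2 0 0"
definition "g1'' = expo 0 (B * b2 * b2) b2 0 0"
definition "h0 = expo (- lam) C c1 (lam - C) c2"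
definition "h0' = expo 0 (C * c1) c1 ((lam - C) * c2) c2"
definition "h0'' = expo 0 (C * c1 * c1) c1 ((lam - C) * c2 * c2) c2"
definition "h1 = expo (- lam) D d2 0 0"
definition "h1' = expo 0 (D * d2) d2 0 0"
definition "h1'' = expo 0 (D * d2 * d2) d2 0 0"

lemmas pieces = g0_def g0'_def g0''_def g1_def g1'_def g1''_def h0_def h0'_def h0''_def h1_def h1'_def h1''_def

lemma derivs:
  "(g0 has_real_derivative g0' x) (at x)" "(g0' has_real_derivative g0'' x) (at x)"
  "(g1 has_real_derivative g1' x) (at x)" "(g1' has_real_derivative g1'' x) (at x)"
  "(h0 has_real_derivative h0' x) (at x)" "(h0' has_real_derivative h0'' x) (at x)"
  "(h1 has_real_derivative h1' x) (at x)" "(h1' has_real_derivative h1'' x) (at x)"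
  unfolding pieces
  using DERIV_expo[of 0 A a1 "- A" a2 x] DERIV_expo[of 0 "A * a1" a1 "- A * a2" a2 x]
    DERIV_expo[of "L / \<delta>" B b2 0 0 x] DERIV_expo[of 0 "B * b2" b2 0 0 x]
    DERIV_expo[of "- lam" C c1 "lam - C" c2 x] DERIV_expo[of 0 "C * c1" c1 "(lam - C) * c2" c2 x]
    DERIV_expo[of "- lam" D d2 0 0 x] DERIV_expo[of 0 "D * d2" d2 0 0 x]
  by simp_all

text \<open>The coefficients are chosen so that values and slopes agree at the threshold.\<close>
lemma match: "g0 b = g1 b" "g0' b = g1' b" "h0 b = h1 b" "h0' b = h1' b"
proof -
  show "g0' b = g1' b" using B_eq by (simp add: pieces expo_def algebra_simps)
  show "h0 b = h1 b" using D_eq by (simp add: pieces expo_def)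
  have "A * E1 b = L / \<delta> * (- b2)" using E1_pos[of b] by (simp add: A_eq)
  then have "b2 * (A * (exp (a1 * b) - exp (a2 * b)) - L / \<delta>) = A * (a1 * exp (a1 * b) - a2 * exp (a2 * b))"
    by (simp add: E1_def algebra_simps)
  also have "\<dots> = b2 * (B * exp (b2 * b))" using B_eq by (simp add: mult_ac)
  finally have "A * (exp (a1 * b) - exp (a2 * b)) - L / \<delta> = B * exp (b2 * b)" using signs by simp
  then show "g0 b = g1 b" by (simp add: pieces expo_def algebra_simps)
  have "C * c1 * exp (c1 * b) + (lam - C) * c2 * exp (c2 * b) = d2 * (C * exp (c1 * b) + (lam - C) * exp (c2 * b))"
    using C_eq by (simp add: E2_def algebra_simps)
  then show "h0' b = h1' b" unfolding D_eq[symmetric] by (simp add: pieces expo_def algebra_simps)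
qed

lemma at_zero: "g0 0 = 0" "h0 0 = 0" by (simp_all add: pieces expo_def)

lemma odes:
  "\<sigma>\<^sup>2 / 2 * g0'' x + \<mu> * g0' x = \<delta> * g0 x"
  "\<sigma>\<^sup>2 / 2 * g1'' x + (\<mu> - L) * g1' x = \<delta> * g1 x - L"
  "\<sigma>\<^sup>2 / 2 * h0'' x + \<mu> * h0' x = \<beta> * h0 x + \<beta> * lam"
  "\<sigma>\<^sup>2 / 2 * h1'' x + (\<mu> - L) * h1' x = \<beta> * h1 x + \<beta> * lam"
proof -
  note q = root_quadratic(1,2)[OF pos(1,2), of \<mu>] root_quadratic(2)[OF pos(1,2), of "\<mu> - L"]
    root_quadratic(1,2)[OF pos(1,3), of \<mu>] root_quadratic(2)[OF pos(1,3), of "\<mu> - L"]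
  show "\<sigma>\<^sup>2 / 2 * g0'' x + \<mu> * g0' x = \<delta> * g0 x"
    using expo_ode[OF q(1), of a2 "- A" A x] q(2) by (simp add: pieces)
  show "\<sigma>\<^sup>2 / 2 * g1'' x + (\<mu> - L) * g1' x = \<delta> * g1 x - L"
    using expo_ode[OF q(3), of 0 0 B x] pos by (simp add: pieces expo_shift[of "L / \<delta>"] distrib_left)
  show "\<sigma>\<^sup>2 / 2 * h0'' x + \<mu> * h0' x = \<beta> * h0 x + \<beta> * lam"
    using expo_ode[OF q(4), of c2 "lam - C" C x] q(5) by (simp add: pieces expo_shift[of "- lam"] distrib_left right_diff_distrib)
  show "\<sigma>\<^sup>2 / 2 * h1'' x + (\<mu> - L) * h1' x = \<beta> * h1 x + \<beta> * lam"
    using expo_ode[OF q(6), of 0 0 D x] by (simp add: pieces expo_shift[of "- lam"] distrib_left right_diff_distrib)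
qed

text \<open>This is where the equation \<open>G b = 0\<close> is used: the sum of the two slopes at the threshold is \<open>G b + 1\<close>.\<close>
lemma slopes_at_threshold:
  "g1' b = L / \<delta> * (- b2) * s1 b" "h1' b = lam * d2 * s2 b" "g1' b + h1' b = 1" "0 < g1' b" "0 \<le> h1' b"
proof -
  have s1: "0 < s1 b" unfolding s1_def
    using E1_pos[of b] signs by (intro divide_pos_pos) (auto intro!: add_pos_pos mult_pos_pos simp: diff_conv_add_uminus mult_neg_pos simp del: add_uminus_conv_diff)
  have s2: "0 < s2 b" unfolding s2_def using E2_neg[of b] signs by (intro divide_neg_neg mult_neg_pos) auto
  show g: "g1' b = L / \<delta> * (- b2) * s1 b"
    using B_eq unfolding g1'_def expo_def A_eq s1_def by simp
  have "E2 b * (C * exp (c1 * b) + (lam - C) * exp (c2 * b)) = lam * ((c2 - c1) * exp ((c1 + c2) * b))"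
  proof -
    have "E2 b * (C * exp (c1 * b) + (lam - C) * exp (c2 * b)) = (C * E2 b) * (exp (c1 * b) - exp (c2 * b)) + lam * E2 b * exp (c2 * b)"
      by (simp add: algebra_simps)
    also have "\<dots> = lam * ((c2 - c1) * (exp (c1 * b) * exp (c2 * b)))"
      unfolding C_eq by (simp add: E2_def algebra_simps)
    also have "exp (c1 * b) * exp (c2 * b) = exp ((c1 + c2) * b)" by (simp add: exp_add[symmetric] algebra_simps)
    finally show ?thesis .
  qed
  then have "C * exp (c1 * b) + (lam - C) * exp (c2 * b) = lam * s2 b"
    unfolding s2_def using E2_neg[of b] by (simp add: field_simps)
  then have "D * exp (d2 * b) = lam * s2 b" unfolding D_eq .
  then show h: "h1' b = lam * d2 * s2 b" unfolding h1'_def expo_def by simp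
  show "g1' b + h1' b = 1" unfolding g h using Gb unfolding G_eq by simp
  show "0 < g1' b" unfolding g using s1 signs pos by (intro mult_pos_pos) auto
  have "0 \<le> lam * d2" using lam signs by (intro mult_nonpos_nonpos) auto
  then show "0 \<le> h1' b" unfolding h using s2 by (intro mult_nonneg_nonneg[of "lam * d2"]) auto
qed

lemma marginal_above:
  assumes "b \<le> x" shows "g1' x + h1' x \<le> 1"
proof -
  have e: "g1' x = g1' b * exp (b2 * (x - b))" "h1' x = h1' b * exp (d2 * (x - b))"
    by (simp_all add: pieces expo_def exp_add[symmetric] algebra_simps)
  have "b2 * (x - b) \<le> 0" "d2 * (x - b) \<le> 0" using signs assms by (auto intro: mult_nonpos_nonneg)
  then have "g1' b * exp (b2 * (x - b)) \<le> g1' b * 1" "h1' b * exp (d2 * (x - b)) \<le> h1' b * 1"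
    using slopes_at_threshold(4,5) by (intro mult_left_mono; simp)+
  then show ?thesis unfolding e using slopes_at_threshold(3) by linarith
qed

text \<open>Let \<open>m = g0' + h0'\<close>. As \<open>m b = 1\<close>, it suffices that \<open>m' < 0\<close> up to \<open>b\<close>. The second derivatives of the two sides,
  which differ for \<open>g\<close> and for \<open>h\<close> separately, agree at \<open>b\<close> for the sum just because the slope there
  is \<open>1\<close>; hence \<open>m' b < 0\<close>. And \<open>m'\<close> cannot vanish before \<open>b\<close>: the differentiated equations
  give \<open>\<sigma>\<^sup>2 / 2 * m'' = \<delta> * g0' + \<beta> * h0' > 0\<close> at such a point.\<close>
lemma marginal_below:
  assumes "0 \<le> x" "x \<le> b" shows "1 \<le> g0' x + h0' x"
proof -
  define g3 where "g3 = expo 0 (A * a1 * a1 * a1) a1 (- A * a2 * a2 * a2) a2"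
  define h3 where "h3 = expo 0 (C * c1 * c1 * c1) c1 ((lam - C) * c2 * c2 * c2) c2"
  have d3: "(g0'' has_real_derivative g3 y) (at y)" "(h0'' has_real_derivative h3 y) (at y)" for y
    unfolding g3_def h3_def pieces
    using DERIV_expo[of 0 "A * a1 * a1" a1 "- A * a2 * a2" a2 y] DERIV_expo[of 0 "C * c1 * c1" c1 "(lam - C) * c2 * c2" c2 y] by simp_all
  have ode3: "\<sigma>\<^sup>2 / 2 * g3 y + \<mu> * g0'' y = \<delta> * g0' y" "\<sigma>\<^sup>2 / 2 * h3 y + \<mu> * h0'' y = \<beta> * h0' y" for y
    using expo_ode[OF root_quadratic(1)[OF pos(1,2), of \<mu>], of a2 "- A * a2" "A * a1" y] root_quadratic(2)[OF pos(1,2), of \<mu>]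
      expo_ode[OF root_quadratic(1)[OF pos(1,3), of \<mu>], of c2 "(lam - C) * c2" "C * c1" y] root_quadratic(2)[OF pos(1,3), of \<mu>]
    by (simp_all add: g3_def h3_def pieces)
  have g0': "0 < g0' y" for y
  proof -
    have "g0' y = A * (a1 * exp (a1 * y) + (- a2) * exp (a2 * y))" by (simp add: pieces expo_def algebra_simps)
    also have "\<dots> > 0" using A_pos signs by (intro mult_pos_pos add_pos_pos) auto
    finally show ?thesis .
  qed
  have h0'': "h0'' y \<le> 0" for y
    unfolding pieces expo_def using C_nonpos
    by (simp add: mult.assoc) (intro add_nonpos_nonpos mult_nonpos_nonneg; simp add: zero_le_mult_iff mult.assoc[symmetric])
  have h0': "0 \<le> h0' y" if "y \<le> b" for y
  proof -
    have "h0' b \<le> h0' y"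
      by (rule DERIV_nonpos_imp_nonincreasing[OF that]) (use derivs(6) h0'' in blast)
    then show ?thesis using slopes_at_threshold(5) match by simp
  qed
  have "\<sigma>\<^sup>2 / 2 * (g0'' b + h0'' b) = \<sigma>\<^sup>2 / 2 * (g1'' b + h1'' b)"
  proof -
    have "\<sigma>\<^sup>2 / 2 * (g0'' b + h0'' b) = \<delta> * g0 b + \<beta> * h0 b + \<beta> * lam - \<mu> * (g0' b + h0' b)"
      using odes(1)[of b] odes(3)[of b] unfolding distrib_left by linarith
    also have "\<dots> = \<delta> * g1 b + \<beta> * h1 b + \<beta> * lam - \<mu>" unfolding match slopes_at_threshold(3) by simp
    also have "\<dots> = \<delta> * g1 b - L + \<beta> * h1 b + \<beta> * lam - (\<mu> - L) * (g1' b + h1' b)" unfolding slopes_at_threshold(3) by simp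
    also have "\<dots> = \<sigma>\<^sup>2 / 2 * (g1'' b + h1'' b)"
      using odes(2)[of b] odes(4)[of b] unfolding distrib_left by linarith
    finally show ?thesis .
  qed
  then have "g0'' b + h0'' b = g1'' b + h1'' b" using pos by simp
  also have "\<dots> = b2 * g1' b + d2 * h1' b" by (simp add: pieces expo_def algebra_simps)
  also have "\<dots> < 0" using signs slopes_at_threshold by (intro add_neg_nonpos mult_neg_pos mult_nonpos_nonneg) auto
  finally have neg: "g0'' b + h0'' b < 0" .
  have "g0'' y + h0'' y < 0" if y: "y \<le> b" for y
  proof (rule negative_before_if_upcrossing[where f="\<lambda>y. g0'' y + h0'' y" and b=b])
    show "((\<lambda>y. g0'' y + h0'' y) has_real_derivative g3 y + h3 y) (at y)" for y
      using d3 by (rule DERIV_add)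
    fix u assume u: "u < b" "g0'' u + h0'' u = 0"
    have "\<mu> * g0'' u + \<mu> * h0'' u = 0" using u(2) by (simp add: distrib_left[symmetric])
    then have "\<sigma>\<^sup>2 / 2 * (g3 u + h3 u) = \<delta> * g0' u + \<beta> * h0' u"
      using ode3[of u] unfolding distrib_left by linarith
    also have "\<dots> > 0" using g0'[of u] h0'[of u] u pos by (intro add_pos_nonneg mult_pos_pos mult_nonneg_nonneg) auto
    finally show "0 < g3 u + h3 u" using pos by (simp add: zero_less_mult_iff)
  qed (use neg y in auto)
  then have "g0' b + h0' b \<le> g0' x + h0' x"
    using assms(2) DERIV_add[OF derivs(2) derivs(6)]
    by (intro DERIV_nonpos_imp_nonincreasing[of x b "\<lambda>y. g0' y + h0' y"]) (auto intro: less_imp_le)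
  then show ?thesis unfolding match using slopes_at_threshold(3) by simp
qed

definition "gf = glue b g0 g1"
definition "gD = glue b g0' g1'"
definition "gDD = glue b g0'' g1''"
definition "hf = glue b h0 h1"
definition "hD = glue b h0' h1'"
definition "hDD = glue b h0'' h1''"

lemmas glued = gf_def gD_def gDD_def hf_def hD_def hDD_def

lemma glued_C11:
  "\<exists>K. C11_test (glue 0 (\<lambda>x. g0 0 + g0' 0 * sin x) gf) (glue 0 (\<lambda>x. g0' 0 * cos x) gD) (glue 0 (\<lambda>x. - g0' 0 * sin x) gDD) K"
  "\<exists>K. C11_test (glue 0 (\<lambda>x. h0 0 + h0' 0 * sin x) hf) (glue 0 (\<lambda>x. h0' 0 * cos x) hD) (glue 0 (\<lambda>x. - h0' 0 * sin x) hDD) K"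
  using profile_C11[of b b2 0 A a1 "- A" a2 "L / \<delta>" B] profile_C11[of b d2 "- lam" C c1 "lam - C" c2 "- lam" D] b signs match
  unfolding glued pieces by simp_all

lemma glued_zero: "gf 0 = 0" "hf 0 = 0" using b at_zero by (simp_all add: glued)

text \<open>Both sides of the threshold in one formula: the differential equations of the two sides differ by \<open>L\<close> times
  the slope, which is the threshold control itself.\<close>
lemma glued_odes:
  "- \<delta> * gf x + (\<mu> - c) * gD x + \<sigma>\<^sup>2 / 2 * gDD x = (threshold_control L b t x - c) * gD x - threshold_control L b t x"
  "- \<beta> * hf x + (\<mu> - c) * hD x + \<sigma>\<^sup>2 / 2 * hDD x = (threshold_control L b t x - c) * hD x + \<beta> * lam"
  using odes[of x] by (cases "x < b"; simp add: glued threshold_control_def algebra_simps)+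

text \<open>The threshold control is optimal pointwise: it pays at the maximal rate where a unit of dividends is
  worth more than a unit of surplus, and nothing where it is worth less.\<close>
lemma marginal:
  assumes "0 \<le> x" "0 \<le> c" "c \<le> L"
  shows "0 \<le> (threshold_control L b t x - c) * (1 - (gD x + hD x))"
proof (cases "x < b")
  case True
  then have "1 - (gD x + hD x) \<le> 0" using marginal_below[of x] assms by (simp add: glued)
  then show ?thesis using True assms by (intro mult_nonpos_nonpos) (auto simp: threshold_control_def)
next
  case False
  then have "0 \<le> 1 - (gD x + hD x)" using marginal_above[of x] by (simp add: glued)
  then show ?thesis using False assms by (intro mult_nonneg_nonneg) (auto simp: threshold_control_def)
qed

lemma glued_derivs:
  "(gf has_real_derivative gD x) (at x)" "(hf has_real_derivative hD x) (at x)"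
  "(gD has_real_derivative gDD x) (at x within {x..})" "(hD has_real_derivative hDD x) (at x within {x..})"
  "x \<noteq> b \<Longrightarrow> (gD has_real_derivative gDD x) (at x)" "x \<noteq> b \<Longrightarrow> (hD has_real_derivative hDD x) (at x)"
proof -
  show "(gf has_real_derivative gD x) (at x)" "(hf has_real_derivative hD x) (at x)"
    unfolding glued by (rule DERIV_glue; use derivs match in auto)+
  show "(gD has_real_derivative gDD x) (at x within {x..})" "(hD has_real_derivative hDD x) (at x within {x..})"
    unfolding glued by (rule DERIV_right_glue[OF has_field_derivative_at_within[OF derivs(2)] has_field_derivative_at_within[OF derivs(4)]]
        DERIV_right_glue[OF has_field_derivative_at_within[OF derivs(6)] has_field_derivative_at_within[OF derivs(8)]])+
  show "x \<noteq> b \<Longrightarrow> (gD has_real_derivative gDD x) (at x)" "x \<noteq> b \<Longrightarrow> (hD has_real_derivative hDD x) (at x)"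
    unfolding glued using DERIV_glue_left[OF derivs(2)] DERIV_glue_left[OF derivs(6)] DERIV_glue_right[OF derivs(4)] DERIV_glue_right[OF derivs(8)]
    by (cases "x < b"; simp)+
qed

lemma candidate_eq:
  "candidate \<mu> \<sigma> \<delta> \<beta> L lam \<alpha> b r t x = exp (-\<delta> * (t - r)) * gf x + exp (-\<beta> * (t - r)) * hf x + lam * (1 - \<alpha>)"
  by (simp add: candidate_def Let_def glued pieces expo_def glue_def algebra_simps)

end

section \<open>The extended HJB system and the equilibrium property\<close>

lemma vector_derivative_within_Ici:
  assumes "0 \<le> (x::real)" "(f has_real_derivative D) (at x within {0..})"
  shows "vector_derivative f (at x within {0..}) = D"
proof -
  have "at x within {x<..} \<le> at x within {0..}" using assms by (intro at_le) auto
  then have "at x within {0..} \<noteq> bot" using trivial_limit_at_right_real[of x] by (metis bot.extremum_uniqueI)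
  then show ?thesis using assms(2) by (intro vector_derivative_within) (simp_all add: has_real_derivative_iff_has_vector_derivative)
qed

context threshold_problem
begin

context
  fixes \<alpha> r :: real
begin

abbreviation "f \<equiv> candidate \<mu> \<sigma> \<delta> \<beta> L lam \<alpha> b r"
abbreviation "e1 s \<equiv> exp (-\<delta> * (s - r))"
abbreviation "e2 s \<equiv> exp (-\<beta> * (s - r))"

lemma candidate_DERIV_t:
  "((\<lambda>s. f s x) has_real_derivative (- \<delta> * e1 s * gf x - \<beta> * e2 s * hf x)) (at s within S)"
  unfolding candidate_eq by (auto intro!: derivative_eq_intros)

lemma candidate_DERIV_x: "((\<lambda>y. f s y) has_real_derivative (e1 s * gD x + e2 s * hD x)) (at x within S)"
  unfolding candidate_eq
  by (rule has_field_derivative_at_within) (auto intro!: derivative_eq_intros glued_derivs(1,2))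

lemma candidate_deriv_t: "0 \<le> s \<Longrightarrow> deriv_t f s x = - \<delta> * e1 s * gf x - \<beta> * e2 s * hf x"
  unfolding deriv_t_def by (rule vector_derivative_within_Ici[OF _ candidate_DERIV_t])

lemma candidate_deriv_x: "0 \<le> x \<Longrightarrow> deriv_x f s x = e1 s * gD x + e2 s * hD x"
  unfolding deriv_x_def by (rule vector_derivative_within_Ici[OF _ candidate_DERIV_x])

lemma candidate_DERIV_xx:
  assumes "0 \<le> x" "x \<noteq> b"
  shows "((\<lambda>y. deriv_x f s y) has_real_derivative (e1 s * gDD x + e2 s * hDD x)) (at x within {0..})"
proof -
  have "((\<lambda>y. e1 s * gD y + e2 s * hD y) has_real_derivative (e1 s * gDD x + e2 s * hDD x)) (at x within {0..})"
    by (rule has_field_derivative_at_within) (use assms in \<open>auto intro!: derivative_eq_intros glued_derivs(5,6)\<close>)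
  then show ?thesis
    by (rule has_field_derivative_transform_within[where d=1]) (use assms in \<open>auto simp: candidate_deriv_x\<close>)
qed

lemma candidate_deriv_x_x: "0 \<le> x \<Longrightarrow> x \<noteq> b \<Longrightarrow> deriv_x (deriv_x f) s x = e1 s * gDD x + e2 s * hDD x"
  unfolding deriv_x_def[of "deriv_x f"] by (rule vector_derivative_within_Ici[OF _ candidate_DERIV_xx])

lemma candidate_xx_right_limit:
  "((\<lambda>y. deriv_x (deriv_x f) s y) \<longlongrightarrow> e1 s * gDD b + e2 s * hDD b) (at_right b)"
proof (rule Lim_transform_eventually)
  have c: "isCont g1'' b" "isCont h1'' b" unfolding pieces by (rule DERIV_isCont[OF DERIV_expo])+
  have "((\<lambda>y. e1 s * g1'' y + e2 s * h1'' y) \<longlongrightarrow> e1 s * g1'' b + e2 s * h1'' b) (at_right b)"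
    using c by (intro tendsto_intros) (auto simp: isCont_def intro: tendsto_within_subset)
  then show "((\<lambda>y. e1 s * g1'' y + e2 s * h1'' y) \<longlongrightarrow> e1 s * gDD b + e2 s * hDD b) (at_right b)"
    by (simp add: glued)
  show "\<forall>\<^sub>F y in at_right b. e1 s * g1'' y + e2 s * h1'' y = deriv_x (deriv_x f) s y"
    unfolding eventually_at_filter
    by (rule always_eventually) (use b in \<open>auto simp: candidate_deriv_x_x glued\<close>)
qed

text \<open>If the second derivative exists at the threshold, it equals the right derivative; otherwise the right-hand
  limit is taken by definition. Both give the piece above the threshold.\<close>
lemma candidate_deriv_xx:
  assumes x: "0 \<le> x" shows "deriv_xx f s x = e1 s * gDD x + e2 s * hDD x"
proof (cases "(\<lambda>y. deriv_x f s y) differentiable (at x within {0..})")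
  case True
  show ?thesis
  proof (cases "x = b")
    case False
    then show ?thesis using True candidate_deriv_x_x[OF x] by (simp add: deriv_xx_def)
  next
    case eq: True
    obtain D where D: "((\<lambda>y. deriv_x f s y) has_real_derivative D) (at x within {0..})"
      using True by (auto simp: real_differentiable_def)
    then have 1: "((\<lambda>y. deriv_x f s y) has_real_derivative D) (at x within {x..})"
      by (rule DERIV_subset) (use x in auto)
    have "((\<lambda>y. e1 s * gD y + e2 s * hD y) has_real_derivative (e1 s * gDD x + e2 s * hDD x)) (at x within {x..})"
      by (auto intro!: derivative_eq_intros glued_derivs(3,4))
    then have 2: "((\<lambda>y. deriv_x f s y) has_real_derivative (e1 s * gDD x + e2 s * hDD x)) (at x within {x..})"
      by (rule has_field_derivative_transform_within[where d=1]) (use x in \<open>auto simp: candidate_deriv_x\<close>)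
    have "at x within {x<..} \<le> at x within {x..}" by (intro at_le) auto
    then have "at x within {x..} \<noteq> bot" using trivial_limit_at_right_real[of x] by (metis bot.extremum_uniqueI)
    then have "D = e1 s * gDD x + e2 s * hDD x"
      using 1 2 unfolding has_field_derivative_iff by (rule tendsto_unique)
    then show ?thesis using True vector_derivative_within_Ici[OF x D] by (simp add: deriv_xx_def deriv_x_def[of "deriv_x f"])
  qed
next
  case False
  then have "x = b" using candidate_DERIV_xx[OF x] by (auto simp: real_differentiable_def)
  moreover have "Lim (at_right b) (\<lambda>y. deriv_x (deriv_x f) s y) = e1 s * gDD b + e2 s * hDD b"
    by (rule tendsto_Lim[OF trivial_limit_at_right_real candidate_xx_right_limit])
  ultimately show ?thesis using False by (simp add: deriv_xx_def)
qed

lemma candidate_smooth_off: "smooth_off b f"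
  unfolding smooth_off_def
proof (intro allI impI conjI)
  fix s x :: real assume "0 \<le> s" "0 \<le> x"
  show "(\<lambda>s. f s x) differentiable at s within {0..}" using candidate_DERIV_t real_differentiable_def by blast
  show "(\<lambda>y. f s y) differentiable at x within {0..}" using candidate_DERIV_x real_differentiable_def by blast
  show "(\<lambda>y. deriv_x f s y) differentiable at x within {0..} \<or>
      x = b \<and> (\<exists>k. ((\<lambda>y. deriv_x (deriv_x f) s y) \<longlongrightarrow> k) (at_right b))"
    using candidate_DERIV_xx[OF \<open>0 \<le> x\<close>] candidate_xx_right_limit real_differentiable_def by blast
qed

lemma candidate_generator:
  assumes "0 \<le> s" "0 \<le> x"
  shows "generator \<mu> \<sigma> c f s x + running \<delta> \<beta> lam r s c
     = (threshold_control L b s x - c) * (e1 s * (gD x - 1) + e2 s * hD x)"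
proof -
  have "generator \<mu> \<sigma> c f s x + running \<delta> \<beta> lam r s c
      = e1 s * (- \<delta> * gf x + (\<mu> - c) * gD x + \<sigma>\<^sup>2 / 2 * gDD x)
      + e2 s * (- \<beta> * hf x + (\<mu> - c) * hD x + \<sigma>\<^sup>2 / 2 * hDD x) + e1 s * c - lam * \<beta> * e2 s"
    unfolding generator_def running_def candidate_deriv_t[OF assms(1)] candidate_deriv_x[OF assms(2)] candidate_deriv_xx[OF assms(2)]
    by (simp add: algebra_simps)
  then show ?thesis unfolding glued_odes[of x c s] by (simp add: algebra_simps)
qed

end

lemma threshold_control_bounds: "0 \<le> threshold_control L b t x" "threshold_control L b t x \<le> L"
  using pos by (auto simp: threshold_control_def)

lemma candidate_solves_supremum:
  assumes "0 \<le> t" "0 \<le> x"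
  shows "(SUP c\<in>{0..L}. generator \<mu> \<sigma> c (candidate \<mu> \<sigma> \<delta> \<beta> L lam \<alpha> b t) t x + running \<delta> \<beta> lam t t c) = 0"
proof (rule cSup_eq_maximum)
  show "0 \<in> (\<lambda>c. generator \<mu> \<sigma> c (candidate \<mu> \<sigma> \<delta> \<beta> L lam \<alpha> b t) t x + running \<delta> \<beta> lam t t c) ` {0..L}"
    using threshold_control_bounds[of t x] candidate_generator[OF assms, of "threshold_control L b t x"]
    by (intro image_eqI[of _ _ "threshold_control L b t x"]) auto
  fix z assume "z \<in> (\<lambda>c. generator \<mu> \<sigma> c (candidate \<mu> \<sigma> \<delta> \<beta> L lam \<alpha> b t) t x + running \<delta> \<beta> lam t t c) ` {0..L}"
  then obtain c where c: "0 \<le> c" "c \<le> L" and z: "z = (threshold_control L b t x - c) * (gD x - 1 + hD x)"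
    using candidate_generator[OF assms] by auto
  have "z = - ((threshold_control L b t x - c) * (1 - (gD x + hD x)))" unfolding z by (simp add: algebra_simps)
  then show "z \<le> 0" using marginal[OF assms(2) c, of t] by simp
qed

lemma glued_bounds:
  "\<exists>K\<ge>0. \<forall>y\<ge>0. \<bar>gf y\<bar> \<le> K \<and> \<bar>gD y\<bar> \<le> K" "\<exists>K\<ge>0. \<forall>y\<ge>0. \<bar>hf y\<bar> \<le> K \<and> \<bar>hD y\<bar> \<le> K"
proof -
  obtain Kg Kh where
    g: "C11_test (glue 0 (\<lambda>x. g0 0 + g0' 0 * sin x) gf) (glue 0 (\<lambda>x. g0' 0 * cos x) gD) (glue 0 (\<lambda>x. - g0' 0 * sin x) gDD) Kg"
    and h: "C11_test (glue 0 (\<lambda>x. h0 0 + h0' 0 * sin x) hf) (glue 0 (\<lambda>x. h0' 0 * cos x) hD) (glue 0 (\<lambda>x. - h0' 0 * sin x) hDD) Kh"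
    using glued_C11 by blast
  have "\<bar>gf y\<bar> \<le> Kg \<and> \<bar>gD y\<bar> \<le> Kg" if "0 \<le> y" for y
    using C11_test.bnd(1)[OF g, of y] C11_test.bnd(2)[OF g, of y] that by simp
  then show "\<exists>K\<ge>0. \<forall>y\<ge>0. \<bar>gf y\<bar> \<le> K \<and> \<bar>gD y\<bar> \<le> K" using C11_test.B0[OF g] by blast
  have "\<bar>hf y\<bar> \<le> Kh \<and> \<bar>hD y\<bar> \<le> Kh" if "0 \<le> y" for y
    using C11_test.bnd(1)[OF h, of y] C11_test.bnd(2)[OF h, of y] that by simp
  then show "\<exists>K\<ge>0. \<forall>y\<ge>0. \<bar>hf y\<bar> \<le> K \<and> \<bar>hD y\<bar> \<le> K" using C11_test.B0[OF h] by blast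
qed

lemma glued_meas: "gf \<in> borel_measurable borel" "hf \<in> borel_measurable borel"
  by (rule borel_measurable_continuous_onI, intro continuous_at_imp_continuous_on ballI, rule DERIV_isCont, rule glued_derivs)+

end

locale controlled_threshold =
  controlled M F W \<mu> \<sigma> Lmax t x l Y + threshold_problem \<mu> \<sigma> \<delta> \<beta> Lmax lam b
  for M :: "'a measure" and F and W :: "real \<Rightarrow> 'a \<Rightarrow> real" and \<mu> \<sigma> Lmax t x l Y \<delta> \<beta> lam b
begin

text \<open>This turns the terminal payment into a running one, for finite and infinite ruin times alike.\<close>
lemma discount_as_running_reward:
  assumes \<omega>: "\<omega> \<in> space M"
  shows "discount \<beta> (\<tau> \<omega> - ereal t) = 1 - run (\<lambda>r y. exp (-\<beta> * (r - t)) * \<beta>) \<omega>"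
proof -
  have \<beta>: "0 < \<beta>" using pos by simp
  note i = exp_tail(1)[OF \<beta>] and v = exp_tail(2)[OF \<beta>]
  have r: "run (\<lambda>r y. exp (-\<beta> * (r - t)) * \<beta>) \<omega> = (LINT r:{s. t \<le> s \<and> ereal s < \<tau> \<omega>}|lborel. exp (-\<beta> * (r - t))) * \<beta>"
    unfolding run_def by (rule set_integral_mult_left)
  show ?thesis
  proof (cases "\<tau> \<omega>")
    case PInf
    then have "{s. t \<le> s \<and> ereal s < \<tau> \<omega>} = {t..}" by auto
    then show ?thesis unfolding r using PInf v[of t t] \<beta> by (simp add: discount_def)
  next
    case MInf
    then show ?thesis using ruin_time_ge[of t Y \<omega>] by simp
  next
    case (real T)
    then have T: "t \<le> T" using ruin_time_ge[of t Y \<omega>] by simp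
    have S: "{s. t \<le> s \<and> ereal s < \<tau> \<omega>} = {t..<T}" using real by auto
    have "(LINT r:{t..}|lborel. exp (-\<beta> * (r - t))) = (LINT r:{t..<T} \<union> {T..}|lborel. exp (-\<beta> * (r - t)))"
      using T by (simp add: ivl_disj_un)
    also have "\<dots> = (LINT r:{t..<T}|lborel. exp (-\<beta> * (r - t))) + (LINT r:{T..}|lborel. exp (-\<beta> * (r - t)))"
    proof (rule set_integral_Un)
      show "set_integrable lborel {t..<T} (\<lambda>r. exp (-\<beta> * (r - t)))"
        by (rule set_integrable_subset[OF i[of t t]]) auto
    qed (use i in auto)
    finally have "(LINT r:{t..<T}|lborel. exp (-\<beta> * (r - t))) * \<beta> = 1 - exp (-\<beta> * (T - t))"
      unfolding v using \<beta> by (simp add: field_simps)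
    then show ?thesis unfolding r S using real by (simp add: discount_def)
  qed
qed

text \<open>The resolvent equations for \<open>g\<close> and \<open>h\<close>, with the drift of the given control, express \<open>g x + h x\<close> as the
  mean of an integral up to ruin. By \<open>glued_odes\<close> its integrand is the running reward of the problem plus a
  multiple of \<open>threshold_control - l\<close>.\<close>
lemma reward_decomposition:
  assumes XY: "X l t x = Y"
  shows "reward M X \<delta> \<beta> lam \<alpha> t x l = gf x + hf x + lam * (1 - \<alpha>)
    + (\<integral>\<omega>. run (\<lambda>r y. (l r y - threshold_control Lmax b r y) * (exp (-\<delta> * (r - t)) * (1 - gD y) - exp (-\<beta> * (r - t)) * hD y)) \<omega> \<partial>M)"
    (is "_ = _ + (\<integral>\<omega>. run ?dev \<omega> \<partial>M)")
    and "damped t (\<lambda>r y. (l r y - threshold_control Lmax b r y) * (exp (-\<delta> * (r - t)) * (1 - gD y) - exp (-\<beta> * (r - t)) * hD y))"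
proof -
  obtain Kg Kh where
    g: "C11_test (glue 0 (\<lambda>x. g0 0 + g0' 0 * sin x) gf) (glue 0 (\<lambda>x. g0' 0 * cos x) gD) (glue 0 (\<lambda>x. - g0' 0 * sin x) gDD) Kg"
    and h: "C11_test (glue 0 (\<lambda>x. h0 0 + h0' 0 * sin x) hf) (glue 0 (\<lambda>x. h0' 0 * cos x) hD) (glue 0 (\<lambda>x. - h0' 0 * sin x) hDD) Kh"
    using glued_C11 by blast
  let ?lh = "threshold_control Lmax b"
  let ?u = "\<lambda>r y. exp (-\<delta> * (r - t)) * l r y"
  let ?v = "\<lambda>r y. exp (-\<beta> * (r - t)) * \<beta>"
  have z: "glue 0 (\<lambda>x. g0 0 + g0' 0 * sin x) gf 0 = 0" "glue 0 (\<lambda>x. h0 0 + h0' 0 * sin x) hf 0 = 0"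
    using glued_zero by simp_all
  note Rg = resolvent_representation[OF g z(1) pos(2)] and Rh = resolvent_representation[OF h z(2) pos(3)]
  define pg where "pg = (\<lambda>r y. exp (-\<delta> * (r - t)) * (- \<delta> * glue 0 (\<lambda>x. g0 0 + g0' 0 * sin x) gf y
      + (\<mu> - l r y) * glue 0 (\<lambda>x. g0' 0 * cos x) gD y + \<sigma>\<^sup>2 / 2 * glue 0 (\<lambda>x. - g0' 0 * sin x) gDD y))"
  define ph where "ph = (\<lambda>r y. exp (-\<beta> * (r - t)) * (- \<beta> * glue 0 (\<lambda>x. h0 0 + h0' 0 * sin x) hf y
      + (\<mu> - l r y) * glue 0 (\<lambda>x. h0' 0 * cos x) hD y + \<sigma>\<^sup>2 / 2 * glue 0 (\<lambda>x. - h0' 0 * sin x) hDD y))"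
  have dg: "damped t pg" "(\<integral>\<omega>. run pg \<omega> \<partial>M) = - gf x" unfolding pg_def using Rg x0 by simp_all
  have dh: "damped t ph" "(\<integral>\<omega>. run ph \<omega> \<partial>M) = - hf x" unfolding ph_def using Rh x0 by simp_all
  have du: "damped t ?u"
    by (rule damped_discounted[OF l_meas _ pos(2), of t Lmax]) (use l_bounds in auto)
  have dv: "damped t ?v"
    by (rule damped_discounted[OF borel_measurable_const _ pos(3), of t \<beta> \<beta>]) (use pos in auto)
  define s where "s = (\<lambda>r y. (?u r y + (- lam) * ?v r y) + (pg r y + ph r y))"
  have ds: "damped t s" unfolding s_def by (intro damped_add du damped_cmult dv dg dh)
  have s_eq: "s r y = ?dev r y" if "0 \<le> y" for r y
  proof -
    have "pg r y = exp (-\<delta> * (r - t)) * ((?lh r y - l r y) * gD y - ?lh r y)"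
      unfolding pg_def using that glued_odes(1)[of y "l r y" r] by simp
    moreover have "ph r y = exp (-\<beta> * (r - t)) * ((?lh r y - l r y) * hD y + \<beta> * lam)"
      unfolding ph_def using that glued_odes(2)[of y "l r y" r] by simp
    ultimately show ?thesis by (simp add: s_def algebra_simps)
  qed
  show "damped t ?dev"
  proof -
    obtain \<rho> K where k: "0 < \<rho>" "0 \<le> K" "\<And>r y. t \<le> r \<Longrightarrow> 0 \<le> y \<Longrightarrow> \<bar>s r y\<bar> \<le> K * exp (-\<rho> * (r - t))"
      using dampedE[OF ds] by blast
    have "(\<lambda>p. ?dev (fst p) (snd p)) \<in> borel_measurable (restrict_space borel ({0..} \<times> {0..}))"
      using damped_meas[OF ds] by (subst measurable_cong[where g="\<lambda>p. s (fst p) (snd p)"]) (auto simp: space_restrict_space s_eq)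
    then show ?thesis by (rule dampedI[OF _ k(1,2)]) (use k(3) s_eq in auto)
  qed
  have rs: "run s \<omega> = run ?dev \<omega>" for \<omega> by (rule run_cong) (use s_eq in auto)
  have split: "run s \<omega> = (run ?u \<omega> - lam * run ?v \<omega>) + (run pg \<omega> + run ph \<omega>)" if "\<omega> \<in> space M" for \<omega>
  proof -
    have "run s \<omega> = run (\<lambda>r y. ?u r y + (- lam) * ?v r y) \<omega> + run (\<lambda>r y. pg r y + ph r y) \<omega>"
      unfolding s_def by (rule run_add[OF damped_add[OF du damped_cmult[OF dv]] damped_add[OF dg(1) dh(1)] that])
    moreover have "run (\<lambda>r y. ?u r y + (- lam) * ?v r y) \<omega> = run ?u \<omega> + run (\<lambda>r y. (- lam) * ?v r y) \<omega>"
      by (rule run_add[OF du damped_cmult[OF dv] that])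
    moreover have "run (\<lambda>r y. (- lam) * ?v r y) \<omega> = (- lam) * run ?v \<omega>" by (rule run_cmult)
    moreover have "run (\<lambda>r y. pg r y + ph r y) \<omega> = run pg \<omega> + run ph \<omega>" by (rule run_add[OF dg(1) dh(1) that])
    ultimately show ?thesis by linarith
  qed
  note int = run_integrable[OF du] run_integrable[OF dv] run_integrable[OF dg(1)] run_integrable[OF dh(1)]
  have "(\<integral>\<omega>. run ?dev \<omega> \<partial>M) = (\<integral>\<omega>. (run ?u \<omega> - lam * run ?v \<omega>) + (run pg \<omega> + run ph \<omega>) \<partial>M)"
    by (rule Bochner_Integration.integral_cong[OF refl]) (simp only: rs[symmetric] split)
  also have "\<dots> = (\<integral>\<omega>. run ?u \<omega> - lam * run ?v \<omega> \<partial>M) - gf x - hf x"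
    using int dg(2) dh(2) by simp
  finally have dev: "(\<integral>\<omega>. run ?u \<omega> - lam * run ?v \<omega> \<partial>M) = gf x + hf x + (\<integral>\<omega>. run ?dev \<omega> \<partial>M)" by simp
  have "reward M X \<delta> \<beta> lam \<alpha> t x l = (\<integral>\<omega>. run ?u \<omega> + lam * (discount \<beta> (\<tau> \<omega> - ereal t) - \<alpha>) \<partial>M)"
    unfolding reward_def XY run_def ..
  also have "\<dots> = (\<integral>\<omega>. (run ?u \<omega> - lam * run ?v \<omega>) + lam * (1 - \<alpha>) \<partial>M)"
    by (rule Bochner_Integration.integral_cong) (auto simp: discount_as_running_reward algebra_simps)
  also have "\<dots> = (\<integral>\<omega>. run ?u \<omega> - lam * run ?v \<omega> \<partial>M) + lam * (1 - \<alpha>)"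
    using int by (simp add: prob_space)
  finally show "reward M X \<delta> \<beta> lam \<alpha> t x l = gf x + hf x + lam * (1 - \<alpha>) + (\<integral>\<omega>. run ?dev \<omega> \<partial>M)"
    unfolding dev by simp
qed

lemma terminal_condition:
  shows "t \<le> v \<Longrightarrow> integrable M (\<lambda>\<omega>. candidate \<mu> \<sigma> \<delta> \<beta> Lmax lam \<alpha> b r (stop v \<omega>) (Y (stop v \<omega>) \<omega>))"
    and "((\<lambda>v. \<integral>\<omega>. candidate \<mu> \<sigma> \<delta> \<beta> Lmax lam \<alpha> b r (stop v \<omega>) (Y (stop v \<omega>) \<omega>) \<partial>M) \<longlongrightarrow> lam * (1 - \<alpha>)) at_top"
proof -
  obtain Kg Kh where Kg: "\<And>y. 0 \<le> y \<Longrightarrow> \<bar>gf y\<bar> \<le> Kg" and Kh: "\<And>y. 0 \<le> y \<Longrightarrow> \<bar>hf y\<bar> \<le> Kh"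
    using glued_bounds by blast
  note g = stopped_decay[where k=gf and B=Kg and r=r, OF Kg glued_zero(1) glued_meas(1) pos(2)]
    and h = stopped_decay[where k=hf and B=Kh and r=r, OF Kh glued_zero(2) glued_meas(2) pos(3)]
  let ?g = "\<lambda>v \<omega>. exp (-\<delta> * (stop v \<omega> - r)) * gf (Y (stop v \<omega>) \<omega>)"
  let ?h = "\<lambda>v \<omega>. exp (-\<beta> * (stop v \<omega> - r)) * hf (Y (stop v \<omega>) \<omega>)"
  show "t \<le> v \<Longrightarrow> integrable M (\<lambda>\<omega>. candidate \<mu> \<sigma> \<delta> \<beta> Lmax lam \<alpha> b r (stop v \<omega>) (Y (stop v \<omega>) \<omega>))"
    unfolding candidate_eq by (intro Bochner_Integration.integrable_add g(1) h(1)) auto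
  have "((\<lambda>v. (\<integral>\<omega>. ?g v \<omega> \<partial>M) + (\<integral>\<omega>. ?h v \<omega> \<partial>M) + lam * (1 - \<alpha>)) \<longlongrightarrow> 0 + 0 + lam * (1 - \<alpha>)) at_top"
    by (intro tendsto_add g(2) h(2) tendsto_const) auto
  then have lim: "((\<lambda>v. (\<integral>\<omega>. ?g v \<omega> \<partial>M) + (\<integral>\<omega>. ?h v \<omega> \<partial>M) + lam * (1 - \<alpha>)) \<longlongrightarrow> lam * (1 - \<alpha>)) at_top" by simp
  show "((\<lambda>v. \<integral>\<omega>. candidate \<mu> \<sigma> \<delta> \<beta> Lmax lam \<alpha> b r (stop v \<omega>) (Y (stop v \<omega>) \<omega>) \<partial>M) \<longlongrightarrow> lam * (1 - \<alpha>)) at_top"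
  proof (rule Lim_transform_eventually[OF lim])
    show "\<forall>\<^sub>F v in at_top. (\<integral>\<omega>. ?g v \<omega> \<partial>M) + (\<integral>\<omega>. ?h v \<omega> \<partial>M) + lam * (1 - \<alpha>)
        = (\<integral>\<omega>. candidate \<mu> \<sigma> \<delta> \<beta> Lmax lam \<alpha> b r (stop v \<omega>) (Y (stop v \<omega>) \<omega>) \<partial>M)"
      using eventually_ge_at_top[of t]
    proof eventually_elim
      case (elim v)
      have "integrable M (?g v)" "integrable M (?h v)" using g(1) h(1) elim by auto
      then show ?case unfolding candidate_eq by (simp add: prob_space)
    qed
  qed
qed

lemma reward_threshold_control:
  assumes "X l t x = Y" "l = threshold_control Lmax b"
  shows "reward M X \<delta> \<beta> lam \<alpha> t x l = gf x + hf x + lam * (1 - \<alpha>)"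
proof -
  have "run (\<lambda>r y. 0) = (\<lambda>\<omega>. 0)" by (simp add: run_def fun_eq_iff)
  then show ?thesis unfolding reward_decomposition(1)[where X=X, OF assms(1)] using assms(2) by simp
qed

text \<open>Before \<open>t + h\<close> the integrand of \<open>reward_decomposition\<close> consists of a nonpositive part, by \<open>marginal\<close>, and
  of a part proportional to the difference of the discount factors, which is at most \<open>(\<delta> + \<beta>) * h\<close>.\<close>
lemma reward_short_deviation:
  assumes XY: "X l t x = Y" and h: "0 < h" and late: "\<And>r y. t + h \<le> r \<Longrightarrow> l r y = threshold_control Lmax b r y"
    and H: "\<And>y. 0 \<le> y \<Longrightarrow> \<bar>hD y\<bar> \<le> H" "0 \<le> H"
  shows "reward M X \<delta> \<beta> lam \<alpha> t x l \<le> gf x + hf x + lam * (1 - \<alpha>) + Lmax * H * (\<delta> + \<beta>) * h * h"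
proof -
  let ?dev = "\<lambda>r y. (l r y - threshold_control Lmax b r y) * (exp (-\<delta> * (r - t)) * (1 - gD y) - exp (-\<beta> * (r - t)) * hD y)"
  define B where "B = Lmax * H * (\<delta> + \<beta>) * h"
  have B: "0 \<le> B" using H h pos by (simp add: B_def)
  have bound: "?dev r y \<le> indicator {t..t+h} r * B" if ry: "t \<le> r" "0 \<le> y" for r y
  proof (cases "r < t + h")
    case True
    let ?d = "l r y - threshold_control Lmax b r y"
    have lb: "0 \<le> l r y" "l r y \<le> Lmax" using l_bounds[OF ry] by auto
    have d: "\<bar>?d\<bar> \<le> Lmax" using lb threshold_control_bounds[of r y] by linarith
    have e: "\<bar>exp (-\<delta> * (r - t)) - exp (-\<beta> * (r - t))\<bar> \<le> (\<delta> + \<beta>) * h"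
    proof -
      have "\<bar>exp (-\<delta> * (r - t)) - 1\<bar> \<le> \<delta> * (r - t)" "\<bar>exp (-\<beta> * (r - t)) - 1\<bar> \<le> \<beta> * (r - t)"
        using exp_neg_diff_bounds(1)[of \<delta> 0 "r - t"] exp_neg_diff_bounds(1)[of \<beta> 0 "r - t"] pos ry by auto
      moreover have "\<delta> * (r - t) \<le> \<delta> * h" "\<beta> * (r - t) \<le> \<beta> * h" using True pos by (auto intro!: mult_left_mono)
      ultimately show ?thesis unfolding distrib_right by linarith
    qed
    have "?dev r y = exp (-\<delta> * (r - t)) * (?d * (1 - (gD y + hD y))) + ?d * hD y * (exp (-\<delta> * (r - t)) - exp (-\<beta> * (r - t)))"
      by (simp add: algebra_simps)
    also have "\<dots> \<le> 0 + B"
    proof (rule add_mono)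
      have "?d * (1 - (gD y + hD y)) = - ((threshold_control Lmax b r y - l r y) * (1 - (gD y + hD y)))" by (simp add: algebra_simps)
      then have "?d * (1 - (gD y + hD y)) \<le> 0" using marginal[OF ry(2) lb, of r] by simp
      then show "exp (-\<delta> * (r - t)) * (?d * (1 - (gD y + hD y))) \<le> 0" by (rule mult_nonneg_nonpos[OF exp_ge_zero])
      have "\<bar>?d * hD y * (exp (-\<delta> * (r - t)) - exp (-\<beta> * (r - t)))\<bar> \<le> Lmax * H * ((\<delta> + \<beta>) * h)"
        unfolding abs_mult using d H(1)[OF ry(2)] e H(2) L0 by (intro mult_mono) auto
      then show "?d * hD y * (exp (-\<delta> * (r - t)) - exp (-\<beta> * (r - t))) \<le> B" by (simp add: B_def mult.assoc)
    qed
    finally show ?thesis using True ry by simp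
  next
    case False
    then show ?thesis using late[of r y] B by (simp add: indicator_def)
  qed
  have "run ?dev \<omega> \<le> B * h" if \<omega>: "\<omega> \<in> space M" for \<omega>
  proof -
    have "run ?dev \<omega> \<le> (LINT r|lborel. indicator {t..t+h} r * B)"
      unfolding run_alt
    proof (rule Bochner_Integration.integral_mono)
      have "(\<lambda>r. indicator {s. t \<le> s \<and> ereal s < \<tau> \<omega>} r *\<^sub>R ?dev r (Y r \<omega>)) = (\<lambda>r. if t \<le> r \<and> ereal r < \<tau> \<omega> then ?dev r (Y r \<omega>) else 0)"
        by (auto simp: indicator_def)
      then show "integrable lborel (\<lambda>r. if t \<le> r \<and> ereal r < \<tau> \<omega> then ?dev r (Y r \<omega>) else 0)"
        using run_path_integrable[OF reward_decomposition(2)[where X=X, OF XY] \<omega>] unfolding set_integrable_def by simp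
      show "integrable lborel (\<lambda>r. indicator {t..t+h} r * B)"
        using set_integrable_bounded_Icc[of "\<lambda>_. B" t "t + h" B] B by (simp add: set_integrable_def)
      show "(if t \<le> r \<and> ereal r < \<tau> \<omega> then ?dev r (Y r \<omega>) else 0) \<le> indicator {t..t+h} r * B" for r
      proof (cases "t \<le> r \<and> ereal r < \<tau> \<omega>")
        case True
        then show ?thesis using bound[of r "Y r \<omega>"] pos_before_ruin[of t r Y \<omega>] by auto
      next
        case False
        then show ?thesis using B by (simp only: if_False) simp
      qed
    qed
    also have "\<dots> = B * h" using set_integral_Icc_const[of t "t + h" B] h by (simp add: set_lebesgue_integral_def)
    finally show ?thesis .
  qed
  then have "(\<integral>\<omega>. run ?dev \<omega> \<partial>M) \<le> (\<integral>\<omega>. B * h \<partial>M)"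
    by (intro Bochner_Integration.integral_mono run_integrable[OF reward_decomposition(2)[where X=X, OF XY]]) auto
  then show ?thesis unfolding reward_decomposition(1)[where X=X, OF XY] by (simp add: prob_space B_def)
qed

end

lemma threshold_control_in_controls: "0 < Lmax \<Longrightarrow> threshold_control Lmax b \<in> controls Lmax"
proof -
  assume "0 < Lmax"
  have "(\<lambda>y::real. if y < b then 0 else Lmax) \<in> borel_measurable borel" by measurable
  from quadrant_meas_snd[OF this] \<open>0 < Lmax\<close> show ?thesis
    unfolding controls_def threshold_control_def by auto
qed

lemma deviation_in_controls:
  assumes "l \<in> controls Lmax" "l' \<in> controls Lmax" shows "deviation t h l l' \<in> controls Lmax"
proof -
  let ?R = "restrict_space borel ({0..} \<times> {0..}) :: (real \<times> real) measure"
  have "(\<lambda>p::real\<times>real. fst p) \<in> borel_measurable ?R"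
    by (rule measurable_restrict_space1, rule borel_measurable_continuous_onI) (intro continuous_intros)
  then have [measurable]: "Measurable.pred ?R (\<lambda>p. t \<le> fst p \<and> fst p < t + h)" by measurable
  have [measurable]: "(\<lambda>p. l (fst p) (snd p)) \<in> borel_measurable ?R" "(\<lambda>p. l' (fst p) (snd p)) \<in> borel_measurable ?R"
    using assms by (auto simp: controls_def)
  have "(\<lambda>p. deviation t h l l' (fst p) (snd p)) \<in> borel_measurable ?R"
    unfolding deviation_def by measurable
  then show ?thesis using assms by (auto simp: controls_def deviation_def)
qed

theorem theorem3:
  fixes M :: "'a measure" and F :: "real \<Rightarrow> 'a measure" and W :: "real \<Rightarrow> 'a \<Rightarrow> real"
    and X :: "'a process_family"
    and \<mu> \<sigma> \<delta> \<beta> Lmax lam \<alpha> bs :: real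
  assumes "brownian_motion M F W"
    and "\<sigma> > 0" and "\<delta> > 0" and "\<beta> > 0" and "Lmax > 0"
    and "lam \<le> 0" and "0 < \<alpha>" and "\<alpha> \<le> 1"
    and "\<And>l t x. \<lbrakk>l \<in> controls Lmax; 0 \<le> t; 0 \<le> x\<rbrakk> \<Longrightarrow>
           controlled_process M F W \<mu> \<sigma> l t x (X l t x)"
    and "(- root2 (\<mu> - Lmax) \<sigma> \<delta>) * (Lmax / \<delta>) + lam * root2 (\<mu> - Lmax) \<sigma> \<beta> - 1 > 0"
    and "bs = (THE b. 0 < b \<and> threshold_fun \<mu> \<sigma> \<delta> \<beta> Lmax lam b = 0)"
  shows "extended_HJB M X \<mu> \<sigma> \<delta> \<beta> lam \<alpha> Lmax bs (threshold_control Lmax bs)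
           (candidate \<mu> \<sigma> \<delta> \<beta> Lmax lam \<alpha> bs)
       \<and> equilibrium_control M X \<delta> \<beta> lam \<alpha> Lmax (threshold_control Lmax bs)
       \<and> equilibrium_value_function M X \<delta> \<beta> lam \<alpha> Lmax (threshold_control Lmax bs)
           (\<lambda>t x. candidate \<mu> \<sigma> \<delta> \<beta> Lmax lam \<alpha> bs t t x)"
proof -
  have dp: "dividend_problem \<sigma> \<delta> \<beta> Lmax lam" using assms(2-6) by unfold_locales
  have "0 < bs \<and> threshold_fun \<mu> \<sigma> \<delta> \<beta> Lmax lam bs = 0"
    unfolding assms(11) by (rule theI'[OF dividend_problem.threshold_unique[OF dp assms(10)]])
  then have tp: "threshold_problem \<mu> \<sigma> \<delta> \<beta> Lmax lam bs"
    using dp by (simp add: threshold_problem_def threshold_problem_axioms_def)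
  interpret T: threshold_problem \<mu> \<sigma> \<delta> \<beta> Lmax lam bs by (rule tp)
  let ?lh = "threshold_control Lmax bs"
  let ?\<nu> = "candidate \<mu> \<sigma> \<delta> \<beta> Lmax lam \<alpha> bs"
  have lh: "?lh \<in> controls Lmax" using assms(5) by (rule threshold_control_in_controls)
  have ct: "controlled_threshold M F W \<mu> \<sigma> Lmax t x l (X l t x) \<delta> \<beta> lam bs"
    if "l \<in> controls Lmax" "0 \<le> t" "0 \<le> x" for l t x
    using assms(1,2,5) assms(9)[OF that] that tp
    by (simp add: controlled_threshold_def controlled_def controlled_axioms_def)
  have hjb: "extended_HJB M X \<mu> \<sigma> \<delta> \<beta> lam \<alpha> Lmax bs ?lh ?\<nu>"
    unfolding extended_HJB_def Let_def
  proof (intro conjI allI impI)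
    show "smooth_off bs (?\<nu> r)" for r by (rule T.candidate_smooth_off)
    fix t x :: real assume t: "0 \<le> t" and x: "0 \<le> x"
    show "(SUP c\<in>{0..Lmax}. generator \<mu> \<sigma> c (?\<nu> t) t x + running \<delta> \<beta> lam t t c) = 0"
      using t x by (rule T.candidate_solves_supremum)
    show "?lh t x \<in> {0..Lmax}" using T.threshold_control_bounds by simp
    have gen: "generator \<mu> \<sigma> (?lh t x) (?\<nu> r) t x + running \<delta> \<beta> lam r t (?lh t x) = 0" for r
      using T.candidate_generator[OF t x] by simp
    show "generator \<mu> \<sigma> (?lh t x) (?\<nu> t) t x + running \<delta> \<beta> lam t t (?lh t x) = 0" by (rule gen)
    show "generator \<mu> \<sigma> (?lh t x) (?\<nu> r) t x + running \<delta> \<beta> lam r t (?lh t x) = 0" for r by (rule gen)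
    interpret P: controlled_threshold M F W \<mu> \<sigma> Lmax t x ?lh "X ?lh t x" \<delta> \<beta> lam bs
      by (rule ct[OF lh t x])
    show "integrable M (\<lambda>\<omega>. ?\<nu> r (real_of_ereal (min (ereal w) (ruin_time t (X ?lh t x) \<omega>)))
        (X ?lh t x (real_of_ereal (min (ereal w) (ruin_time t (X ?lh t x) \<omega>))) \<omega>))" if "t \<le> w" for r w
      using P.terminal_condition(1)[OF that] unfolding P.stop_def .
    show "((\<lambda>w. \<integral>\<omega>. ?\<nu> r (real_of_ereal (min (ereal w) (ruin_time t (X ?lh t x) \<omega>)))
        (X ?lh t x (real_of_ereal (min (ereal w) (ruin_time t (X ?lh t x) \<omega>))) \<omega>) \<partial>M) \<longlongrightarrow> lam * (1 - \<alpha>)) at_top" for r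
      using P.terminal_condition(2) unfolding P.stop_def .
  qed
  have lh_value: "reward M X \<delta> \<beta> lam \<alpha> t x ?lh = T.gf x + T.hf x + lam * (1 - \<alpha>)" if "0 \<le> t" "0 \<le> x" for t x
    using controlled_threshold.reward_threshold_control[where X=X, OF ct[OF lh that] refl refl] .
  have eq: "equilibrium_control M X \<delta> \<beta> lam \<alpha> Lmax ?lh"
    unfolding equilibrium_control_def
  proof (intro conjI ballI allI impI lh)
    fix l and t x :: real assume l: "l \<in> controls Lmax" and t: "0 \<le> t" and x: "0 \<le> x"
    obtain K where K: "0 \<le> K" "\<And>y. 0 \<le> y \<Longrightarrow> \<bar>T.hD y\<bar> \<le> K" using T.glued_bounds(2) by blast
    define c where "c = Lmax * K * (\<delta> + \<beta>)"
    let ?q = "\<lambda>h. (reward M X \<delta> \<beta> lam \<alpha> t x ?lh - reward M X \<delta> \<beta> lam \<alpha> t x (deviation t h l ?lh)) / h"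
    \<comment> \<open>The deviation gains at most \<open>c * h * h\<close>, so the quotient is bounded below by a
      function that tends to \<open>0\<close>.\<close>
    have q: "- c * h \<le> ?q h" if h: "0 < h" for h
    proof -
      interpret P: controlled_threshold M F W \<mu> \<sigma> Lmax t x "deviation t h l ?lh" "X (deviation t h l ?lh) t x" \<delta> \<beta> lam bs
        by (rule ct[OF deviation_in_controls[OF l lh] t x])
      have "reward M X \<delta> \<beta> lam \<alpha> t x (deviation t h l ?lh) \<le> T.gf x + T.hf x + lam * (1 - \<alpha>) + c * h * h"
        unfolding c_def by (rule P.reward_short_deviation[where X=X, OF refl h _ K(2,1)]) (simp add: deviation_def)
      then show ?thesis using h unfolding lh_value[OF t x] by (simp add: field_simps)
    qed
    have "((\<lambda>h. ereal (- c * h)) \<longlongrightarrow> ereal (- c * 0)) (at_right 0)"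
      by (intro tendsto_intros)
    then have "Liminf (at_right 0) (\<lambda>h. ereal (- c * h)) = 0"
      using lim_imp_Liminf[OF trivial_limit_at_right_real] by (metis mult_zero_right zero_ereal_def)
    moreover have "Liminf (at_right 0) (\<lambda>h. ereal (- c * h)) \<le> Liminf (at_right 0) (\<lambda>h. ereal (?q h))"
      by (rule Liminf_mono) (use q in \<open>auto simp: eventually_at_filter\<close>)
    ultimately show "0 \<le> Liminf (at_right 0) (\<lambda>h. ereal (?q h))" by simp
  qed
  have "equilibrium_value_function M X \<delta> \<beta> lam \<alpha> Lmax ?lh (\<lambda>t x. ?\<nu> t t x)"
    unfolding equilibrium_value_function_def using eq lh_value by (auto simp: T.candidate_eq)
  then show ?thesis using hjb eq by blast
qed

end
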